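(* (Verification and separation.) In the controlled homodyne model of the context, let $V_l:\mathcal{S}\to\mathbb{R}$, $l=0,\ldots,k$, be defined by the Bellman recursion $$V_k(\rho)=\mathrm{Tr}[\rho K],\qquad V_l(\rho)=\inf_{u\in\mathfrak{U}}\Bigl[\mathrm{Tr}[\rho Q(u)]\,\lambda^2+\sum_{\Delta y=\pm\lambda}p(\Delta y;\rho,u)\,V_{l+1}(\Gamma(\rho,u,\Delta y))\Bigr],\quad l<k .$$ Suppose that all the infima in this recursion are attained, and let $\mu^*=\{g_0^*,\ldots,g_{k-1}^*\}\in\mathfrak{K}_S$ be any separated strategy such that, for each $l<k$ and $\rho\in\mathcal{S}$, $g_l^*(\rho)\in\mathfrak{U}$ is a minimizer of the expression in brackets. Then $\mu^*$ is optimal in $\mathfrak{K}$, i.e. $J(\mu^* )\le J(\mu)$ for every admissible strategy $\mu\in\mathfrak{K}$. Moreover $V_l(\rho)=W_l(\mu^*,\rho)$ for every $l$ and all $\rho$ reachable under $\mu^*$ at time $l$ (i.e. $\mathbf{P}^{\mu^*}(\rho_l^{\mu^*}=\rho)>0$), and in particular $V_0(\rho_0)=J(\mu^* )$.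
   Context: Let $\mathscr{M}=M_2(\mathbb{C})$, $\sigma_-=\begin{pmatrix}0&0\\1&0\end{pmatrix}$, $\sigma_+=\sigma_-^*$, $\Phi=(0,1)^T$, $\phi(X)=\langle\Phi,X\Phi\rangle$, $k\in\mathbb{N}$, $T>0$, $\lambda=\sqrt{T/k}$, $\mathscr{W}_k=\mathscr{M}^{\otimes k}$, $\mathcal{S}$ the set of $2\times2$ density matrices (nonnegative, unit trace), $\rho_0\in\mathcal{S}$, and $\mathbb{P}=\mathrm{Tr}[\rho_0\,\cdot\,]\otimes\phi^{\otimes k}$ on $\mathscr{M}\otimes\mathscr{W}_k$. $X\in\mathscr{M}$ is identified with $X\otimes I$; $X_i$ is $X$ in the $i$-th factor of $\mathscr{W}_k$. $\Delta A(i)=\lambda(\sigma_-)_i$, $\Delta A^*(i)=\lambda(\sigma_+)_i$, $\Delta\Lambda(i)=(\sigma_+\sigma_-)_i$, $\Delta t(i)=\lambda^2I$, $\Delta Z(i)=\Delta A(i)+\Delta A^*(i)$. Control set $\mathfrak{U}\subset\mathbb{R}$ (nonempty); for each $u\in\mathfrak{U}$ matrices $L_1(u),L_2(u),L_3(u)\in\mathscr{M}$ with $L_1(u),L_3(u)$ self-adjoint; $M_l(u)=\exp(-i\{L_1(u)\Delta\Lambda(l)+L_2(u)\Delta A^*(l)+L_2(u)^*\Delta A(l)+L_3(u)\Delta t(l)\})=I+M^\pm(u)\Delta\Lambda(l)+M^+(u)\Delta A^*(l)+M^-(u)\Delta A(l)+M^\circ(u)\Delta t(l)$ with unique $M^{\pm,+,-,\circ}(u)\in\mathscr{M}$.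 Admissible strategies $\mathfrak{K}$: $\mu=\{f_1,\ldots,f_k\}$ with $f_l:\{\pm\lambda\}^{l-1}\to\mathfrak{U}$. Put $\check{\mathfrak{u}}_l=f_l(\Delta Z(1),\ldots,\Delta Z(l-1))$ (joint functional calculus), and for an operator-valued function $F$ on $\mathfrak{U}$ set $F(\check{\mathfrak{u}}_l)=\sum_{u}F(u)P_{\check{\mathfrak{u}}_l}(u)$, with $P_{\check{\mathfrak u}_l}(u)$ the eigenprojector of $\check{\mathfrak{u}}_l$ for eigenvalue $u$. $U^\mu(0)=I$, $U^\mu(l)=M_l(\check{\mathfrak{u}}_l)\cdots M_1(\check{\mathfrak{u}}_1)$, $j_l^\mu(X)=U^\mu(l)^*XU^\mu(l)$, $\Delta Y^\mu(l)=U^\mu(l)^*\Delta Z(l)U^\mu(l)$. The observables $\Delta Y^\mu(1),\dots,\Delta Y^\mu(k)$ commute and correspond (by simultaneous diagonalization) to classical $\{\pm\lambda\}$-valued random variables $\Delta y^\mu_1,\ldots,\Delta y^\mu_k$ on a finite probability space with measure $\mathbf{P}^\mu$, expectation $\mathbf{E}^\mu$. Cost: $Q:\mathfrak{U}\to\mathscr{M}$, $K\in\mathscr{M}$ with $Q(u),K$ self-adjoint and nonnegative, and $J(\mu)=\mathbb{P}\bigl[\sum_{l=1}^kj_{l-1}^\mu(Q(\check{\mathfrak{u}}_l))\Delta t(l)+j_k^\mu(K)\bigr]$. Filter: define $\overline{\mathcal{L}}(\rho,u)=M^+(u)\rho M^+(u)^*+\lambda^2M^\circ(u)\rho M^\circ(u)^*+M^\circ(u)\rho+\rho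 M^\circ(u)^*$, $\overline{\mathcal{J}}(\rho,u)=M^+(u)\rho+\rho M^+(u)^*+\lambda^2M^+(u)\rho M^\circ(u)^*+\lambda^2M^\circ(u)\rho M^+(u)^*$, $$\Gamma(\rho,u,\Delta y)=\rho+\lambda^2\overline{\mathcal{L}}(\rho,u)+\frac{\overline{\mathcal{J}}(\rho,u)-\mathrm{Tr}[\overline{\mathcal{J}}(\rho,u)](\rho+\lambda^2\overline{\mathcal{L}}(\rho,u))}{1-\lambda^2\mathrm{Tr}[\overline{\mathcal{J}}(\rho,u)]^2}\bigl(\Delta y-\lambda^2\mathrm{Tr}[\overline{\mathcal{J}}(\rho,u)]\bigr),$$ $p(\Delta y=\pm\lambda;\rho,u)=\frac12\pm\frac\lambda2\mathrm{Tr}[\overline{\mathcal{J}}(\rho,u)]$. If the denominator of $\Gamma$ vanishes, the fraction term is read as $0$ for the value of $\Delta y$ with $p=1$, and terms with $p=0$ are omitted from sums. The conditional density matrix is $\rho_0^\mu=\rho_0$, $\rho^\mu_l=\Gamma(\rho^\mu_{l-1},u^\mu_l,\Delta y^\mu_l)$ with $u^\mu_l=f_l(\Delta y_1^\mu,\ldots,\Delta y_{l-1}^\mu)$. Separated strategies $\mathfrak{K}_S\subset\mathfrak{K}$: those given by functions $g_0,\ldots,g_{k-1}:\mathcal{S}\to\mathfrak{U}$ through $u_l^\mu=g_{l-1}(\rho_{l-1}^\mu)$. The cost-to-go of $\mu\in\mathfrak{K}_S$ is $W_l(\mu,\rho)=\mathbf{E}^\mu\bigl[\sum_{i=l+1}^k\mathrm{Tr}[\rho^\mu_{i-1}Q(u_i^\mu)]\lambda^2+\mathrm{Tr}[\rho_k^\mu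 K]\,\big|\,\rho_l^\mu=\rho\bigr]$ (equivalently, for all $\rho\in\mathcal S$, it is given by $W_k(\mu,\rho)=\mathrm{Tr}[\rho K]$, $W_l(\mu,\rho)=\mathrm{Tr}[\rho Q(g_l(\rho))]\lambda^2+\sum_{\Delta y=\pm\lambda}p(\Delta y;\rho,g_l(\rho))W_{l+1}(\mu,\Gamma(\rho,g_l(\rho),\Delta y))$). *)

theory Defs
  imports "HOL-Probability.Probability" "Jordan_Normal_Form.Schur_Decomposition"
begin

unbundle no vec_syntax
unbundle no inner_syntax
hide_const (open) Finite_Cartesian_Product.mat Finite_Cartesian_Product.vec

section \<open>Finite-dimensional operators\<close>

definition mtrace :: "complex mat \<Rightarrow> complex" where
  "mtrace A = (\<Sum>i<dim_row A. A $$ (i, i))"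

definition nonneg_mat :: "nat \<Rightarrow> complex mat \<Rightarrow> bool" where
  "nonneg_mat n A \<longleftrightarrow> A \<in> carrier_mat n n \<and> mat_adjoint A = A \<and>
     (\<forall>v\<in>carrier_vec n. 0 \<le> Re ((A *\<^sub>v v) \<bullet>c v))"

definition density_mats :: "complex mat set" where
  "density_mats = {\<rho>. nonneg_mat 2 \<rho> \<and> mtrace \<rho> = 1}"

definition msum :: "nat \<Rightarrow> ('a \<Rightarrow> complex mat) \<Rightarrow> 'a set \<Rightarrow> complex mat" where
  "msum n F S = mat n n (\<lambda>(i, j). \<Sum>x\<in>S. F x $$ (i, j))"

definition mprod :: "nat \<Rightarrow> complex mat list \<Rightarrow> complex mat" where
  "mprod n As = foldr (*) As (1\<^sub>m n)"

definition mexp :: "complex mat \<Rightarrow> complex mat" where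
  "mexp A = mat (dim_row A) (dim_row A) (\<lambda>(i, j). \<Sum>m. (A ^\<^sub>m m) $$ (i, j) / fact m)"

text \<open>The orthogonal projector onto the eigenspace of \<open>A\<close> for \<open>a\<close> (so \<open>0\<close> if \<open>a\<close> is not an
  eigenvalue); a projector is determined by its range, which is its set of fixed vectors.\<close>

definition eigenproj :: "complex mat \<Rightarrow> real \<Rightarrow> complex mat" where
  "eigenproj A a = (THE P. P \<in> carrier_mat (dim_row A) (dim_row A) \<and> P * P = P \<and> mat_adjoint P = P \<and>
     (\<forall>v\<in>carrier_vec (dim_row A). P *\<^sub>v v = v \<longleftrightarrow> A *\<^sub>v v = complex_of_real a \<cdot>\<^sub>v v))"

definition kron :: "complex mat \<Rightarrow> complex mat \<Rightarrow> complex mat" where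
  "kron A B = mat (dim_row A * dim_row B) (dim_col A * dim_col B)
     (\<lambda>(i, j). A $$ (i div dim_row B, j div dim_col B) * B $$ (i mod dim_row B, j mod dim_col B))"

definition tensor_list :: "complex mat list \<Rightarrow> complex mat" where
  "tensor_list As = foldr kron As (1\<^sub>m 1)"

definition sigma_minus :: "complex mat" where
  "sigma_minus = mat_of_rows_list 2 [[0, 0], [1, 0]]"

definition sigma_plus :: "complex mat" where
  "sigma_plus = mat_adjoint sigma_minus"

definition vac_vec :: "complex vec" where
  "vac_vec = vec_of_list [0, 1]"

definition vac_state :: "complex mat \<Rightarrow> complex" where
  "vac_state X = (X *\<^sub>v vac_vec) \<bullet>c vac_vec"

text \<open>The rank one projector onto \<open>vac_vec\<close>, i.e. the density matrix of \<open>vac_state\<close>.\<close>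

definition vac_proj :: "complex mat" where
  "vac_proj = mat 2 2 (\<lambda>(i, j). vac_vec $ i * cnj (vac_vec $ j))"

section \<open>The controlled homodyne model\<close>

record homodyne =
  nsteps :: nat
  horizon :: real
  rho0 :: "complex mat"
  ctrls :: "real set"
  L1 :: "real \<Rightarrow> complex mat"
  L2 :: "real \<Rightarrow> complex mat"
  L3 :: "real \<Rightarrow> complex mat"
  Qcost :: "real \<Rightarrow> complex mat"
  Kcost :: "complex mat"

definition homodyne_model :: "homodyne \<Rightarrow> bool" where
  "homodyne_model H \<longleftrightarrow>
     0 < nsteps H \<and> 0 < horizon H \<and> rho0 H \<in> density_mats \<and> ctrls H \<noteq> {} \<and>
     (\<forall>u\<in>ctrls H. L1 H u \<in> carrier_mat 2 2 \<and> L2 H u \<in> carrier_mat 2 2 \<and> L3 H u \<in> carrier_mat 2 2 \<and>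
        mat_adjoint (L1 H u) = L1 H u \<and> mat_adjoint (L3 H u) = L3 H u \<and> nonneg_mat 2 (Qcost H u)) \<and>
     nonneg_mat 2 (Kcost H)"

definition lam :: "homodyne \<Rightarrow> real" where
  "lam H = sqrt (horizon H / real (nsteps H))"

text \<open>The total space is \<open>\<complex>\<^sup>2 \<otimes> (\<complex>\<^sup>2)\<^sup>\<otimes>\<^sup>k\<close>: slot \<open>0\<close> carries the system, slots \<open>1, \<dots>, k\<close> the field.\<close>

abbreviation tdim :: "homodyne \<Rightarrow> nat" where
  "tdim H \<equiv> 2 ^ Suc (nsteps H)"

definition slot :: "homodyne \<Rightarrow> nat \<Rightarrow> complex mat \<Rightarrow> complex mat" where
  "slot H i X = tensor_list ((replicate (Suc (nsteps H)) (1\<^sub>m 2))[i := X])"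

definition dA :: "homodyne \<Rightarrow> nat \<Rightarrow> complex mat" where
  "dA H l = complex_of_real (lam H) \<cdot>\<^sub>m slot H l sigma_minus"

definition dAstar :: "homodyne \<Rightarrow> nat \<Rightarrow> complex mat" where
  "dAstar H l = complex_of_real (lam H) \<cdot>\<^sub>m slot H l sigma_plus"

definition dLambda :: "homodyne \<Rightarrow> nat \<Rightarrow> complex mat" where
  "dLambda H l = slot H l (sigma_plus * sigma_minus)"

definition dt :: "homodyne \<Rightarrow> nat \<Rightarrow> complex mat" where
  "dt H l = complex_of_real ((lam H)\<^sup>2) \<cdot>\<^sub>m 1\<^sub>m (tdim H)"

definition dZ :: "homodyne \<Rightarrow> nat \<Rightarrow> complex mat" where
  "dZ H l = dA H l + dAstar H l"

text \<open>The state \<open>Tr[\<rho>\<^sub>0 \<cdot>] \<otimes> \<phi>\<^sup>\<otimes>\<^sup>k\<close>, through its density matrix; on elementary tensors it is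
  the product of the factor states (lemma \<open>qstate_tensor\<close> below).\<close>

definition qstate :: "homodyne \<Rightarrow> complex mat \<Rightarrow> complex" where
  "qstate H Z = mtrace (tensor_list (rho0 H # replicate (nsteps H) vac_proj) * Z)"

definition Mstep :: "homodyne \<Rightarrow> nat \<Rightarrow> real \<Rightarrow> complex mat" where
  "Mstep H l u = mexp ((- \<i>) \<cdot>\<^sub>m
     (slot H 0 (L1 H u) * dLambda H l + slot H 0 (L2 H u) * dAstar H l
      + slot H 0 (mat_adjoint (L2 H u)) * dA H l + slot H 0 (L3 H u) * dt H l))"

text \<open>The unique coefficients \<open>(M\<^sup>\<plusminus>, M\<^sup>+, M\<^sup>-, M\<^sup>\<circ>)\<close>; they do not depend on the slot \<open>l\<close>.\<close>

definition Mcoeffs :: "homodyne \<Rightarrow> real \<Rightarrow> complex mat \<times> complex mat \<times> complex mat \<times> complex mat" where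
  "Mcoeffs H u = (THE (Mpm, Mp, Mm, Mo).
     Mpm \<in> carrier_mat 2 2 \<and> Mp \<in> carrier_mat 2 2 \<and> Mm \<in> carrier_mat 2 2 \<and> Mo \<in> carrier_mat 2 2 \<and>
     (\<forall>l\<in>{1..nsteps H}. Mstep H l u =
        1\<^sub>m (tdim H) + slot H 0 Mpm * dLambda H l + slot H 0 Mp * dAstar H l
        + slot H 0 Mm * dA H l + slot H 0 Mo * dt H l))"

definition Mplus :: "homodyne \<Rightarrow> real \<Rightarrow> complex mat" where
  "Mplus H u = fst (snd (Mcoeffs H u))"

definition Mcirc :: "homodyne \<Rightarrow> real \<Rightarrow> complex mat" where
  "Mcirc H u = snd (snd (snd (Mcoeffs H u)))"

section \<open>Control strategies\<close>

definition records :: "homodyne \<Rightarrow> nat \<Rightarrow> real list set" where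
  "records H n = {ys. length ys = n \<and> set ys \<subseteq> {lam H, - lam H}}"

text \<open>\<open>\<mu> l\<close> is the control function \<open>f\<^sub>l\<close>, evaluated on lists \<open>[y\<^sub>1, \<dots>, y\<^bsub>l-1\<^esub>]\<close>.\<close>

type_synonym strategy = "nat \<Rightarrow> real list \<Rightarrow> real"

definition admissible :: "homodyne \<Rightarrow> strategy \<Rightarrow> bool" where
  "admissible H \<mu> \<longleftrightarrow> (\<forall>l\<in>{1..nsteps H}. \<forall>ys\<in>records H (l - 1). \<mu> l ys \<in> ctrls H)"

text \<open>\<open>f\<^sub>l(\<Delta>Z(1), \<dots>, \<Delta>Z(l-1))\<close> by joint functional calculus of the commuting observables \<open>\<Delta>Z(i)\<close>.\<close>

definition ctrl_op :: "homodyne \<Rightarrow> strategy \<Rightarrow> nat \<Rightarrow> complex mat" where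
  "ctrl_op H \<mu> l = msum (tdim H)
     (\<lambda>ys. complex_of_real (\<mu> l ys) \<cdot>\<^sub>m
        mprod (tdim H) (map (\<lambda>i. eigenproj (dZ H i) (ys ! (i - 1))) [1..<l]))
     (records H (l - 1))"

definition at_ctrl :: "homodyne \<Rightarrow> strategy \<Rightarrow> nat \<Rightarrow> (real \<Rightarrow> complex mat) \<Rightarrow> complex mat" where
  "at_ctrl H \<mu> l F = msum (tdim H) (\<lambda>u. F u * eigenproj (ctrl_op H \<mu> l) u)
     {u \<in> ctrls H. eigenvalue (ctrl_op H \<mu> l) (complex_of_real u)}"

primrec Uop :: "homodyne \<Rightarrow> strategy \<Rightarrow> nat \<Rightarrow> complex mat" where
  "Uop H \<mu> 0 = 1\<^sub>m (tdim H)"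
| "Uop H \<mu> (Suc l) = at_ctrl H \<mu> (Suc l) (Mstep H (Suc l)) * Uop H \<mu> l"

definition jflow :: "homodyne \<Rightarrow> strategy \<Rightarrow> nat \<Rightarrow> complex mat \<Rightarrow> complex mat" where
  "jflow H \<mu> l X = mat_adjoint (Uop H \<mu> l) * X * Uop H \<mu> l"

definition dY :: "homodyne \<Rightarrow> strategy \<Rightarrow> nat \<Rightarrow> complex mat" where
  "dY H \<mu> l = jflow H \<mu> l (dZ H l)"

text \<open>\<open>J(\<mu>)\<close> is the expectation of a self-adjoint operator, hence real.\<close>

definition Jcost :: "homodyne \<Rightarrow> strategy \<Rightarrow> real" where
  "Jcost H \<mu> = Re (qstate H
     (msum (tdim H) (\<lambda>l. jflow H \<mu> (l - 1) (at_ctrl H \<mu> l (\<lambda>u. slot H 0 (Qcost H u))) * dt H l)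
        {1..nsteps H}
      + jflow H \<mu> (nsteps H) (slot H 0 (Kcost H))))"

text \<open>Law of the observation record \<open>(\<Delta>y\<^sub>1, \<dots>, \<Delta>y\<^sub>k)\<close>: its weights are the expectations of the joint
  spectral projectors of the commuting observables \<open>\<Delta>Y(1), \<dots>, \<Delta>Y(k)\<close>.\<close>

definition record_pmf :: "homodyne \<Rightarrow> strategy \<Rightarrow> real list pmf" where
  "record_pmf H \<mu> = embed_pmf (\<lambda>ys. if ys \<in> records H (nsteps H)
     then Re (qstate H (mprod (tdim H) (map (\<lambda>l. eigenproj (dY H \<mu> l) (ys ! (l - 1))) [1..<Suc (nsteps H)])))
     else 0)"

section \<open>The filter\<close>

definition Lbar :: "homodyne \<Rightarrow> complex mat \<Rightarrow> real \<Rightarrow> complex mat" where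
  "Lbar H \<rho> u = Mplus H u * \<rho> * mat_adjoint (Mplus H u)
     + complex_of_real ((lam H)\<^sup>2) \<cdot>\<^sub>m (Mcirc H u * \<rho> * mat_adjoint (Mcirc H u))
     + Mcirc H u * \<rho> + \<rho> * mat_adjoint (Mcirc H u)"

definition Jbar :: "homodyne \<Rightarrow> complex mat \<Rightarrow> real \<Rightarrow> complex mat" where
  "Jbar H \<rho> u = Mplus H u * \<rho> + \<rho> * mat_adjoint (Mplus H u)
     + complex_of_real ((lam H)\<^sup>2) \<cdot>\<^sub>m (Mplus H u * \<rho> * mat_adjoint (Mcirc H u))
     + complex_of_real ((lam H)\<^sup>2) \<cdot>\<^sub>m (Mcirc H u * \<rho> * mat_adjoint (Mplus H u))"

text \<open>\<open>Tr[\<J>(\<rho>, u)]\<close>, real since \<open>Jbar\<close> preserves self-adjointness in \<open>\<rho>\<close>.\<close>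

definition trJ :: "homodyne \<Rightarrow> complex mat \<Rightarrow> real \<Rightarrow> real" where
  "trJ H \<rho> u = Re (mtrace (Jbar H \<rho> u))"

text \<open>If the denominator vanishes, one of the two outcomes \<open>\<plusminus>\<lambda>\<close> is certain and the fraction is read
  as \<open>0\<close>. (The same value is used for the null outcome, where it is irrelevant.)\<close>

definition Gam :: "homodyne \<Rightarrow> complex mat \<Rightarrow> real \<Rightarrow> real \<Rightarrow> complex mat" where
  "Gam H \<rho> u y =
     (let R = \<rho> + complex_of_real ((lam H)\<^sup>2) \<cdot>\<^sub>m Lbar H \<rho> u;
          t = trJ H \<rho> u;
          d = 1 - (lam H)\<^sup>2 * t\<^sup>2
      in if d = 0 then R
         else R + complex_of_real ((y - (lam H)\<^sup>2 * t) / d) \<cdot>\<^sub>m (Jbar H \<rho> u - complex_of_real t \<cdot>\<^sub>m R))"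

text \<open>\<open>p(\<Delta>y = y; \<rho>, u)\<close>, meant for \<open>y = \<plusminus>\<lambda>\<close>.\<close>

definition ptrans :: "homodyne \<Rightarrow> complex mat \<Rightarrow> real \<Rightarrow> real \<Rightarrow> real" where
  "ptrans H \<rho> u y = 1 / 2 + y / 2 * trJ H \<rho> u"

text \<open>\<open>\<rho>\<^sub>l\<close> and \<open>u\<^sub>l\<close> as random variables on records \<open>ys = [y\<^sub>1, \<dots>, y\<^sub>k]\<close>; only the first \<open>l\<close>,
  respectively \<open>l - 1\<close>, entries are used.\<close>

definition uctrl :: "strategy \<Rightarrow> nat \<Rightarrow> real list \<Rightarrow> real" where
  "uctrl \<mu> l ys = \<mu> l (take (l - 1) ys)"

primrec filt :: "homodyne \<Rightarrow> strategy \<Rightarrow> nat \<Rightarrow> real list \<Rightarrow> complex mat" where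
  "filt H \<mu> 0 ys = rho0 H"
| "filt H \<mu> (Suc l) ys = Gam H (filt H \<mu> l ys) (uctrl \<mu> (Suc l) ys) (ys ! l)"

text \<open>\<open>\<mu>\<close> is given by \<open>g\<^sub>0, \<dots>, g\<^bsub>k-1\<^esub>\<close>. The identity \<open>u\<^sub>l = g\<^bsub>l-1\<^esub>(\<rho>\<^bsub>l-1\<^esub>)\<close> of random variables is required
  on the records of positive probability, so no convention for null records enters.\<close>

definition separated :: "homodyne \<Rightarrow> (nat \<Rightarrow> complex mat \<Rightarrow> real) \<Rightarrow> strategy \<Rightarrow> bool" where
  "separated H g \<mu> \<longleftrightarrow> admissible H \<mu> \<and>
     (\<forall>l<nsteps H. \<forall>\<rho>\<in>density_mats. g l \<rho> \<in> ctrls H) \<and>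
     (\<forall>ys\<in>set_pmf (record_pmf H \<mu>). \<forall>l\<in>{1..nsteps H}.
        uctrl \<mu> l ys = g (l - 1) (filt H \<mu> (l - 1) ys))"

text \<open>Conditional expectation given \<open>\<rho>\<^sub>l = \<rho>\<close>; meaningful only if this event has positive probability.\<close>

definition cost_to_go :: "homodyne \<Rightarrow> strategy \<Rightarrow> nat \<Rightarrow> complex mat \<Rightarrow> real" where
  "cost_to_go H \<mu> l \<rho> =
     measure_pmf.expectation (cond_pmf (record_pmf H \<mu>) {ys. filt H \<mu> l ys = \<rho>})
       (\<lambda>ys. (\<Sum>i\<in>{l + 1..nsteps H}.
                Re (mtrace (filt H \<mu> (i - 1) ys * Qcost H (uctrl \<mu> i ys))) * (lam H)\<^sup>2)
             + Re (mtrace (filt H \<mu> (nsteps H) ys * Kcost H)))"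

text \<open>The bracket in the Bellman recursion. A null outcome contributes \<open>0\<close>, i.e. is omitted.\<close>

definition bellman :: "homodyne \<Rightarrow> (nat \<Rightarrow> complex mat \<Rightarrow> real) \<Rightarrow> nat \<Rightarrow> complex mat \<Rightarrow> real \<Rightarrow> real" where
  "bellman H V l \<rho> u = Re (mtrace (\<rho> * Qcost H u)) * (lam H)\<^sup>2
     + (\<Sum>y\<in>{lam H, - lam H}. ptrans H \<rho> u y * V (Suc l) (Gam H \<rho> u y))"

section \<open>The state on elementary tensors\<close>

lemma kron_dims [simp]:
  "dim_row (kron A B) = dim_row A * dim_row B" "dim_col (kron A B) = dim_col A * dim_col B"
  by (auto simp: kron_def)

lemma sum_mult_split:
  fixes f :: "nat \<Rightarrow> nat \<Rightarrow> complex"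
  shows "(\<Sum>i<m * n. f (i div n) (i mod n)) = (\<Sum>a<m. \<Sum>b<n. f a b)"
proof (cases "n = 0")
  case False
  have bound: "a * n + b < m * n" if "a < m" "b < n" for a b
  proof -
    have "a * n + b < Suc a * n" using that by simp
    also have "\<dots> \<le> m * n" using that by (intro mult_right_mono) auto
    finally show ?thesis .
  qed
  have "(\<Sum>a<m. \<Sum>b<n. f a b) = (\<Sum>(a, b)\<in>{..<m} \<times> {..<n}. f a b)"
    by (simp add: sum.cartesian_product)
  also have "\<dots> = (\<Sum>i<m * n. f (i div n) (i mod n))"
    using False
    by (intro sum.reindex_bij_witness[of _ "\<lambda>i. (i div n, i mod n)" "\<lambda>(a, b). a * n + b"])
       (auto simp: less_mult_imp_div_less bound)
  finally show ?thesis by simp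
qed simp

lemma kron_mult:
  assumes "dim_col A = dim_row C" "dim_col B = dim_row D"
  shows "kron A B * kron C D = kron (A * C) (B * D)"
proof (rule eq_matI)
  fix i j assume "i < dim_row (kron (A * C) (B * D))" "j < dim_col (kron (A * C) (B * D))"
  hence i: "i < dim_row A * dim_row B" and j: "j < dim_col C * dim_col D" by auto
  have pos: "0 < dim_row B" "0 < dim_col D" using i j by (auto intro: gr0I)
  have b: "i div dim_row B < dim_row A" "j div dim_col D < dim_col C"
    "i mod dim_row B < dim_row B" "j mod dim_col D < dim_col D"
    using i j pos by (auto simp: less_mult_imp_div_less)
  let ?f = "\<lambda>a b. (A $$ (i div dim_row B, a) * B $$ (i mod dim_row B, b)) *
                  (C $$ (a, j div dim_col D) * D $$ (b, j mod dim_col D))"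
  have "(kron A B * kron C D) $$ (i, j) =
      (\<Sum>x<dim_row C * dim_row D. ?f (x div dim_row D) (x mod dim_row D))"
    using i j assms by (auto simp: scalar_prod_def kron_def lessThan_atLeast0 intro!: sum.cong)
  also have "\<dots> = (\<Sum>a<dim_row C. \<Sum>b<dim_row D. ?f a b)" by (rule sum_mult_split)
  also have "\<dots> = (\<Sum>a<dim_row C. A $$ (i div dim_row B, a) * C $$ (a, j div dim_col D)) *
                (\<Sum>b<dim_row D. B $$ (i mod dim_row B, b) * D $$ (b, j mod dim_col D))"
    by (simp add: sum_product mult_ac)
  also have "\<dots> = kron (A * C) (B * D) $$ (i, j)"
    using i j b assms by (auto simp: kron_def scalar_prod_def lessThan_atLeast0 intro!: sum.cong)
  finally show "(kron A B * kron C D) $$ (i, j) = kron (A * C) (B * D) $$ (i, j)" .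
qed auto

lemma mtrace_kron:
  assumes "A \<in> carrier_mat m m" "B \<in> carrier_mat n n"
  shows "mtrace (kron A B) = mtrace A * mtrace B"
proof -
  have "mtrace (kron A B) = (\<Sum>i<m * n. A $$ (i div n, i div n) * B $$ (i mod n, i mod n))"
    using assms by (auto simp: mtrace_def kron_def intro!: sum.cong)
  also have "\<dots> = (\<Sum>a<m. \<Sum>b<n. A $$ (a, a) * B $$ (b, b))"
    by (rule sum_mult_split[of "\<lambda>a b. A $$ (a, a) * B $$ (b, b)"])
  finally show ?thesis using assms by (simp add: mtrace_def sum_product)
qed

lemma tensor_list_carrier:
  "(\<forall>X\<in>set Xs. X \<in> carrier_mat 2 2) \<Longrightarrow> tensor_list Xs \<in> carrier_mat (2 ^ length Xs) (2 ^ length Xs)"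
  by (induction Xs) (auto simp: tensor_list_def kron_def)

lemma mtrace_vac:
  assumes "X \<in> carrier_mat 2 2"
  shows "mtrace (vac_proj * X) = vac_state X"
  using assms
  by (simp add: mtrace_def vac_proj_def vac_state_def vac_vec_def scalar_prod_def numeral_2_eq_2
      mult_mat_vec_def)

lemma mtrace_vac_list:
  "(\<forall>X\<in>set Xs. X \<in> carrier_mat 2 2) \<Longrightarrow>
   mtrace (tensor_list (replicate (length Xs) vac_proj) * tensor_list Xs) = (\<Prod>X\<leftarrow>Xs. vac_state X)"
proof (induction Xs)
  case Nil
  show ?case by (simp add: tensor_list_def mtrace_def)
next
  case (Cons X Xs)
  have T: "tensor_list Xs \<in> carrier_mat (2 ^ length Xs) (2 ^ length Xs)"
    "tensor_list (replicate (length Xs) vac_proj) \<in> carrier_mat (2 ^ length Xs) (2 ^ length Xs)"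
    using Cons.prems tensor_list_carrier[of Xs]
      tensor_list_carrier[of "replicate (length Xs) vac_proj"] by (auto simp: vac_proj_def)
  have V: "vac_proj \<in> carrier_mat 2 2" by (simp add: vac_proj_def)
  have X: "X \<in> carrier_mat 2 2" using Cons.prems by simp
  have "tensor_list (replicate (length (X # Xs)) vac_proj) * tensor_list (X # Xs) =
      kron (vac_proj * X) (tensor_list (replicate (length Xs) vac_proj) * tensor_list Xs)"
    using T V X by (subst kron_mult[symmetric]) (auto simp: tensor_list_def)
  thus ?case
    using Cons T V X by (simp add: mtrace_kron[of _ 2 _ "2 ^ length Xs"] mtrace_vac)
qed

lemma qstate_tensor:
  assumes "rho0 H \<in> carrier_mat 2 2" "X \<in> carrier_mat 2 2" "\<forall>Y\<in>set Xs. Y \<in> carrier_mat 2 2"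
    and "length Xs = nsteps H"
  shows "qstate H (tensor_list (X # Xs)) = mtrace (rho0 H * X) * (\<Prod>Y\<leftarrow>Xs. vac_state Y)"
proof -
  have T: "tensor_list Xs \<in> carrier_mat (2 ^ length Xs) (2 ^ length Xs)"
    "tensor_list (replicate (length Xs) vac_proj) \<in> carrier_mat (2 ^ length Xs) (2 ^ length Xs)"
    using assms tensor_list_carrier[of Xs]
      tensor_list_carrier[of "replicate (length Xs) vac_proj"] by (auto simp: vac_proj_def)
  have "tensor_list (rho0 H # replicate (nsteps H) vac_proj) * tensor_list (X # Xs) =
      kron (rho0 H * X) (tensor_list (replicate (length Xs) vac_proj) * tensor_list Xs)"
    using T assms by (subst kron_mult[symmetric]) (auto simp: tensor_list_def)
  thus ?thesis
    using assms T mtrace_vac_list[of Xs]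
    by (simp add: qstate_def mtrace_kron[of _ 2 _ "2 ^ length Xs"])
qed

end

theory Submission
  imports Defs
begin

text \<open>Since the observations are non-demolition, the joint spectral projector of
  \<open>\<Delta>Y(1), \<dots>, \<Delta>Y(l)\<close> for a record \<open>ys\<close> is \<open>U(l)\<^sup>* P U(l)\<close> with \<open>P\<close> the joint projector of
  \<open>\<Delta>Z(1), \<dots>, \<Delta>Z(l)\<close>, and below \<open>P\<close> the controlled evolution uses the fixed controls read off
  from \<open>ys\<close>. Hence \<open>P U(l)\<close> carries the initial state to a product state whose system factor is
  an unnormalised conditional state; each step multiplies its trace by the transition probability
  \<open>p\<close> and applies \<open>\<Gamma>\<close> to its normalisation. The law of the record is therefore that of the filter,
  seen as a controlled Markov chain on density matrices, and the cost is the expected path cost of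
  that chain, so that the theorem becomes backward induction on the Bellman recursion.\<close>

text \<open>Three notions of the model are given by \<open>THE\<close> or by an embedding:
  \<open>eigenproj\<close>, \<open>Mcoeffs\<close> and \<open>record_pmf\<close>. Each becomes
  usable only through an explicit candidate: sums of product projectors, the blocks of an
  exponential computed among 4 x 4 matrices, and products of transition probabilities. Conditional
  states are carried together with a weight, because the probabilities to divide by may vanish: a
  weight 0 propagates, and on a null outcome the unnormalised filter step is itself 0, being
  nonnegative of trace 0. Trace preservation is the isometry property of that block column of the
  one-step unitary which meets the vacuum. The Bellman induction runs over record prefixes instead
  of density matrices: an admissible control may depend on the whole past, yet on each prefix it is
  a single element of the control set, so the pointwise minimum bounds it from below. In that
  induction values and costs stay multiplied by the weight of the prefix; conditioning comes only
  afterwards.\<close>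

section \<open>Matrix algebra, adjoints and traces\<close>

lemma square_mult_carrier [simp]:
  "A \<in> carrier_mat n n \<Longrightarrow> B \<in> carrier_mat n n \<Longrightarrow> A * B \<in> carrier_mat n n"
  by (rule mult_carrier_mat)

lemma mat_mult_assoc:
  fixes A B C :: "complex mat"
  assumes "dim_col A = dim_row B" "dim_col B = dim_row C"
  shows "A * B * C = A * (B * C)"
  using assms by (intro assoc_mult_mat[of _ "dim_row A" "dim_row B" _ "dim_row C" _ "dim_col C"]) auto

lemma mat_distrib_left:
  fixes A B C :: "complex mat"
  assumes "dim_col A = dim_row B" "dim_row B = dim_row C" "dim_col B = dim_col C"
  shows "A * (B + C) = A * B + A * C"
  using assms by (intro mult_add_distrib_mat[of _ "dim_row A" "dim_row B" _ "dim_col C"]) auto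

lemma mat_distrib_right:
  fixes A B C :: "complex mat"
  assumes "dim_col A = dim_row C" "dim_row A = dim_row B" "dim_col A = dim_col B"
  shows "(A + B) * C = A * C + B * C"
  using assms by (intro add_mult_distrib_mat[of _ "dim_row A" "dim_col A" _ _ "dim_col C"]) auto

lemma mat_vec_assoc:
  fixes A B :: "complex mat"
  assumes "dim_col A = dim_row B" "dim_col B = dim_vec v"
  shows "A * B *\<^sub>v v = A *\<^sub>v (B *\<^sub>v v)"
proof (rule assoc_mult_mat_vec)
  show "A \<in> carrier_mat (dim_row A) (dim_row B)" using assms by (intro carrier_matI) auto
  show "B \<in> carrier_mat (dim_row B) (dim_vec v)" using assms by (intro carrier_matI) auto
qed simp

lemma smult_mat_mult:
  fixes A B :: "complex mat"
  shows "dim_col A = dim_row B \<Longrightarrow> (a \<cdot>\<^sub>m A) * B = a \<cdot>\<^sub>m (A * B)"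
    and "dim_col A = dim_row B \<Longrightarrow> A * (a \<cdot>\<^sub>m B) = a \<cdot>\<^sub>m (A * B)"
  by (auto intro!: eq_matI simp: scalar_prod_def sum_distrib_left mult_ac)

lemma smult_smult_mat: "a \<cdot>\<^sub>m (b \<cdot>\<^sub>m A) = (a * b) \<cdot>\<^sub>m (A :: complex mat)"
  by (intro eq_matI) auto

lemma smult_add_mat:
  "dim_row A = dim_row B \<Longrightarrow> dim_col A = dim_col B \<Longrightarrow> a \<cdot>\<^sub>m (A + B) = a \<cdot>\<^sub>m A + a \<cdot>\<^sub>m (B :: complex mat)"
  by (intro eq_matI) (auto simp: algebra_simps)

lemma one_smult_mat [simp]: "1 \<cdot>\<^sub>m A = (A :: complex mat)"
  by (intro eq_matI) auto

abbreviation adj :: "complex mat \<Rightarrow> complex mat" where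
  "adj \<equiv> mat_adjoint"

lemma dim_adjoint [simp]: "dim_row (adj A) = dim_col A" "dim_col (adj A) = dim_row A"
  by (auto simp: mat_adjoint_def)

lemma index_adjoint [simp]:
  fixes A :: "complex mat"
  shows "i < dim_col A \<Longrightarrow> j < dim_row A \<Longrightarrow> adj A $$ (i, j) = cnj (A $$ (j, i))"
  by (simp add: mat_adjoint_def mat_of_rows_def)

lemma adjoint_carrier [simp]: "A \<in> carrier_mat m n \<Longrightarrow> adj A \<in> carrier_mat n m"
  by (metis carrier_matD carrier_matI dim_adjoint)

lemma adjoint_adjoint [simp]: "adj (adj A) = (A :: complex mat)"
  by (intro eq_matI) auto

lemma adjoint_mult:
  fixes A B :: "complex mat"
  assumes "dim_col A = dim_row B"
  shows "adj (A * B) = adj B * adj A"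
  using assms by (intro eq_matI) (auto simp: scalar_prod_def mult_ac)

lemma adjoint_add:
  fixes A B :: "complex mat"
  shows "dim_row A = dim_row B \<Longrightarrow> dim_col A = dim_col B \<Longrightarrow>
    adj (A + B) = adj A + adj B"
  by (intro eq_matI) auto

lemma adjoint_smult: "adj (a \<cdot>\<^sub>m A) = cnj a \<cdot>\<^sub>m adj (A :: complex mat)"
  by (intro eq_matI) auto

lemma adjoint_one [simp]: "adj (1\<^sub>m n) = (1\<^sub>m n :: complex mat)"
  by (intro eq_matI) auto

lemma cscalar_prod_adjoint:
  fixes A :: "complex mat"
  assumes "v \<in> carrier_vec (dim_col A)" "w \<in> carrier_vec (dim_row A)"
  shows "(A *\<^sub>v v) \<bullet>c w = v \<bullet>c (adj A *\<^sub>v w)"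
proof -
  have "(A *\<^sub>v v) \<bullet>c w = (\<Sum>i<dim_row A. \<Sum>j<dim_col A. A $$ (i, j) * v $ j * cnj (w $ i))"
    using assms by (simp add: scalar_prod_def sum_distrib_right lessThan_atLeast0)
  also have "\<dots> = (\<Sum>j<dim_col A. \<Sum>i<dim_row A. A $$ (i, j) * v $ j * cnj (w $ i))"
    by (rule sum.swap)
  also have "\<dots> = v \<bullet>c (adj A *\<^sub>v w)"
    using assms by (simp add: scalar_prod_def sum_distrib_left lessThan_atLeast0 mult_ac)
  finally show ?thesis .
qed

lemma mtrace_mult_comm:
  assumes "dim_row A = dim_col B" "dim_col A = dim_row B"
  shows "mtrace (A * B) = mtrace (B * A)"
proof -
  have "mtrace (A * B) = (\<Sum>i<dim_row A. \<Sum>j<dim_col A. A $$ (i, j) * B $$ (j, i))"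
    using assms by (auto simp: mtrace_def scalar_prod_def lessThan_atLeast0 intro!: sum.cong)
  also have "\<dots> = (\<Sum>j<dim_col A. \<Sum>i<dim_row A. A $$ (i, j) * B $$ (j, i))"
    by (rule sum.swap)
  also have "\<dots> = mtrace (B * A)"
    using assms by (auto simp: mtrace_def scalar_prod_def lessThan_atLeast0 mult_ac intro!: sum.cong)
  finally show ?thesis .
qed

lemma mtrace_add:
  "dim_row A = dim_row B \<Longrightarrow> dim_row B = dim_col B \<Longrightarrow> mtrace (A + B) = mtrace A + mtrace B"
  by (simp add: mtrace_def sum.distrib)

lemma mtrace_smult: "dim_row A = dim_col A \<Longrightarrow> mtrace (a \<cdot>\<^sub>m A) = a * mtrace A"
  by (simp add: mtrace_def sum_distrib_left)

lemma mtrace_adjoint: "dim_row A = dim_col A \<Longrightarrow> mtrace (adj A) = cnj (mtrace A)"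
  by (simp add: mtrace_def)

lemma smult_mat_mult_vec:
  fixes A :: "complex mat"
  assumes "A \<in> carrier_mat m n" "v \<in> carrier_vec n"
  shows "(a \<cdot>\<^sub>m A) *\<^sub>v v = a \<cdot>\<^sub>v (A *\<^sub>v v)"
  using assms by (intro eq_vecI) (auto simp: scalar_prod_def sum_distrib_left mult_ac)

lemma mat_eqI_mult_vec:
  fixes A B :: "complex mat"
  assumes "A \<in> carrier_mat m n" "B \<in> carrier_mat m n"
    and "\<And>v. v \<in> carrier_vec n \<Longrightarrow> A *\<^sub>v v = B *\<^sub>v v"
  shows "A = B"
proof (rule eq_matI)
  fix i j assume ij: "i < dim_row B" "j < dim_col B"
  have "(A *\<^sub>v unit_vec n j) $ i = (B *\<^sub>v unit_vec n j) $ i"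
    using assms(3) by simp
  thus "A $$ (i, j) = B $$ (i, j)" using assms(1,2) ij by simp
qed (use assms in auto)

lemma square_mat_eqI:
  assumes "A \<in> carrier_mat n n" "B \<in> carrier_mat n n"
    and "\<And>i j. i < n \<Longrightarrow> j < n \<Longrightarrow> A $$ (i, j) = B $$ (i, j)"
  shows "A = B"
  using assms by (intro eq_matI) auto

section \<open>Finite sums of matrices\<close>

lemma dim_msum [simp]: "dim_row (msum n F S) = n" "dim_col (msum n F S) = n"
  by (auto simp: msum_def)

lemma msum_carrier [simp]: "msum n F S \<in> carrier_mat n n"
  by (simp add: msum_def)

lemma index_msum [simp]: "i < n \<Longrightarrow> j < n \<Longrightarrow> msum n F S $$ (i, j) = (\<Sum>x\<in>S. F x $$ (i, j))"
  by (simp add: msum_def)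

lemma msum_cong: "S = T \<Longrightarrow> (\<And>x. x \<in> T \<Longrightarrow> F x = G x) \<Longrightarrow> msum n F S = msum n G T"
  by (intro eq_matI) auto

lemma msum_mult_left:
  assumes "dim_col A = n" "dim_row A = n" "\<And>x. x \<in> S \<Longrightarrow> F x \<in> carrier_mat n n"
  shows "A * msum n F S = msum n (\<lambda>x. A * F x) S"
proof (rule square_mat_eqI[where n = "n"])
  fix i j assume ij: "i < n" "j < n"
  have "(A * msum n F S) $$ (i, j) = (\<Sum>k<n. \<Sum>x\<in>S. A $$ (i, k) * F x $$ (k, j))"
    using ij assms by (simp add: scalar_prod_def sum_distrib_left lessThan_atLeast0)
  also have "\<dots> = (\<Sum>x\<in>S. \<Sum>k<n. A $$ (i, k) * F x $$ (k, j))" by (rule sum.swap)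
  also have "\<dots> = (\<Sum>x\<in>S. (A * F x) $$ (i, j))"
    using ij assms by (auto simp: scalar_prod_def lessThan_atLeast0 intro!: sum.cong dest!: assms(3))
  finally show "(A * msum n F S) $$ (i, j) = msum n (\<lambda>x. A * F x) S $$ (i, j)" using ij by simp
qed (use assms in auto)

lemma msum_mult_right:
  assumes "dim_col A = n" "dim_row A = n" "\<And>x. x \<in> S \<Longrightarrow> F x \<in> carrier_mat n n"
  shows "msum n F S * A = msum n (\<lambda>x. F x * A) S"
proof (rule square_mat_eqI[where n = "n"])
  fix i j assume ij: "i < n" "j < n"
  have "(msum n F S * A) $$ (i, j) = (\<Sum>k<n. \<Sum>x\<in>S. F x $$ (i, k) * A $$ (k, j))"
    using ij assms by (simp add: scalar_prod_def sum_distrib_right lessThan_atLeast0)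
  also have "\<dots> = (\<Sum>x\<in>S. \<Sum>k<n. F x $$ (i, k) * A $$ (k, j))" by (rule sum.swap)
  also have "\<dots> = (\<Sum>x\<in>S. (F x * A) $$ (i, j))"
    using ij assms by (auto simp: scalar_prod_def lessThan_atLeast0 intro!: sum.cong dest!: assms(3))
  finally show "(msum n F S * A) $$ (i, j) = msum n (\<lambda>x. F x * A) S $$ (i, j)" using ij by simp
qed (use assms in auto)

lemma msum_adjoint:
  assumes "\<And>x. x \<in> S \<Longrightarrow> F x \<in> carrier_mat n n"
  shows "adj (msum n F S) = msum n (\<lambda>x. adj (F x)) S"
  using assms by (intro eq_matI) (auto intro!: sum.cong dest!: assms)

lemma mtrace_msum:
  assumes "\<And>x. x \<in> S \<Longrightarrow> F x \<in> carrier_mat n n"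
  shows "mtrace (msum n F S) = (\<Sum>x\<in>S. mtrace (F x))"
proof -
  have "mtrace (msum n F S) = (\<Sum>x\<in>S. \<Sum>i<n. F x $$ (i, i))"
    by (simp add: mtrace_def) (rule sum.swap)
  thus ?thesis using assms by (auto simp: mtrace_def intro!: sum.cong dest!: assms)
qed

text \<open>Orthogonality relations are brought into this shape, so that multiplying a sum of
  projectors by one of them leaves a single term.\<close>

lemma msum_delta:
  assumes "finite S" "F a \<in> carrier_mat n n"
  shows "msum n (\<lambda>x. if x = a then F x else 0\<^sub>m n n) S = (if a \<in> S then F a else 0\<^sub>m n n)"
proof (rule square_mat_eqI[where n = "n"])
  fix i j assume ij: "i < n" "j < n"
  have "(\<Sum>x\<in>S. (if x = a then F x else 0\<^sub>m n n) $$ (i, j)) = (\<Sum>x\<in>S. if x = a then F x $$ (i, j) else 0)"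
    using ij by (intro sum.cong) auto
  thus "msum n (\<lambda>x. if x = a then F x else 0\<^sub>m n n) S $$ (i, j) = (if a \<in> S then F a else 0\<^sub>m n n) $$ (i, j)"
    using assms(1) ij by (simp add: sum.delta)
qed (use assms in auto)

lemma msum_empty [simp]: "msum n F {} = 0\<^sub>m n n"
  by (intro eq_matI) auto

lemma msum_insert:
  "finite S \<Longrightarrow> a \<notin> S \<Longrightarrow> F a \<in> carrier_mat n n \<Longrightarrow> msum n F (insert a S) = F a + msum n F S"
  by (intro eq_matI) auto

lemma msum_singleton [simp]: "F a \<in> carrier_mat n n \<Longrightarrow> msum n F {a} = F a"
  by (intro eq_matI) auto

lemma msum_mono_neutral:
  assumes "finite T" "S \<subseteq> T" "\<And>x. x \<in> T - S \<Longrightarrow> F x = 0\<^sub>m n n"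
  shows "msum n F S = msum n F T"
  using assms by (intro eq_matI) (auto intro!: sum.mono_neutral_left)

text \<open>Several records can yield the same control; this identifies summation by control value
  with summation by record.\<close>

lemma msum_group:
  assumes "finite S" "\<And>x. x \<in> S \<Longrightarrow> F x \<in> carrier_mat n n"
  shows "msum n (\<lambda>u. msum n F {x \<in> S. f x = u}) (f ` S) = msum n F S"
  using assms by (intro eq_matI) (auto simp: sum.image_gen[of S _ f])

lemma msum_smult:
  assumes "\<And>x. x \<in> S \<Longrightarrow> F x \<in> carrier_mat n n"
  shows "msum n (\<lambda>x. a \<cdot>\<^sub>m F x) S = a \<cdot>\<^sub>m msum n F S"
  using assms by (intro eq_matI) (auto simp: sum_distrib_left intro!: sum.cong dest!: assms)

lemma mult_mat_vec_msum_index: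
  assumes "v \<in> carrier_vec n" "i < n" "\<And>x. x \<in> S \<Longrightarrow> F x \<in> carrier_mat n n"
  shows "(msum n F S *\<^sub>v v) $ i = (\<Sum>x\<in>S. (F x *\<^sub>v v) $ i)"
proof -
  have "(msum n F S *\<^sub>v v) $ i = (\<Sum>k<n. \<Sum>x\<in>S. F x $$ (i, k) * v $ k)"
    using assms by (simp add: scalar_prod_def sum_distrib_right lessThan_atLeast0)
  also have "\<dots> = (\<Sum>x\<in>S. \<Sum>k<n. F x $$ (i, k) * v $ k)" by (rule sum.swap)
  finally show ?thesis
    using assms by (auto simp: scalar_prod_def lessThan_atLeast0 intro!: sum.cong dest!: assms(3))
qed

section \<open>Spectral projectors\<close>

definition orth_proj :: "nat \<Rightarrow> complex mat \<Rightarrow> bool" where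
  "orth_proj n P \<longleftrightarrow> P \<in> carrier_mat n n \<and> P * P = P \<and> adj P = P"

definition is_eigenproj :: "nat \<Rightarrow> complex mat \<Rightarrow> real \<Rightarrow> complex mat \<Rightarrow> bool" where
  "is_eigenproj n A a P \<longleftrightarrow> orth_proj n P \<and>
     (\<forall>v\<in>carrier_vec n. P *\<^sub>v v = v \<longleftrightarrow> A *\<^sub>v v = of_real a \<cdot>\<^sub>v v)"

text \<open>An orthogonal projector is determined by its fixed vectors: equal fixed spaces give
  \<open>P * Q = Q\<close> and \<open>Q * P = P\<close>, and taking adjoints in the first identity \<open>Q * P = Q\<close>.\<close>

lemma eigenproj_eqI:
  assumes A: "A \<in> carrier_mat n n" and P: "is_eigenproj n A a P"
  shows "eigenproj A a = P"
  unfolding eigenproj_def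
proof (rule the_equality)
  show "P \<in> carrier_mat (dim_row A) (dim_row A) \<and> P * P = P \<and> adj P = P \<and>
     (\<forall>v\<in>carrier_vec (dim_row A). P *\<^sub>v v = v \<longleftrightarrow> A *\<^sub>v v = of_real a \<cdot>\<^sub>v v)"
    using assms by (auto simp: is_eigenproj_def orth_proj_def)
next
  fix Q assume "Q \<in> carrier_mat (dim_row A) (dim_row A) \<and> Q * Q = Q \<and> adj Q = Q \<and>
     (\<forall>v\<in>carrier_vec (dim_row A). Q *\<^sub>v v = v \<longleftrightarrow> A *\<^sub>v v = of_real a \<cdot>\<^sub>v v)"
  hence Q: "Q \<in> carrier_mat n n" "Q * Q = Q" "adj Q = Q"
    "\<And>v. v \<in> carrier_vec n \<Longrightarrow> Q *\<^sub>v v = v \<longleftrightarrow> A *\<^sub>v v = of_real a \<cdot>\<^sub>v v"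
    using A by auto
  have P': "P \<in> carrier_mat n n" "P * P = P" "adj P = P"
    "\<And>v. v \<in> carrier_vec n \<Longrightarrow> P *\<^sub>v v = v \<longleftrightarrow> A *\<^sub>v v = of_real a \<cdot>\<^sub>v v"
    using P by (auto simp: is_eigenproj_def orth_proj_def)
  have absorb: "R * S = S"
    if "R \<in> carrier_mat n n" "S \<in> carrier_mat n n" "S * S = S"
      "\<And>v. v \<in> carrier_vec n \<Longrightarrow> S *\<^sub>v v = v \<Longrightarrow> R *\<^sub>v v = v" for R S :: "complex mat"
  proof (rule mat_eqI_mult_vec)
    fix v :: "complex vec" assume v: "v \<in> carrier_vec n"
    have "S *\<^sub>v (S *\<^sub>v v) = S *\<^sub>v v"
      using that v by (metis assoc_mult_mat_vec)
    hence "R *\<^sub>v (S *\<^sub>v v) = S *\<^sub>v v" using that v by simp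
    thus "(R * S) *\<^sub>v v = S *\<^sub>v v" using that v by (simp add: assoc_mult_mat_vec[of _ n n _ n])
  qed (use that in auto)
  have PQ: "P * Q = Q" by (rule absorb) (use P' Q in auto)
  have QP: "Q * P = P" by (rule absorb) (use P' Q in auto)
  have "Q = adj (P * Q)" using PQ Q by simp
  also have "\<dots> = Q * P" using P' Q by (simp add: adjoint_mult)
  finally show "Q = P" using QP by simp
qed

text \<open>The range of \<open>P\<close> is the eigenspace. The sum in \<open>at_ctrl\<close> runs
  over eigenvalues only; by this criterion every omitted value has projector 0, so its term can be
  added without changing the sum.\<close>

lemma eigenvalue_iff_eigenproj_nonzero:
  assumes A: "A \<in> carrier_mat n n" and P: "is_eigenproj n A a P"
  shows "eigenvalue A (of_real a) \<longleftrightarrow> P \<noteq> 0\<^sub>m n n"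
proof -
  have P': "P \<in> carrier_mat n n" "P * P = P"
    "\<And>v. v \<in> carrier_vec n \<Longrightarrow> P *\<^sub>v v = v \<longleftrightarrow> A *\<^sub>v v = of_real a \<cdot>\<^sub>v v"
    using P by (auto simp: is_eigenproj_def orth_proj_def)
  show ?thesis
  proof
    assume "eigenvalue A (of_real a)"
    then obtain v where v: "v \<in> carrier_vec n" "v \<noteq> 0\<^sub>v n" "P *\<^sub>v v = v"
      using A P' by (auto simp: eigenvalue_def eigenvector_def)
    have "0\<^sub>m n n *\<^sub>v v = 0\<^sub>v n" using v(1) by auto
    thus "P \<noteq> 0\<^sub>m n n" using v by auto
  next
    assume ne: "P \<noteq> 0\<^sub>m n n"
    show "eigenvalue A (of_real a)"
    proof (rule ccontr)
      assume neg: "\<not> eigenvalue A (of_real a)"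
      have "P = 0\<^sub>m n n"
      proof (rule mat_eqI_mult_vec)
        fix v :: "complex vec" assume v: "v \<in> carrier_vec n"
        have "P *\<^sub>v (P *\<^sub>v v) = P *\<^sub>v v"
          using P' v by (metis assoc_mult_mat_vec)
        hence "A *\<^sub>v (P *\<^sub>v v) = of_real a \<cdot>\<^sub>v (P *\<^sub>v v)" using P' v by auto
        hence "P *\<^sub>v v = 0\<^sub>v n"
          using neg A mult_mat_vec_carrier[OF P'(1) v] by (auto simp: eigenvalue_def eigenvector_def)
        thus "P *\<^sub>v v = 0\<^sub>m n n *\<^sub>v v" using v by auto
      qed (use P' in auto)
      with ne show False by simp
    qed
  qed
qed

text \<open>\<open>adj U * P * U\<close> fixes \<open>v\<close> exactly when \<open>P\<close> fixes
  \<open>U v\<close>, and the eigenvalue equation transforms in the same way. This yields the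
  projectors of \<open>dY\<close> from those of \<open>dZ\<close>.\<close>

lemma is_eigenproj_unitary_conj:
  assumes A: "A \<in> carrier_mat n n" and U: "U \<in> carrier_mat n n"
    and UU: "adj U * U = 1\<^sub>m n" "U * adj U = 1\<^sub>m n"
    and P: "is_eigenproj n A a P"
  shows "is_eigenproj n (adj U * A * U) a (adj U * P * U)"
proof -
  have P': "P \<in> carrier_mat n n" "P * P = P" "adj P = P"
    "\<And>v. v \<in> carrier_vec n \<Longrightarrow> P *\<^sub>v v = v \<longleftrightarrow> A *\<^sub>v v = of_real a \<cdot>\<^sub>v v"
    using P by (auto simp: is_eigenproj_def orth_proj_def)
  note c = carrier_matD[OF U] carrier_matD[OF A] carrier_matD[OF P'(1)]
  have "adj U * P * U * (adj U * P * U)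
      = adj U * (P * ((U * adj U) * (P * U)))"
    by (simp add: mat_mult_assoc c)
  also have "\<dots> = adj U * ((P * P) * U)" by (simp add: UU c mat_mult_assoc)
  also have "\<dots> = adj U * P * U" by (simp add: P' c mat_mult_assoc)
  finally have idem: "adj U * P * U * (adj U * P * U) = adj U * P * U" .
  have conj: "(adj U * B * U) *\<^sub>v v = adj U *\<^sub>v (B *\<^sub>v (U *\<^sub>v v))"
    if "B \<in> carrier_mat n n" "v \<in> carrier_vec n" for B v
    using that U by (simp add: mat_vec_assoc carrier_matD[of _ n n] carrier_vecD[of _ n])
  have UUv: "adj U *\<^sub>v (U *\<^sub>v v) = v" "U *\<^sub>v (adj U *\<^sub>v v) = v" if "v \<in> carrier_vec n" for v
    using that U UU by (simp_all add: assoc_mult_mat_vec[of _ n n _ n, symmetric])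
  have "(adj U * P * U) *\<^sub>v v = v \<longleftrightarrow> (adj U * A * U) *\<^sub>v v = of_real a \<cdot>\<^sub>v v"
    if v: "v \<in> carrier_vec n" for v
  proof -
    have Uv: "U *\<^sub>v v \<in> carrier_vec n" using U v by simp
    have "(adj U * P * U) *\<^sub>v v = v \<longleftrightarrow> P *\<^sub>v (U *\<^sub>v v) = U *\<^sub>v v"
      using conj[OF P'(1) v] UUv[OF v] UUv(2)[of "P *\<^sub>v (U *\<^sub>v v)"] P'(1) Uv by (metis mult_mat_vec_carrier)
    also have "\<dots> \<longleftrightarrow> A *\<^sub>v (U *\<^sub>v v) = of_real a \<cdot>\<^sub>v (U *\<^sub>v v)" using P'(4) Uv by simp
    also have "of_real a \<cdot>\<^sub>v (U *\<^sub>v v) = U *\<^sub>v (of_real a \<cdot>\<^sub>v v)"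
      using U v by (simp add: mult_mat_vec)
    also have "A *\<^sub>v (U *\<^sub>v v) = U *\<^sub>v (of_real a \<cdot>\<^sub>v v) \<longleftrightarrow>
        (adj U * A * U) *\<^sub>v v = of_real a \<cdot>\<^sub>v v"
      using conj[OF A v] UUv(1)[of "of_real a \<cdot>\<^sub>v v"] UUv(2)[of "A *\<^sub>v (U *\<^sub>v v)"] A Uv v
      by (metis mult_mat_vec_carrier smult_carrier_vec)
    finally show ?thesis .
  qed
  moreover have "adj U * P * U \<in> carrier_mat n n" using U P' by simp
  moreover have "adj (adj U * P * U) = adj U * P * U"
    using P' by (simp add: adjoint_mult mat_mult_assoc c)
  ultimately show ?thesis using idem by (simp add: is_eigenproj_def orth_proj_def)
qed

text \<open>A finite projection-valued measure. Single projectors may vanish, so the value attached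
  to an index need not be an eigenvalue.\<close>

definition spectral_family :: "nat \<Rightarrow> 'i set \<Rightarrow> ('i \<Rightarrow> complex mat) \<Rightarrow> bool" where
  "spectral_family n I P \<longleftrightarrow> finite I \<and> (\<forall>i\<in>I. orth_proj n (P i)) \<and>
     (\<forall>i\<in>I. \<forall>j\<in>I. i \<noteq> j \<longrightarrow> P i * P j = 0\<^sub>m n n) \<and> msum n P I = 1\<^sub>m n"

lemma spectral_family_mult:
  assumes "spectral_family n I P" "i \<in> I" "j \<in> I"
  shows "P i * P j = (if i = j then P i else 0\<^sub>m n n)"
  using assms by (auto simp: spectral_family_def orth_proj_def)

lemma spectral_family_carrier: "spectral_family n I P \<Longrightarrow> i \<in> I \<Longrightarrow> P i \<in> carrier_mat n n"
  by (auto simp: spectral_family_def orth_proj_def)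

lemma spectral_family_sum_proj:
  assumes "spectral_family n I P" "S \<subseteq> I"
  shows "orth_proj n (msum n P S)"
proof -
  have fin: "finite S" using assms by (auto simp: spectral_family_def finite_subset)
  have c: "\<And>i. i \<in> S \<Longrightarrow> P i \<in> carrier_mat n n" 
    using spectral_family_carrier[OF assms(1)] assms(2) by auto
  have "P i * msum n P S = P i" if "i \<in> S" for i
  proof -
    have "P i * msum n P S = msum n (\<lambda>j. P i * P j) S"
      using c that by (intro msum_mult_left) auto
    also have "\<dots> = msum n (\<lambda>j. if j = i then P j else 0\<^sub>m n n) S"
      using assms that by (intro msum_cong) (auto simp: spectral_family_mult[OF assms(1)] subset_iff)
    also have "\<dots> = P i" using fin c that by (subst msum_delta) auto
    finally show ?thesis .
  qed
  hence "msum n P S * msum n P S = msum n P S"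
    using c by (subst msum_mult_right) auto
  moreover have "adj (msum n P S) = msum n P S"
    using assms c by (subst msum_adjoint) (auto intro!: msum_cong simp: spectral_family_def orth_proj_def)
  ultimately show ?thesis by (simp add: orth_proj_def)
qed

text \<open>As \<open>f\<close> need not be injective, an eigenspace collects all indices with the
  same value. Multiplying \<open>A v = a v\<close> by \<open>P i\<close> gives
  \<open>(f i - a) P i v = 0\<close>, so only components with \<open>f i = a\<close> survive in an
  eigenvector; the converse is \<open>A Q = a Q\<close>.\<close>

lemma is_eigenproj_spectral_sum:
  assumes SF: "spectral_family n I P"
  shows "is_eigenproj n (msum n (\<lambda>i. of_real (f i) \<cdot>\<^sub>m P i) I) a (msum n P {i \<in> I. f i = a})"
    (is "is_eigenproj n ?A a ?Q")
  unfolding is_eigenproj_def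
proof (intro conjI ballI)
  show "orth_proj n ?Q" by (rule spectral_family_sum_proj[OF SF]) auto
  have fin: "finite I" and sum1: "msum n P I = 1\<^sub>m n" using SF by (auto simp: spectral_family_def)
  have c: "\<And>i. i \<in> I \<Longrightarrow> P i \<in> carrier_mat n n" 
    using spectral_family_carrier[OF SF] by auto
  have d: "\<And>i. i \<in> I \<Longrightarrow> dim_row (P i) = n" "\<And>i. i \<in> I \<Longrightarrow> dim_col (P i) = n"
    using c by (meson carrier_matD)+
  have PA: "P i * ?A = of_real (f i) \<cdot>\<^sub>m P i" if "i \<in> I" for i
  proof -
    have "P i * ?A = msum n (\<lambda>j. P i * (of_real (f j) \<cdot>\<^sub>m P j)) I"
      using c that by (intro msum_mult_left) auto
    also have "\<dots> = msum n (\<lambda>j. if j = i then of_real (f j) \<cdot>\<^sub>m P j else 0\<^sub>m n n) I"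
      using that by (intro msum_cong)
        (auto simp: d smult_mat_mult spectral_family_mult[OF SF])
    also have "\<dots> = of_real (f i) \<cdot>\<^sub>m P i" using fin c that by (subst msum_delta) auto
    finally show ?thesis .
  qed
  have AQ: "?A * ?Q = of_real a \<cdot>\<^sub>m ?Q"
  proof -
    have "?A * P j = of_real (f j) \<cdot>\<^sub>m P j" if "j \<in> I" for j
    proof -
      have "?A * P j = msum n (\<lambda>i. (of_real (f i) \<cdot>\<^sub>m P i) * P j) I"
        using c that by (intro msum_mult_right) auto
      also have "\<dots> = msum n (\<lambda>i. if i = j then of_real (f i) \<cdot>\<^sub>m P i else 0\<^sub>m n n) I"
        using that by (intro msum_cong)
          (auto simp: d smult_mat_mult spectral_family_mult[OF SF])
      also have "\<dots> = of_real (f j) \<cdot>\<^sub>m P j" using fin c that by (subst msum_delta) auto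
      finally show ?thesis .
    qed
    hence "?A * ?Q = msum n (\<lambda>i. of_real a \<cdot>\<^sub>m P i) {i \<in> I. f i = a}"
      using c by (subst msum_mult_left) auto
    also have "\<dots> = of_real a \<cdot>\<^sub>m ?Q" using c by (intro msum_smult) auto
    finally show ?thesis .
  qed
  fix v :: "complex vec" assume v: "v \<in> carrier_vec n"
  show "?Q *\<^sub>v v = v \<longleftrightarrow> ?A *\<^sub>v v = of_real a \<cdot>\<^sub>v v"
  proof
    assume Qv: "?Q *\<^sub>v v = v"
    have "?A *\<^sub>v v = (?A * ?Q) *\<^sub>v v"
      using v by (subst assoc_mult_mat_vec[of _ n n _ n]) (auto simp: Qv)
    also have "\<dots> = of_real a \<cdot>\<^sub>v (?Q *\<^sub>v v)"
      unfolding AQ using v by (intro smult_mat_mult_vec[of _ n n]) auto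
    finally show "?A *\<^sub>v v = of_real a \<cdot>\<^sub>v v" by (simp only: Qv)
  next
    assume Av: "?A *\<^sub>v v = of_real a \<cdot>\<^sub>v v"
    have Pv0: "P i *\<^sub>v v = 0\<^sub>v n" if i: "i \<in> I" "f i \<noteq> a" for i
    proof -
      have "of_real (f i) \<cdot>\<^sub>v (P i *\<^sub>v v) = (P i * ?A) *\<^sub>v v"
        unfolding PA[OF i(1)] using v c i by (intro smult_mat_mult_vec[symmetric, of _ n n]) auto
      also have "\<dots> = P i *\<^sub>v (?A *\<^sub>v v)" using v c i by (intro assoc_mult_mat_vec[of _ n n _ n]) auto
      also have "\<dots> = of_real a \<cdot>\<^sub>v (P i *\<^sub>v v)"
        unfolding Av using v c i by (intro mult_mat_vec[of _ n n]) auto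
      finally have e: "of_real (f i) \<cdot>\<^sub>v (P i *\<^sub>v v) = of_real a \<cdot>\<^sub>v (P i *\<^sub>v v)" .
      show ?thesis
      proof (rule eq_vecI)
        fix j assume j: "j < dim_vec (0\<^sub>v n :: complex vec)"
        have "of_real (f i) * (P i *\<^sub>v v) $ j = of_real a * (P i *\<^sub>v v) $ j"
          using arg_cong[OF e, of "\<lambda>w. w $ j"] j c[OF i(1)] by simp
        thus "(P i *\<^sub>v v) $ j = 0\<^sub>v n $ j" using i(2) j by simp
      qed (use c[OF i(1)] in auto)
    qed
    show "?Q *\<^sub>v v = v"
    proof (rule eq_vecI)
      fix j assume j: "j < dim_vec v"
      hence j': "j < n" using v by simp
      have "(?Q *\<^sub>v v) $ j = (\<Sum>i\<in>{i \<in> I. f i = a}. (P i *\<^sub>v v) $ j)"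
        using v j' c by (intro mult_mat_vec_msum_index) auto
      also have "\<dots> = (\<Sum>i\<in>I. (P i *\<^sub>v v) $ j)"
        using fin Pv0 j' by (intro sum.mono_neutral_left) auto
      also have "\<dots> = (msum n P I *\<^sub>v v) $ j"
        using v j' c by (intro mult_mat_vec_msum_index[symmetric]) auto
      also have "\<dots> = v $ j" using v by (simp only: sum1) simp
      finally show "(?Q *\<^sub>v v) $ j = v $ j" .
    qed (use v in auto)
  qed
qed

text \<open>This turns the eigenvalue sum of the model into a sum over records, where the argument
  of \<open>F\<close> is a known number on each summand.\<close>

lemma functional_calculus_spectral_sum:
  fixes f :: "'i \<Rightarrow> real" and P :: "'i \<Rightarrow> complex mat" and n :: nat and I :: "'i set"
  defines "A \<equiv> msum n (\<lambda>i. complex_of_real (f i) \<cdot>\<^sub>m P i) I"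
  assumes SF: "spectral_family n I P" and C: "f ` I \<subseteq> C"
    and F: "\<And>u. u \<in> C \<Longrightarrow> F u \<in> carrier_mat n n"
  shows "msum n (\<lambda>u. F u * eigenproj A u) {u \<in> C. eigenvalue A (of_real u)}
       = msum n (\<lambda>i. F (f i) * P i) I"
proof -
  have fin: "finite I" using SF by (auto simp: spectral_family_def)
  have c: "\<And>i. i \<in> I \<Longrightarrow> P i \<in> carrier_mat n n"
    using spectral_family_carrier[OF SF] by auto
  have A: "A \<in> carrier_mat n n" by (simp add: A_def)
  have ep: "is_eigenproj n A a (msum n P {i \<in> I. f i = a})" for a
    unfolding A_def by (rule is_eigenproj_spectral_sum[OF SF])
  have ev: "eigenvalue A (of_real a) \<longleftrightarrow> msum n P {i \<in> I. f i = a} \<noteq> 0\<^sub>m n n" for a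
    by (rule eigenvalue_iff_eigenproj_nonzero[OF A ep])
  have emp: "msum n P {i \<in> I. f i = a} = 0\<^sub>m n n" if "a \<notin> f ` I" for a
  proof -
    have "{i \<in> I. f i = a} = {}" using that by auto
    thus ?thesis by (simp only: msum_empty)
  qed
  have "msum n (\<lambda>u. F u * eigenproj A u) {u \<in> C. eigenvalue A (of_real u)}
      = msum n (\<lambda>u. F u * msum n P {i \<in> I. f i = u}) {u \<in> C. eigenvalue A (of_real u)}"
    using eigenproj_eqI[OF A ep] by simp
  \<comment> \<open>Every eigenvalue in \<open>C\<close> is a value of \<open>f\<close>, but a value
    of \<open>f\<close> may fail to be an eigenvalue when its projectors vanish; the terms added
    here are therefore 0.\<close>
  also have "\<dots> = msum n (\<lambda>u. F u * msum n P {i \<in> I. f i = u}) (f ` I)"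
  proof (rule msum_mono_neutral)
    show "{u \<in> C. eigenvalue A (of_real u)} \<subseteq> f ` I" using ev emp by blast
    fix u assume u: "u \<in> f ` I - {u \<in> C. eigenvalue A (of_real u)}"
    hence "msum n P {i \<in> I. f i = u} = 0\<^sub>m n n" "F u \<in> carrier_mat n n" using C F ev by auto
    thus "F u * msum n P {i \<in> I. f i = u} = 0\<^sub>m n n" by simp
  qed (use fin in auto)
  also have "\<dots> = msum n (\<lambda>u. msum n (\<lambda>i. F (f i) * P i) {i \<in> I. f i = u}) (f ` I)"
  proof (rule msum_cong)
    fix u assume u: "u \<in> f ` I"
    hence Fu: "F u \<in> carrier_mat n n" using C F by auto
    have "F u * msum n P {i \<in> I. f i = u} = msum n (\<lambda>i. F u * P i) {i \<in> I. f i = u}"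
      using Fu c by (intro msum_mult_left) auto
    also have "\<dots> = msum n (\<lambda>i. F (f i) * P i) {i \<in> I. f i = u}"
      by (rule msum_cong) auto
    finally show "F u * msum n P {i \<in> I. f i = u} = msum n (\<lambda>i. F (f i) * P i) {i \<in> I. f i = u}" .
  qed simp
  also have "\<dots> = msum n (\<lambda>i. F (f i) * P i) I"
  proof (rule msum_group[OF fin])
    fix i assume "i \<in> I"
    thus "F (f i) * P i \<in> carrier_mat n n" using c C F by (intro mult_carrier_mat[of _ n n _ n]) auto
  qed
  finally show ?thesis .
qed

section \<open>Products of matrices\<close>

lemma mprod_simps [simp]: "mprod n [] = 1\<^sub>m n" "mprod n (A # As) = A * mprod n As"
  by (simp_all add: mprod_def)

lemma mprod_carrier:
  "(\<forall>A\<in>set As. A \<in> carrier_mat n n) \<Longrightarrow> mprod n As \<in> carrier_mat n n"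
  by (induction As) auto

lemma mprod_snoc:
  assumes "\<forall>A\<in>set As. A \<in> carrier_mat n n" "B \<in> carrier_mat n n"
  shows "mprod n (As @ [B]) = mprod n As * B"
  using assms
proof (induction As)
  case (Cons A As)
  thus ?case using mprod_carrier[of As n] by (simp add: assoc_mult_mat[of _ n n _ n _ n])
qed (simp add: carrier_matD[of B n n])

text \<open>Between neighbouring factors \<open>U * adj U\<close> cancels; the empty product uses
  \<open>adj U * U\<close>.\<close>

lemma mprod_conj:
  assumes "\<forall>A\<in>set As. A \<in> carrier_mat n n" and U: "U \<in> carrier_mat n n"
    and UU: "adj U * U = 1\<^sub>m n" "U * adj U = 1\<^sub>m n"
  shows "mprod n (map (\<lambda>A. adj U * A * U) As) = adj U * mprod n As * U"
  using assms(1)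
proof (induction As)
  case Nil
  thus ?case using U UU by simp
next
  case (Cons A As)
  have A: "A \<in> carrier_mat n n" and M: "mprod n As \<in> carrier_mat n n"
    using Cons.prems mprod_carrier[of As n] by auto
  note c = carrier_matD[OF U] carrier_matD[OF A] carrier_matD[OF M]
  have "adj U * A * U * (adj U * mprod n As * U)
      = adj U * (A * ((U * adj U) * (mprod n As * U)))"
    by (simp add: mat_mult_assoc c)
  also have "\<dots> = adj U * (A * mprod n As) * U"
    by (simp add: UU c mat_mult_assoc)
  finally show ?case using Cons by simp
qed

section \<open>The matrix exponential\<close>

lemma pow_mat_add:
  fixes A :: "complex mat"
  assumes "A \<in> carrier_mat n n"
  shows "A ^\<^sub>m (k + l) = A ^\<^sub>m k * A ^\<^sub>m l"
proof (induction l)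
  case (Suc l)
  have "A ^\<^sub>m k \<in> carrier_mat n n" "A ^\<^sub>m l \<in> carrier_mat n n" using assms by auto
  thus ?case using Suc assms by (simp add: assoc_mult_mat[of _ n n _ n _ n])
qed (use assms in simp)

lemma pow_mat_smult:
  fixes A :: "complex mat"
  assumes "A \<in> carrier_mat n n"
  shows "(c \<cdot>\<^sub>m A) ^\<^sub>m k = c ^ k \<cdot>\<^sub>m A ^\<^sub>m k"
proof (induction k)
  case (Suc k)
  have "A ^\<^sub>m k \<in> carrier_mat n n" using assms by auto
  thus ?case using Suc assms by (simp add: smult_mat_mult smult_smult_mat carrier_matD[of _ n n] mult_ac)
qed (use assms in simp)

lemma adjoint_pow_mat:
  fixes A :: "complex mat"
  assumes "A \<in> carrier_mat n n"
  shows "adj (A ^\<^sub>m k) = adj A ^\<^sub>m k"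
proof (induction k)
  case (Suc k)
  have A': "adj A \<in> carrier_mat n n" using assms by simp
  have "A ^\<^sub>m k \<in> carrier_mat n n" using assms by auto
  hence "adj (A ^\<^sub>m Suc k) = adj A ^\<^sub>m 1 * adj A ^\<^sub>m k"
    using Suc assms by (simp add: adjoint_mult carrier_matD[of _ n n])
  also have "\<dots> = adj A ^\<^sub>m (1 + k)" by (rule pow_mat_add[OF A', symmetric])
  finally show ?case by simp
qed (use assms in simp)

text \<open>Each further factor sums over \<open>n\<close> intermediate indices with entries at most
  \<open>c\<close>, hence the ratio \<open>n * c\<close>. The scalar exponential series of
  \<open>n * c\<close> then dominates that of the matrix.\<close>

lemma norm_pow_mat_bound:
  fixes A :: "complex mat"
  assumes A: "A \<in> carrier_mat n n" and c: "\<And>i j. i < n \<Longrightarrow> j < n \<Longrightarrow> norm (A $$ (i, j)) \<le> c"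
    and ij: "i < n" "j < n"
  shows "norm ((A ^\<^sub>m m) $$ (i, j)) \<le> (real n * c) ^ m"
  using ij
proof (induction m arbitrary: i j)
  case 0
  thus ?case using A by simp
next
  case (Suc m)
  have M: "A ^\<^sub>m m \<in> carrier_mat n n" using A by simp
  have c0: "0 \<le> c" using c[of i j] Suc.prems by (meson norm_ge_zero order_trans)
  have "norm ((A ^\<^sub>m Suc m) $$ (i, j)) = norm (\<Sum>k<n. (A ^\<^sub>m m) $$ (i, k) * A $$ (k, j))"
    using A M Suc.prems by (simp add: scalar_prod_def lessThan_atLeast0)
  also have "\<dots> \<le> (\<Sum>k<n. norm ((A ^\<^sub>m m) $$ (i, k)) * norm (A $$ (k, j)))"
    by (rule order_trans[OF norm_sum]) (simp add: norm_mult)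
  also have "\<dots> \<le> (\<Sum>k<n. (real n * c) ^ m * c)"
    using Suc c c0 by (intro sum_mono mult_mono) auto
  finally show ?case by (simp add: mult_ac)
qed

text \<open>Convergence of the norms is stated because the Cauchy product in
  \<open>mexp_mult_mexp_minus\<close> requires it.\<close>

lemma summable_mexp:
  fixes A :: "complex mat"
  assumes A: "A \<in> carrier_mat n n" and ij: "i < n" "j < n"
  shows "summable (\<lambda>m. norm ((A ^\<^sub>m m) $$ (i, j) / fact m))"
proof -
  define c where "c = Max ((\<lambda>(i, j). norm (A $$ (i, j))) ` ({..<n} \<times> {..<n}))"
  have c: "norm (A $$ (i, j)) \<le> c" if "i < n" "j < n" for i j
    unfolding c_def using that by (intro Max_ge) auto
  have "summable (\<lambda>m. (real n * c) ^ m / fact m)"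
    using summable_exp[of "real n * c"] by (simp add: divide_inverse mult_ac)
  thus ?thesis
    by (rule summable_comparison_test'[where N = 0])
       (auto simp: norm_divide intro!: divide_right_mono norm_pow_mat_bound[OF A c ij])
qed

lemma dim_mexp [simp]: "dim_row (mexp A) = dim_row A" "dim_col (mexp A) = dim_row A"
  by (auto simp: mexp_def)

lemma mexp_carrier [simp]: "A \<in> carrier_mat n n \<Longrightarrow> mexp A \<in> carrier_mat n n"
  by (auto simp: mexp_def)

text \<open>These are the coefficients of the product of the series of \<open>exp x\<close> and
  \<open>exp (- x)\<close>; up to \<open>fact m\<close> the sum is the binomial expansion of
  \<open>(1 - 1) ^ m\<close>.\<close>

lemma alternating_fact_sum:
  "(\<Sum>i\<le>m. (- 1) ^ (m - i) / (fact i * fact (m - i)) :: complex) = (if m = 0 then 1 else 0)"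
proof -
  have "(\<Sum>i\<le>m. (- 1) ^ (m - i) / (fact i * fact (m - i)) :: complex)
      = (\<Sum>i\<le>m. of_nat (m choose i) * 1 ^ i * (- 1) ^ (m - i)) / fact m"
    unfolding sum_divide_distrib by (intro sum.cong) (auto simp: binomial_fact field_simps)
  also have "\<dots> = (1 + (- 1)) ^ m / fact m" by (simp only: binomial_ring)
  finally show ?thesis by (cases m) auto
qed

text \<open>The scalar Cauchy product is applied for each intermediate index \<open>k\<close> of the
  matrix product. Summing over \<open>k\<close> recombines the entries into \<open>A ^ m\<close>,
  whose coefficient vanishes unless \<open>m = 0\<close>.\<close>

lemma mexp_mult_mexp_minus:
  fixes A :: "complex mat"
  assumes A: "A \<in> carrier_mat n n"
  shows "mexp A * mexp ((- 1) \<cdot>\<^sub>m A) = 1\<^sub>m n"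
proof (rule square_mat_eqI[where n = "n"])
  fix i j assume ij: "i < n" "j < n"
  define a where "a k m = (A ^\<^sub>m m) $$ (i, k) / fact m" for k m
  define b where "b k m = (((- 1) \<cdot>\<^sub>m A) ^\<^sub>m m) $$ (k, j) / fact m" for k m
  have mA: "(- 1) \<cdot>\<^sub>m A \<in> carrier_mat n n" using A by simp
  have "(\<lambda>m. \<Sum>l\<le>m. a k l * b k (m - l)) sums (suminf (a k) * suminf (b k))" if "k < n" for k
    unfolding a_def b_def using A mA ij that by (intro Cauchy_product_sums summable_mexp) auto
  hence "(\<lambda>m. \<Sum>k<n. \<Sum>l\<le>m. a k l * b k (m - l)) sums (\<Sum>k<n. suminf (a k) * suminf (b k))"
    by (intro sums_sum) auto
  moreover have "(\<Sum>k<n. \<Sum>l\<le>m. a k l * b k (m - l)) = (if m = 0 then 1\<^sub>m n $$ (i, j) else 0)" for m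
  proof -
    have P: "A ^\<^sub>m l \<in> carrier_mat n n" for l using A by simp
    have "(\<Sum>k<n. \<Sum>l\<le>m. a k l * b k (m - l)) = (\<Sum>l\<le>m. \<Sum>k<n. a k l * b k (m - l))"
      by (rule sum.swap)
    also have "\<dots> = (\<Sum>l\<le>m. ((- 1) ^ (m - l) / (fact l * fact (m - l))) * (A ^\<^sub>m m) $$ (i, j))"
    proof (rule sum.cong[OF refl])
      fix l assume "l \<in> {..m}"
      hence "A ^\<^sub>m m = A ^\<^sub>m l * A ^\<^sub>m (m - l)" using pow_mat_add[OF A, of l "m - l"] by simp
      hence "(A ^\<^sub>m m) $$ (i, j) = (\<Sum>k<n. (A ^\<^sub>m l) $$ (i, k) * (A ^\<^sub>m (m - l)) $$ (k, j))"
        using A ij by (simp add: carrier_matD[OF P] scalar_prod_def lessThan_atLeast0)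
      thus "(\<Sum>k<n. a k l * b k (m - l)) =
          ((- 1) ^ (m - l) / (fact l * fact (m - l))) * (A ^\<^sub>m m) $$ (i, j)"
        using P[of "m - l"] ij A
        by (auto simp: a_def b_def pow_mat_smult[OF A] sum_distrib_left intro!: sum.cong)
    qed
    also have "\<dots> = (\<Sum>l\<le>m. (- 1) ^ (m - l) / (fact l * fact (m - l))) * (A ^\<^sub>m m) $$ (i, j)"
      by (rule sum_distrib_right[symmetric])
    finally show ?thesis using A by (simp add: alternating_fact_sum)
  qed
  ultimately have "(\<lambda>m. if m = 0 then 1\<^sub>m n $$ (i, j) else 0) sums (\<Sum>k<n. suminf (a k) * suminf (b k))"
    by simp
  hence "(\<Sum>k<n. suminf (a k) * suminf (b k)) = 1\<^sub>m n $$ (i, j)"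
    using sums_single[of 0 "\<lambda>m. 1\<^sub>m n $$ (i, j) :: complex"] sums_unique2 by blast
  moreover have "(mexp A * mexp ((- 1) \<cdot>\<^sub>m A)) $$ (i, j) = (\<Sum>k<n. suminf (a k) * suminf (b k))"
    using A ij by (simp add: scalar_prod_def mexp_def a_def[abs_def] b_def[abs_def] lessThan_atLeast0)
  ultimately show "(mexp A * mexp ((- 1) \<cdot>\<^sub>m A)) $$ (i, j) = 1\<^sub>m n $$ (i, j)" by simp
qed (use A in auto)

lemma mexp_adjoint:
  fixes A :: "complex mat"
  assumes A: "A \<in> carrier_mat n n"
  shows "adj (mexp A) = mexp (adj A)"
proof (rule square_mat_eqI[where n = "n"])
  fix i j assume ij: "i < n" "j < n"
  have P: "A ^\<^sub>m l \<in> carrier_mat n n" for l using A by simp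
  have s: "summable (\<lambda>m. (A ^\<^sub>m m) $$ (j, i) / fact m)"
    using summable_mexp[OF A ij(2,1)] by (rule summable_norm_cancel)
  have "adj (mexp A) $$ (i, j) = cnj (\<Sum>m. (A ^\<^sub>m m) $$ (j, i) / fact m)"
    using A ij by (simp add: mexp_def)
  also have "\<dots> = (\<Sum>m. cnj ((A ^\<^sub>m m) $$ (j, i) / fact m))"
    by (rule bounded_linear.suminf[OF bounded_linear_cnj s])
  also have "\<dots> = (\<Sum>m. (adj A ^\<^sub>m m) $$ (i, j) / fact m)"
  proof (rule suminf_cong)
    fix m
    show "cnj ((A ^\<^sub>m m) $$ (j, i) / fact m) = (adj A ^\<^sub>m m) $$ (i, j) / fact m"
      using A ij index_adjoint[of i "A ^\<^sub>m m" j]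
      by (simp add: carrier_matD[OF P] adjoint_pow_mat[OF A, symmetric])
  qed
  also have "\<dots> = mexp (adj A) $$ (i, j)" using A ij by (simp add: mexp_def)
  finally show "adj (mexp A) $$ (i, j) = mexp (adj A) $$ (i, j)" .
qed (use A in auto)

lemma mexp_skew_adjoint_unitary:
  fixes A :: "complex mat"
  assumes A: "A \<in> carrier_mat n n" and skew: "adj A = (- 1) \<cdot>\<^sub>m A"
  shows "adj (mexp A) * mexp A = 1\<^sub>m n" "mexp A * adj (mexp A) = 1\<^sub>m n"
proof -
  have m: "(- 1) \<cdot>\<^sub>m A \<in> carrier_mat n n" using A by simp
  have mm: "(- 1) \<cdot>\<^sub>m ((- 1) \<cdot>\<^sub>m A) = A" by (simp add: smult_smult_mat)
  show "adj (mexp A) * mexp A = 1\<^sub>m n"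
    using mexp_mult_mexp_minus[OF m] by (simp only: mexp_adjoint[OF A] skew mm)
  show "mexp A * adj (mexp A) = 1\<^sub>m n"
    using mexp_mult_mexp_minus[OF A] by (simp only: mexp_adjoint[OF A] skew)
qed

section \<open>Matrix units\<close>

definition matrix_units :: "nat \<Rightarrow> nat \<Rightarrow> (nat \<Rightarrow> nat \<Rightarrow> complex mat) \<Rightarrow> bool" where
  "matrix_units N n B \<longleftrightarrow> (\<forall>r<n. \<forall>s<n. B r s \<in> carrier_mat N N) \<and>
     (\<forall>r<n. \<forall>s<n. \<forall>t<n. \<forall>u<n. B r s * B t u = (if s = t then B r u else 0\<^sub>m N N)) \<and>
     msum N (\<lambda>r. B r r) {..<n} = 1\<^sub>m N"

text \<open>The linear map sending the standard matrix units to \<open>B\<close>. For a system of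
  matrix units it is a unital homomorphism, so that an exponential in the large tensor space can be
  computed in dimension \<open>n\<close>.\<close>

definition unit_emb :: "nat \<Rightarrow> nat \<Rightarrow> (nat \<Rightarrow> nat \<Rightarrow> complex mat) \<Rightarrow> complex mat \<Rightarrow> complex mat" where
  "unit_emb N n B X = mat N N (\<lambda>(i, j). \<Sum>r<n. \<Sum>s<n. X $$ (r, s) * B r s $$ (i, j))"

lemma unit_emb_carrier [simp]: "unit_emb N n B X \<in> carrier_mat N N"
  by (simp add: unit_emb_def)

lemma dim_unit_emb [simp]: "dim_row (unit_emb N n B X) = N" "dim_col (unit_emb N n B X) = N"
  by (simp_all add: unit_emb_def)

lemma unit_emb_one:
  assumes "matrix_units N n B"
  shows "unit_emb N n B (1\<^sub>m n) = 1\<^sub>m N"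
proof -
  have "unit_emb N n B (1\<^sub>m n) = msum N (\<lambda>r. B r r) {..<n}"
  proof (rule square_mat_eqI[where n = "N"])
    fix i j assume ij: "i < N" "j < N"
    have "(\<Sum>s<n. 1\<^sub>m n $$ (r, s) * B r s $$ (i, j)) = B r r $$ (i, j)" if "r < n" for r
    proof -
      have "(\<Sum>s<n. 1\<^sub>m n $$ (r, s) * B r s $$ (i, j)) = (\<Sum>s<n. if s = r then B r s $$ (i, j) else 0)"
        using that by (intro sum.cong) auto
      thus ?thesis using that by simp
    qed
    thus "unit_emb N n B (1\<^sub>m n) $$ (i, j) = msum N (\<lambda>r. B r r) {..<n} $$ (i, j)"
      using ij by (simp add: unit_emb_def)
  qed auto
  thus ?thesis using assms by (simp add: matrix_units_def)
qed

lemma unit_emb_mult: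
  assumes B: "matrix_units N n B" and X: "X \<in> carrier_mat n n" and Y: "Y \<in> carrier_mat n n"
  shows "unit_emb N n B X * unit_emb N n B Y = unit_emb N n B (X * Y)"
proof (rule square_mat_eqI[where n = "N"])
  fix i j assume ij: "i < N" "j < N"
  have BB: "(\<Sum>k<N. B r s $$ (i, k) * B t u $$ (k, j)) = (if s = t then B r u $$ (i, j) else 0)"
    if "r < n" "s < n" "t < n" "u < n" for r s t u
  proof -
    have c: "B r s \<in> carrier_mat N N" "B t u \<in> carrier_mat N N"
      using B that by (auto simp: matrix_units_def)
    have "(\<Sum>k<N. B r s $$ (i, k) * B t u $$ (k, j)) = (B r s * B t u) $$ (i, j)"
      using c ij by (simp add: scalar_prod_def lessThan_atLeast0)
    also have "B r s * B t u = (if s = t then B r u else 0\<^sub>m N N)"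
      using B that by (simp add: matrix_units_def)
    finally show ?thesis using ij by simp
  qed
  have "(unit_emb N n B X * unit_emb N n B Y) $$ (i, j) =
      (\<Sum>k<N. (\<Sum>r<n. \<Sum>s<n. X $$ (r, s) * B r s $$ (i, k)) * (\<Sum>t<n. \<Sum>u<n. Y $$ (t, u) * B t u $$ (k, j)))"
    using ij by (simp add: unit_emb_def scalar_prod_def lessThan_atLeast0)
  also have "\<dots> = (\<Sum>k<N. \<Sum>r<n. \<Sum>t<n. \<Sum>s<n. \<Sum>u<n.
      X $$ (r, s) * B r s $$ (i, k) * (Y $$ (t, u) * B t u $$ (k, j)))"
    by (simp only: sum_product)
  also have "\<dots> = (\<Sum>k<N. \<Sum>r<n. \<Sum>t<n. \<Sum>s<n. \<Sum>u<n.
      X $$ (r, s) * Y $$ (t, u) * (B r s $$ (i, k) * B t u $$ (k, j)))"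
    by (intro sum.cong refl) (simp only: mult_ac)
  also have "\<dots> = (\<Sum>r<n. \<Sum>t<n. \<Sum>s<n. \<Sum>u<n.
      X $$ (r, s) * Y $$ (t, u) * (\<Sum>k<N. B r s $$ (i, k) * B t u $$ (k, j)))"
    by (simp only: sum_distrib_left sum.swap[of _ _ "{..<N}"])
  also have "\<dots> = (\<Sum>r<n. \<Sum>t<n. \<Sum>s<n. \<Sum>u<n.
      if s = t then X $$ (r, s) * Y $$ (t, u) * B r u $$ (i, j) else 0)"
    by (intro sum.cong refl) (simp add: BB)
  also have "\<dots> = (\<Sum>r<n. \<Sum>t<n. \<Sum>u<n. \<Sum>s<n.
      if s = t then X $$ (r, s) * Y $$ (t, u) * B r u $$ (i, j) else 0)"
    by (intro sum.cong refl sum.swap)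
  also have "\<dots> = (\<Sum>r<n. \<Sum>t<n. \<Sum>u<n. X $$ (r, t) * Y $$ (t, u) * B r u $$ (i, j))"
    by (intro sum.cong refl) simp
  also have "\<dots> = (\<Sum>r<n. \<Sum>u<n. \<Sum>t<n. X $$ (r, t) * Y $$ (t, u) * B r u $$ (i, j))"
    by (intro sum.cong refl sum.swap)
  also have "\<dots> = (\<Sum>r<n. \<Sum>u<n. (X * Y) $$ (r, u) * B r u $$ (i, j))"
    using X Y by (intro sum.cong refl) (simp add: scalar_prod_def lessThan_atLeast0 sum_distrib_right)
  finally show "(unit_emb N n B X * unit_emb N n B Y) $$ (i, j) = unit_emb N n B (X * Y) $$ (i, j)"
    using ij by (simp add: unit_emb_def)
qed auto

lemma unit_emb_pow:
  assumes B: "matrix_units N n B" and X: "X \<in> carrier_mat n n"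
  shows "unit_emb N n B X ^\<^sub>m k = unit_emb N n B (X ^\<^sub>m k)"
  by (induction k) (use X in \<open>simp_all add: unit_emb_one[OF B] unit_emb_mult[OF B]\<close>)

text \<open>A homomorphism respects powers, and every entry of the image is a finite linear
  combination of entries of the argument, so it passes through the series.\<close>

lemma unit_emb_mexp:
  assumes B: "matrix_units N n B" and X: "X \<in> carrier_mat n n"
  shows "mexp (unit_emb N n B X) = unit_emb N n B (mexp X)"
proof (rule square_mat_eqI[where n = "N"])
  fix i j assume ij: "i < N" "j < N"
  have s: "(\<lambda>m. (X ^\<^sub>m m) $$ (r, s) / fact m) sums (mexp X $$ (r, s))" if "r < n" "s < n" for r s
    using summable_sums[OF summable_norm_cancel[OF summable_mexp[OF X that]]] X that
    by (simp add: mexp_def)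
  have "(\<lambda>m. \<Sum>r<n. \<Sum>s<n. (X ^\<^sub>m m) $$ (r, s) / fact m * B r s $$ (i, j)) sums
      (\<Sum>r<n. \<Sum>s<n. mexp X $$ (r, s) * B r s $$ (i, j))"
    by (intro sums_sum sums_mult2 s) auto
  moreover have "(\<Sum>r<n. \<Sum>s<n. (X ^\<^sub>m m) $$ (r, s) / fact m * B r s $$ (i, j))
      = (unit_emb N n B X ^\<^sub>m m) $$ (i, j) / fact m" for m
    unfolding unit_emb_pow[OF B X] using ij by (simp add: unit_emb_def sum_divide_distrib)
  ultimately have "(\<lambda>m. (unit_emb N n B X ^\<^sub>m m) $$ (i, j) / fact m) sums
      (\<Sum>r<n. \<Sum>s<n. mexp X $$ (r, s) * B r s $$ (i, j))"
    by simp
  thus "mexp (unit_emb N n B X) $$ (i, j) = unit_emb N n B (mexp X) $$ (i, j)"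
    using ij by (simp add: mexp_def sums_unique[symmetric]) (simp add: unit_emb_def mexp_def)
qed auto

declare replicate_Suc [simp del] \<comment> \<open>keeps the list in \<open>slot_def\<close> folded\<close>

section \<open>Tensor products\<close>

lemma kron_index:
  "i < dim_row A * dim_row B \<Longrightarrow> j < dim_col A * dim_col B \<Longrightarrow>
    kron A B $$ (i, j) = A $$ (i div dim_row B, j div dim_col B) * B $$ (i mod dim_row B, j mod dim_col B)"
  by (simp add: kron_def)

lemma mod_div_bounds:
  assumes "i < m * (n :: nat)"
  shows "i div n < m" "i mod n < n"
proof -
  have "0 < n" using assms by (auto intro: gr0I)
  thus "i div n < m" "i mod n < n" using assms by (auto simp: less_mult_imp_div_less)
qed

lemma kron_carrier [simp]:
  "A \<in> carrier_mat m m \<Longrightarrow> B \<in> carrier_mat n n \<Longrightarrow> kron A B \<in> carrier_mat (m * n) (m * n)"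
  by (auto simp: kron_def)

lemma kron_add:
  fixes A B C :: "complex mat"
  shows "A \<in> carrier_mat m m \<Longrightarrow> B \<in> carrier_mat m m \<Longrightarrow> C \<in> carrier_mat n n \<Longrightarrow>
      kron (A + B) C = kron A C + kron B C"
    and "A \<in> carrier_mat n n \<Longrightarrow> B \<in> carrier_mat n n \<Longrightarrow> C \<in> carrier_mat m m \<Longrightarrow>
      kron C (A + B) = kron C A + kron C B"
  by (auto intro!: eq_matI simp: kron_index mod_div_bounds algebra_simps)

lemma kron_smult:
  fixes A B :: "complex mat"
  assumes "A \<in> carrier_mat m m" "B \<in> carrier_mat n n"
  shows "kron (a \<cdot>\<^sub>m A) B = a \<cdot>\<^sub>m kron A B" "kron A (a \<cdot>\<^sub>m B) = a \<cdot>\<^sub>m kron A B"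
  using assms by (auto intro!: eq_matI simp: kron_index mod_div_bounds)

lemma kron_adjoint: "adj (kron A B) = kron (adj A) (adj B)"
  by (intro eq_matI) (auto simp: kron_index mod_div_bounds)

lemma kron_one: "kron (1\<^sub>m m) (1\<^sub>m n) = 1\<^sub>m (m * n)"
proof (rule square_mat_eqI[where n = "m * n"])
  fix i j assume ij: "i < m * n" "j < m * n"
  have "i = j \<longleftrightarrow> i div n = j div n \<and> i mod n = j mod n" by (metis div_mult_mod_eq)
  thus "kron (1\<^sub>m m) (1\<^sub>m n) $$ (i, j) = 1\<^sub>m (m * n) $$ (i, j)"
    using ij mod_div_bounds[OF ij(1)] mod_div_bounds[OF ij(2)] by (simp add: kron_index)
qed auto

abbreviation lamsq :: "homodyne \<Rightarrow> complex" where
  "lamsq H \<equiv> complex_of_real ((lam H)\<^sup>2)"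

abbreviation M2 :: "complex mat set" where
  "M2 \<equiv> carrier_mat 2 2"

abbreviation mats2 :: "complex mat list \<Rightarrow> bool" where
  "mats2 As \<equiv> set As \<subseteq> M2"

lemma tensor_list_simps: "tensor_list [] = 1\<^sub>m 1" "tensor_list (A # As) = kron A (tensor_list As)"
  by (simp_all add: tensor_list_def)

lemma tensor_list_closed: "mats2 As \<Longrightarrow> tensor_list As \<in> carrier_mat (2 ^ length As) (2 ^ length As)"
  by (rule tensor_list_carrier) auto

lemma dim_tensor_list:
  assumes "mats2 As"
  shows "dim_row (tensor_list As) = 2 ^ length As" "dim_col (tensor_list As) = 2 ^ length As"
  using tensor_list_closed[OF assms] by auto

lemma tensor_list_mult:
  "length As = length Bs \<Longrightarrow> mats2 As \<Longrightarrow> mats2 Bs \<Longrightarrow>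
    tensor_list As * tensor_list Bs = tensor_list (map2 (*) As Bs)"
proof (induction As Bs rule: list_induct2)
  case (Cons A As B Bs)
  hence AB: "A \<in> M2" "B \<in> M2" "mats2 As" "mats2 Bs" by auto
  show ?case
    using Cons AB by (simp add: tensor_list_simps kron_mult dim_tensor_list carrier_matD[of _ 2 2])
qed (simp add: tensor_list_simps)

lemma tensor_list_adjoint: "adj (tensor_list As) = tensor_list (map adj As)"
  by (induction As) (simp_all add: tensor_list_simps kron_adjoint)

lemma tensor_list_one: "tensor_list (replicate m (1\<^sub>m 2)) = 1\<^sub>m (2 ^ m)"
  by (induction m) (simp_all add: tensor_list_simps kron_one replicate_Suc)

lemma mtrace_tensor_list: "mats2 As \<Longrightarrow> mtrace (tensor_list As) = (\<Prod>A\<leftarrow>As. mtrace A)"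
proof (induction As)
  case (Cons A As)
  hence AB: "A \<in> M2" "mats2 As" by auto
  show ?case
    using Cons AB mtrace_kron[OF AB(1) tensor_list_closed[OF AB(2)]] by (simp add: tensor_list_simps)
qed (simp add: tensor_list_simps mtrace_def)

lemma mats2_update: "mats2 As \<Longrightarrow> X \<in> M2 \<Longrightarrow> mats2 (As[i := X])"
  by (meson order_trans set_update_subset_insert insert_subset)

lemma mats2_nth: "mats2 As \<Longrightarrow> i < length As \<Longrightarrow> As ! i \<in> M2"
  using nth_mem by blast

lemma tensor_list_update_add:
  assumes "mats2 As" "X \<in> M2" "Y \<in> M2" "i < length As"
  shows "tensor_list (As[i := X + Y]) = tensor_list (As[i := X]) + tensor_list (As[i := Y])"
  using assms(1,4)
proof (induction As arbitrary: i)
  case (Cons A As)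
  hence A: "A \<in> M2" and As: "mats2 As" by auto
  show ?case
  proof (cases i)
    case 0
    thus ?thesis using kron_add(1)[OF assms(2,3) tensor_list_closed[OF As]] by (simp add: tensor_list_simps)
  next
    case (Suc i')
    have "tensor_list (As[i' := X + Y]) = tensor_list (As[i' := X]) + tensor_list (As[i' := Y])"
      using Cons As Suc by simp
    thus ?thesis
      using Suc kron_add(2)[OF tensor_list_closed[OF mats2_update[OF As assms(2), of i']] _ A]
        tensor_list_closed[OF mats2_update[OF As assms(3), of i']]
      by (simp add: tensor_list_simps)
  qed
qed simp

lemma tensor_list_update_smult:
  assumes "mats2 As" "X \<in> M2" "i < length As"
  shows "tensor_list (As[i := a \<cdot>\<^sub>m X]) = a \<cdot>\<^sub>m tensor_list (As[i := X])"
  using assms(1,3)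
proof (induction As arbitrary: i)
  case (Cons A As)
  hence A: "A \<in> M2" and As: "mats2 As" by auto
  show ?case
  proof (cases i)
    case 0
    thus ?thesis using kron_smult(1)[OF assms(2) tensor_list_closed[OF As]] by (simp add: tensor_list_simps)
  next
    case (Suc i')
    have "tensor_list (As[i' := a \<cdot>\<^sub>m X]) = a \<cdot>\<^sub>m tensor_list (As[i' := X])"
      using Cons As Suc by simp
    thus ?thesis
      using Suc kron_smult(2)[OF A tensor_list_closed[OF mats2_update[OF As assms(2), of i']]]
      by (simp add: tensor_list_simps)
  qed
qed simp

text \<open>By homogeneity in slot \<open>i\<close>: the zero factor equals 0 times itself, hence so
  does the whole tensor product.\<close>

lemma tensor_list_zero:
  assumes "mats2 As" "i < length As" "As ! i = 0\<^sub>m 2 2"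
  shows "tensor_list As = 0\<^sub>m (2 ^ length As) (2 ^ length As)"
proof -
  have z: "0 \<cdot>\<^sub>m 0\<^sub>m 2 2 = (0\<^sub>m 2 2 :: complex mat)" by simp
  have upd: "As[i := 0\<^sub>m 2 2] = As" using assms(3) by (metis list_update_id)
  have "tensor_list As = 0 \<cdot>\<^sub>m tensor_list As"
    using tensor_list_update_smult[OF assms(1) zero_carrier_mat assms(2), of 0] by (simp add: z upd)
  moreover have "0 \<cdot>\<^sub>m tensor_list As = 0\<^sub>m (2 ^ length As) (2 ^ length As)"
    using tensor_list_closed[OF assms(1)] by (intro eq_matI) auto
  ultimately show ?thesis by simp
qed

section \<open>Operators acting on one slot\<close>

text \<open>Unlike the abbreviation \<open>tdim\<close>, the constant \<open>hdim\<close> is not rewritten by the simplifier.\<close>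

definition hdim :: "homodyne \<Rightarrow> nat" where
  "hdim H = 2 ^ Suc (nsteps H)"

abbreviation ops :: "homodyne \<Rightarrow> complex mat set" where
  "ops H \<equiv> carrier_mat (hdim H) (hdim H)"

lemma tensor_list_hdim:
  "mats2 As \<Longrightarrow> length As = Suc (nsteps H) \<Longrightarrow> tensor_list As \<in> ops H"
  using tensor_list_closed[of As] by (simp only: hdim_def)

lemma mats2_slot: "X \<in> M2 \<Longrightarrow> mats2 ((replicate m (1\<^sub>m 2))[i := X])"
  by (rule mats2_update) auto

lemma slot_carrier [simp]: "X \<in> M2 \<Longrightarrow> slot H i X \<in> ops H"
  unfolding slot_def by (intro tensor_list_hdim mats2_slot) auto

lemma dim_slot [simp]:
  "X \<in> M2 \<Longrightarrow> dim_row (slot H i X) = hdim H"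
  "X \<in> M2 \<Longrightarrow> dim_col (slot H i X) = hdim H"
  by (rule carrier_matD[OF slot_carrier], assumption)+

lemma slot_mult_tensor:
  assumes X: "X \<in> M2" and As: "mats2 As" "length As = Suc (nsteps H)" and i: "i \<le> nsteps H"
  shows "slot H i X * tensor_list As = tensor_list (As[i := X * As ! i])"
proof -
  have "map2 (*) ((replicate (Suc (nsteps H)) (1\<^sub>m 2))[i := X]) As = As[i := X * As ! i]"
  proof (rule nth_equalityI)
    fix j assume "j < length (map2 (*) ((replicate (Suc (nsteps H)) (1\<^sub>m 2))[i := X]) As)"
    hence j: "j < Suc (nsteps H)" using As by simp
    show "map2 (*) ((replicate (Suc (nsteps H)) (1\<^sub>m 2))[i := X]) As ! j = As[i := X * As ! i] ! j"
      using j As mats2_nth[OF As(1), of j] by (cases "j = i") simp_all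
  qed (use As in simp)
  thus ?thesis unfolding slot_def
    using As X by (subst tensor_list_mult) (auto intro: mats2_slot[THEN subsetD])
qed

lemma tensor_mult_slot:
  assumes X: "X \<in> M2" and As: "mats2 As" "length As = Suc (nsteps H)" and i: "i \<le> nsteps H"
  shows "tensor_list As * slot H i X = tensor_list (As[i := As ! i * X])"
proof -
  have "map2 (*) As ((replicate (Suc (nsteps H)) (1\<^sub>m 2))[i := X]) = As[i := As ! i * X]"
  proof (rule nth_equalityI)
    fix j assume "j < length (map2 (*) As ((replicate (Suc (nsteps H)) (1\<^sub>m 2))[i := X]))"
    hence j: "j < Suc (nsteps H)" using As by simp
    show "map2 (*) As ((replicate (Suc (nsteps H)) (1\<^sub>m 2))[i := X]) ! j = As[i := As ! i * X] ! j"
      using j As mats2_nth[OF As(1), of j] by (cases "j = i") simp_all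
  qed (use As in simp)
  thus ?thesis unfolding slot_def
    using As X by (subst tensor_list_mult) (auto intro: mats2_slot[THEN subsetD])
qed

lemma slot_one: "slot H i (1\<^sub>m 2) = 1\<^sub>m (hdim H)"
proof -
  have "(replicate (Suc (nsteps H)) (1\<^sub>m 2 :: complex mat))[i := 1\<^sub>m 2] = replicate (Suc (nsteps H)) (1\<^sub>m 2)"
    by (metis list_update_beyond list_update_id nth_replicate not_le length_replicate)
  thus ?thesis unfolding slot_def by (simp only: tensor_list_one hdim_def)
qed

lemma slot_mult:
  assumes "X \<in> M2" "Y \<in> M2" "i \<le> nsteps H"
  shows "slot H i X * slot H i Y = slot H i (X * Y)"
proof -
  have "slot H i X * slot H i Y =
      slot H i X * tensor_list ((replicate (Suc (nsteps H)) (1\<^sub>m 2))[i := Y])" by (simp only: slot_def)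
  also have "\<dots> = tensor_list (((replicate (Suc (nsteps H)) (1\<^sub>m 2))[i := Y])
      [i := X * ((replicate (Suc (nsteps H)) (1\<^sub>m 2))[i := Y]) ! i])"
    using assms by (intro slot_mult_tensor mats2_slot) auto
  also have "\<dots> = slot H i (X * Y)"
    using assms by (simp add: slot_def)
  finally show ?thesis .
qed

text \<open>In the tensor list of the second operator slot \<open>i\<close> holds the identity, so
  multiplying by \<open>X\<close> from either side produces the same list.\<close>

lemma slot_commute:
  assumes "X \<in> M2" "Y \<in> M2" "i \<le> nsteps H" "j \<le> nsteps H" "i \<noteq> j"
  shows "slot H i X * slot H j Y = slot H j Y * slot H i X"
proof -
  define A where "A = ((replicate (Suc (nsteps H)) (1\<^sub>m 2))[j := Y])"
  have A: "mats2 A" "length A = Suc (nsteps H)" "A ! i = 1\<^sub>m 2"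
    using assms mats2_slot[of Y "Suc (nsteps H)" j] by (simp_all add: A_def)
  have "slot H i X * slot H j Y = slot H i X * tensor_list A" by (simp only: slot_def A_def)
  also have "\<dots> = tensor_list (A[i := X])"
    using assms A by (subst slot_mult_tensor) auto
  also have "\<dots> = tensor_list A * slot H i X"
    using assms A by (subst tensor_mult_slot) auto
  finally show ?thesis by (simp only: slot_def A_def)
qed

lemma slot_add:
  assumes "X \<in> M2" "Y \<in> M2" "i \<le> nsteps H"
  shows "slot H i (X + Y) = slot H i X + slot H i Y"
  unfolding slot_def using assms by (intro tensor_list_update_add) auto

lemma slot_smult:
  assumes "X \<in> M2" "i \<le> nsteps H"
  shows "slot H i (a \<cdot>\<^sub>m X) = a \<cdot>\<^sub>m slot H i X"
  unfolding slot_def using assms by (intro tensor_list_update_smult) auto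

lemma slot_zero: "i \<le> nsteps H \<Longrightarrow> slot H i (0\<^sub>m 2 2) = 0\<^sub>m (hdim H) (hdim H)"
  unfolding slot_def hdim_def
  using tensor_list_zero[OF mats2_slot, of "0\<^sub>m 2 2" i "Suc (nsteps H)" i]
  by (simp only: length_list_update length_replicate) simp

lemma slot_adjoint: "adj (slot H i X) = slot H i (adj X)"
  by (simp add: slot_def tensor_list_adjoint map_update)

section \<open>Observation records\<close>

text \<open>The spectral projector of \<open>\<lambda> (\<sigma>\<^sub>- + \<sigma>\<^sub>+)\<close> for the eigenvalue \<open>y = \<plusminus>\<lambda>\<close>;
  only the sign of \<open>y\<close> enters.\<close>

definition hproj :: "real \<Rightarrow> complex mat" where
  "hproj y = mat 2 2 (\<lambda>(i, j). if i = j then 1 / 2 else of_real (sgn y) / 2)"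

lemma hproj_carrier [simp]: "hproj y \<in> M2"
  by (simp add: hproj_def)

lemma mat2_eqI:
  assumes "A \<in> M2" "B \<in> M2"
    "A $$ (0, 0) = B $$ (0, 0)" "A $$ (0, 1) = B $$ (0, 1)" "A $$ (1, 0) = B $$ (1, 0)" "A $$ (1, 1) = B $$ (1, 1)"
  shows "A = B"
proof (rule eq_matI)
  fix i j assume "i < dim_row B" "j < dim_col B"
  hence "i = 0 \<or> i = 1" "j = 0 \<or> j = 1" using assms(2) by auto
  thus "A $$ (i, j) = B $$ (i, j)" using assms by auto
qed (use assms in auto)

lemma index_mult_mat2:
  assumes "A \<in> M2" "B \<in> M2" "i < 2" "j < 2"
  shows "(A * B) $$ (i, j) = A $$ (i, 0) * B $$ (0, j) + A $$ (i, 1) * B $$ (1, j)"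
  using assms by (simp add: scalar_prod_def numeral_2_eq_2)

lemma mtrace_mat2: "A \<in> M2 \<Longrightarrow> mtrace A = A $$ (0, 0) + A $$ (1, 1)"
  by (simp add: mtrace_def numeral_2_eq_2)

lemma index_hproj: "i < 2 \<Longrightarrow> j < 2 \<Longrightarrow> hproj y $$ (i, j) = (if i = j then 1 / 2 else of_real (sgn y) / 2)"
  by (simp add: hproj_def)

lemma hproj_idem: "y \<noteq> 0 \<Longrightarrow> hproj y * hproj y = hproj y"
  by (rule mat2_eqI) (simp_all add: index_mult_mat2 index_hproj sgn_if)

lemma hproj_orth: "y \<noteq> 0 \<Longrightarrow> hproj y * hproj (- y) = 0\<^sub>m 2 2"
  by (rule mat2_eqI) (simp_all add: index_mult_mat2 index_hproj sgn_if)

lemma hproj_adjoint [simp]: "adj (hproj y) = hproj y"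
  by (rule eq_matI) (auto simp: index_hproj carrier_matD[OF hproj_carrier])

lemma hproj_sum: "hproj y + hproj (- y) = 1\<^sub>m 2"
  by (rule mat2_eqI) (simp_all add: index_hproj sgn_minus carrier_matD[OF hproj_carrier])

lemma mtrace_hproj [simp]: "mtrace (hproj y) = 1"
  by (simp add: mtrace_mat2 index_hproj)

text \<open>The joint spectral projector of \<open>dZ H 1\<close>, ...,
  \<open>dZ H (length ys)\<close> for the outcomes \<open>ys\<close>. The leading identity belongs
  to the system, the trailing ones to field slots not yet observed.\<close>

definition recproj :: "homodyne \<Rightarrow> real list \<Rightarrow> complex mat" where
  "recproj H ys = tensor_list (1\<^sub>m 2 # map hproj ys @ replicate (nsteps H - length ys) (1\<^sub>m 2))"

lemma recproj_Nil: "recproj H [] = 1\<^sub>m (hdim H)"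
proof -
  have "recproj H [] = tensor_list (replicate (Suc (nsteps H)) (1\<^sub>m 2))"
    by (simp add: recproj_def replicate_Suc)
  thus ?thesis by (simp only: tensor_list_one hdim_def)
qed

lemma recproj_carrier:
  "length ys \<le> nsteps H \<Longrightarrow> recproj H ys \<in> ops H"
  unfolding recproj_def by (intro tensor_list_hdim) auto

lemma records_Suc: "records H (Suc n) = (\<lambda>(ys, y). ys @ [y]) ` (records H n \<times> {lam H, - lam H})"
proof (rule equalityI; rule subsetI)
  fix zs assume zs: "zs \<in> records H (Suc n)"
  then obtain ys y where "zs = ys @ [y]" by (cases zs rule: rev_cases) (auto simp: records_def)
  thus "zs \<in> (\<lambda>(ys, y). ys @ [y]) ` (records H n \<times> {lam H, - lam H})"
    using zs by (auto simp: records_def image_iff)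
qed (auto simp: records_def)

lemma finite_records [simp]: "finite (records H n)"
proof -
  have "records H n = {ys. set ys \<subseteq> {lam H, - lam H} \<and> length ys = n}" by (auto simp: records_def)
  thus ?thesis by (simp only: finite_lists_length_eq finite.intros)
qed

lemma records_0 [simp]: "records H 0 = {[]}"
  by (auto simp: records_def)

lemma sum_records_Suc:
  "(\<Sum>zs\<in>records H (Suc n). f zs) = (\<Sum>ys\<in>records H n. \<Sum>y\<in>{lam H, - lam H}. f (ys @ [y]))"
proof -
  have "(\<Sum>zs\<in>records H (Suc n). f zs)
      = (\<Sum>p\<in>records H n \<times> {lam H, - lam H}. f ((\<lambda>(ys, y). ys @ [y]) p))"
    unfolding records_Suc by (subst sum.reindex) (auto simp: inj_on_def)
  thus ?thesis by (simp add: sum.cartesian_product case_prod_unfold)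
qed

lemma records_length: "ys \<in> records H n \<Longrightarrow> length ys = n"
  by (simp add: records_def)

lemma records_nth:
  assumes "ys \<in> records H n" "i < n"
  shows "ys ! i = lam H \<or> ys ! i = - lam H"
proof -
  have "ys ! i \<in> set ys" "set ys \<subseteq> {lam H, - lam H}" using assms by (simp_all add: records_def)
  thus ?thesis by blast
qed

lemma lam_pos: "homodyne_model H \<Longrightarrow> 0 < lam H"
  by (simp add: homodyne_model_def lam_def)

lemma recproj_mult_slot:
  assumes "length ys < nsteps H"
  shows "recproj H ys * slot H (Suc (length ys)) (hproj y) = recproj H (ys @ [y])"
proof -
  let ?A = "1\<^sub>m 2 # map hproj ys @ replicate (nsteps H - length ys) (1\<^sub>m 2)"
  have m: "nsteps H - length ys = Suc (nsteps H - Suc (length ys))" using assms by simp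
  have "recproj H ys * slot H (Suc (length ys)) (hproj y)
      = tensor_list (?A[Suc (length ys) := ?A ! Suc (length ys) * hproj y])"
    unfolding recproj_def using assms by (intro tensor_mult_slot) auto
  also have "?A[Suc (length ys) := ?A ! Suc (length ys) * hproj y]
      = 1\<^sub>m 2 # map hproj (ys @ [y]) @ replicate (nsteps H - length (ys @ [y])) (1\<^sub>m 2)"
    unfolding m by (simp add: replicate_Suc nth_append list_update_append carrier_matD[OF hproj_carrier])
  finally show ?thesis unfolding recproj_def .
qed

lemma records_recproj_carrier:
  "ys \<in> records H n \<Longrightarrow> n \<le> nsteps H \<Longrightarrow> recproj H ys \<in> ops H"
  by (simp add: recproj_carrier records_length)

lemma recproj_adjoint: "adj (recproj H ys) = recproj H ys"
  by (simp add: recproj_def tensor_list_adjoint comp_def)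

lemma recproj_snoc_sum:
  assumes "length ys < nsteps H"
  shows "recproj H (ys @ [y]) + recproj H (ys @ [- y]) = recproj H ys"
proof -
  have c: "recproj H ys \<in> ops H" using assms by (intro recproj_carrier) auto
  have "recproj H (ys @ [y]) + recproj H (ys @ [- y])
      = recproj H ys * (slot H (Suc (length ys)) (hproj y) + slot H (Suc (length ys)) (hproj (- y)))"
    using c by (simp add: recproj_mult_slot[OF assms, symmetric] mat_distrib_left)
  also have "\<dots> = recproj H ys * slot H (Suc (length ys)) (hproj y + hproj (- y))"
    using assms by (simp add: slot_add)
  also have "\<dots> = recproj H ys" using c by (simp add: hproj_sum slot_one)
  finally show ?thesis .
qed

text \<open>Entries of records are \<open>lam H\<close> or its negative, so two different records
  have opposite entries at some position, and there the factors \<open>hproj\<close> are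
  orthogonal.\<close>

lemma recproj_mult:
  assumes "homodyne_model H" "ys \<in> records H n" "zs \<in> records H n" "n \<le> nsteps H"
  shows "recproj H ys * recproj H zs = (if ys = zs then recproj H ys else 0\<^sub>m (hdim H) (hdim H))"
proof -
  have l0: "0 < lam H" using assms lam_pos by blast
  have len: "length ys = n" "length zs = n" using assms by (auto simp: records_def)
  let ?r = "replicate (nsteps H - n) (1\<^sub>m 2 :: complex mat)"
  have m: "recproj H ys * recproj H zs = tensor_list (1\<^sub>m 2 # map2 (*) (map hproj ys) (map hproj zs) @ ?r)"
    unfolding recproj_def len using len
    by (subst tensor_list_mult) (auto simp: zip_append map2_map_map zip_replicate)
  have val: "ys ! i = lam H \<or> ys ! i = - lam H" "zs ! i = lam H \<or> zs ! i = - lam H" if "i < n" for i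
    
    using records_nth[OF assms(2) that] records_nth[OF assms(3) that] by auto
  have nz: "ys ! i \<noteq> 0" if "i < n" for i using val(1)[OF that] l0 by auto
  show ?thesis
  proof (cases "ys = zs")
    case True
    have "map2 (*) (map hproj ys) (map hproj zs) = map hproj ys"
      using True len nz by (intro nth_equalityI) (auto intro!: hproj_idem)
    thus ?thesis using m True len by (simp add: recproj_def)
  next
    case False
    then obtain i where i: "i < n" "ys ! i \<noteq> zs ! i" using len by (metis nth_equalityI)
    hence "zs ! i = - (ys ! i)" "ys ! i \<noteq> 0" using val[of i] l0 by auto
    hence z: "map2 (*) (map hproj ys) (map hproj zs) ! i = 0\<^sub>m 2 2" using i len by (simp add: hproj_orth)
    let ?A = "1\<^sub>m 2 # map2 (*) (map hproj ys) (map hproj zs) @ ?r"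
    have "mats2 ?A" by (auto elim!: in_set_zipE)
    moreover have "Suc i < length ?A" "?A ! Suc i = 0\<^sub>m 2 2" using z i len by (auto simp: nth_append)
    ultimately have "tensor_list ?A = 0\<^sub>m (2 ^ length ?A) (2 ^ length ?A)" by (rule tensor_list_zero)
    moreover have "length ?A = Suc (nsteps H)" using len assms by simp
    ultimately show ?thesis using m False by (simp only: hdim_def if_False)
  qed
qed

text \<open>Summing over the last outcome replaces its projector by the identity, by
  \<open>recproj_snoc_sum\<close>; induction removes one slot after the other.\<close>

lemma msum_recproj:
  assumes "homodyne_model H" "n \<le> nsteps H"
  shows "msum (hdim H) (recproj H) (records H n) = 1\<^sub>m (hdim H)"
  using assms(2)
proof (induction n)
  case 0
  show ?case by (simp add: recproj_Nil)
next
  case (Suc n)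
  have l0: "lam H \<noteq> - lam H" using lam_pos[OF assms(1)] by simp
  have "msum (hdim H) (recproj H) (records H (Suc n)) = msum (hdim H) (recproj H) (records H n)"
  proof (rule square_mat_eqI[where n = "hdim H"])
    fix i j assume ij: "i < hdim H" "j < hdim H"
    have "(\<Sum>y\<in>{lam H, - lam H}. recproj H (ys @ [y]) $$ (i, j)) = recproj H ys $$ (i, j)"
      if "ys \<in> records H n" for ys
    proof -
      have len: "length ys < nsteps H" using that Suc by (simp add: records_def)
      have "recproj H ys $$ (i, j) = (recproj H (ys @ [lam H]) + recproj H (ys @ [- lam H])) $$ (i, j)"
        by (simp only: recproj_snoc_sum[OF len])
      moreover have "recproj H (ys @ [- lam H]) \<in> ops H"
        using len by (intro recproj_carrier) auto
      ultimately show ?thesis using ij l0 by simp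
    qed
    thus "msum (hdim H) (recproj H) (records H (Suc n)) $$ (i, j) =
        msum (hdim H) (recproj H) (records H n) $$ (i, j)"
      using ij by (simp add: sum_records_Suc)
  qed auto
  thus ?case using Suc by simp
qed

lemma spectral_family_recproj:
  assumes "homodyne_model H" "n \<le> nsteps H"
  shows "spectral_family (hdim H) (records H n) (recproj H)"
  unfolding spectral_family_def orth_proj_def
  using assms recproj_mult[OF assms(1) _ _ assms(2)] msum_recproj[OF assms]
    recproj_carrier[of _ H] records_length[of _ H n]
  by (auto simp: recproj_adjoint)

section \<open>Operators acting on the system and one field slot\<close>

definition emat :: "nat \<Rightarrow> nat \<Rightarrow> complex mat" where
  "emat p q = mat 2 2 (\<lambda>(i, j). if i = p \<and> j = q then 1 else 0)"

lemma emat_carrier [simp]: "emat p q \<in> M2"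
  by (simp add: emat_def)

lemma dim_emat [simp]: "dim_row (emat p q) = 2" "dim_col (emat p q) = 2"
  by (simp_all add: emat_def)

lemma index_emat: "i < 2 \<Longrightarrow> j < 2 \<Longrightarrow> emat p q $$ (i, j) = (if i = p \<and> j = q then 1 else 0)"
  by (simp add: emat_def)

lemma nat_less_2_cases: "(p :: nat) < 2 \<Longrightarrow> p = 0 \<or> p = 1"
  by auto

lemma emat_mult:
  assumes "q < 2"
  shows "emat p q * emat r s = (if q = r then emat p s else 0\<^sub>m 2 2)"
  using nat_less_2_cases[OF assms]
  by (intro mat2_eqI) (auto simp: index_mult_mat2 index_emat simp del: index_mult_mat(1))

lemma emat_adjoint [simp]: "adj (emat p q) = emat q p"
  by (intro mat2_eqI) (auto simp: index_emat)

lemma emat_one: "emat 0 0 + emat 1 1 = 1\<^sub>m 2"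
  by (intro mat2_eqI) (auto simp: index_emat)

lemma sigma_minus_eq: "sigma_minus = emat 1 0"
  by (intro eq_matI) (auto simp: sigma_minus_def mat_of_rows_list_def emat_def less_Suc_eq numeral_2_eq_2)

lemma sigma_plus_eq: "sigma_plus = emat 0 1"
  by (simp add: sigma_plus_def sigma_minus_eq)

lemma vac_proj_eq: "vac_proj = emat 1 1"
  by (intro eq_matI) (auto simp: vac_proj_def vac_vec_def emat_def less_Suc_eq numeral_2_eq_2)

text \<open>\<open>hproj y\<close> has rank one, so compressing any matrix gives a multiple of it.
  The scalar is the matrix element in the unit eigenvector
  \<open>(1, sgn y) / sqrt 2\<close>.\<close>

lemma hproj_emat_hproj:
  assumes "p < 2" "q < 2" "y \<noteq> 0"
  shows "hproj y * emat p q * hproj y = (if p = q then 1 / 2 else of_real (sgn y) / 2) \<cdot>\<^sub>m hproj y"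
  using nat_less_2_cases[OF assms(1)] nat_less_2_cases[OF assms(2)] assms(3)
  by (intro mat2_eqI) (auto simp: index_mult_mat2 index_emat index_hproj carrier_matD[OF hproj_carrier] sgn_if simp del: index_mult_mat(1))

definition two_slot :: "homodyne \<Rightarrow> nat \<Rightarrow> complex mat \<Rightarrow> complex mat \<Rightarrow> complex mat" where
  "two_slot H l X Y = slot H 0 X * slot H l Y"

lemma two_slot_carrier [simp]:
  "X \<in> M2 \<Longrightarrow> Y \<in> M2 \<Longrightarrow> two_slot H l X Y \<in> ops H"
  by (simp add: two_slot_def)

lemma dim_two_slot [simp]:
  "X \<in> M2 \<Longrightarrow> dim_row (two_slot H l X Y) = hdim H"
  "Y \<in> M2 \<Longrightarrow> dim_col (two_slot H l X Y) = hdim H"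
  by (simp_all add: two_slot_def)

lemma two_slot_mult:
  assumes "X \<in> M2" "Y \<in> M2" "X' \<in> M2" "Y' \<in> M2"
    and l: "1 \<le> l" "l \<le> nsteps H"
  shows "two_slot H l X Y * two_slot H l X' Y' = two_slot H l (X * X') (Y * Y')"
proof -
  have "two_slot H l X Y * two_slot H l X' Y'
      = slot H 0 X * ((slot H l Y * slot H 0 X') * slot H l Y')"
    using assms by (simp add: two_slot_def mat_mult_assoc)
  also have "slot H l Y * slot H 0 X' = slot H 0 X' * slot H l Y"
    using assms by (intro slot_commute) auto
  also have "slot H 0 X * ((slot H 0 X' * slot H l Y) * slot H l Y')
      = (slot H 0 X * slot H 0 X') * (slot H l Y * slot H l Y')"
    using assms by (simp add: mat_mult_assoc)
  also have "\<dots> = two_slot H l (X * X') (Y * Y')"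
    using assms by (simp add: two_slot_def slot_mult)
  finally show ?thesis .
qed

lemma two_slot_add_left:
  "X \<in> M2 \<Longrightarrow> X' \<in> M2 \<Longrightarrow> Y \<in> M2 \<Longrightarrow>
    two_slot H l (X + X') Y = two_slot H l X Y + two_slot H l X' Y"
  by (simp add: two_slot_def slot_add mat_distrib_right)

lemma two_slot_add_right:
  "X \<in> M2 \<Longrightarrow> Y \<in> M2 \<Longrightarrow> Y' \<in> M2 \<Longrightarrow> l \<le> nsteps H \<Longrightarrow>
    two_slot H l X (Y + Y') = two_slot H l X Y + two_slot H l X Y'"
  by (simp add: two_slot_def slot_add mat_distrib_left)

lemma two_slot_smult_left:
  "X \<in> M2 \<Longrightarrow> Y \<in> M2 \<Longrightarrow> two_slot H l (a \<cdot>\<^sub>m X) Y = a \<cdot>\<^sub>m two_slot H l X Y"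
  by (simp add: two_slot_def slot_smult smult_mat_mult)

lemma two_slot_zero_left:
  "Y \<in> M2 \<Longrightarrow> two_slot H l (0\<^sub>m 2 2) Y = 0\<^sub>m (hdim H) (hdim H)"
  by (simp add: two_slot_def slot_zero)

lemma two_slot_zero_right:
  "X \<in> M2 \<Longrightarrow> l \<le> nsteps H \<Longrightarrow> two_slot H l X (0\<^sub>m 2 2) = 0\<^sub>m (hdim H) (hdim H)"
  by (simp add: two_slot_def slot_zero)

lemma two_slot_one: "two_slot H l (1\<^sub>m 2) (1\<^sub>m 2) = 1\<^sub>m (hdim H)"
  by (simp add: two_slot_def slot_one)

lemma two_slot_adjoint:
  assumes "X \<in> M2" "Y \<in> M2" "1 \<le> l" "l \<le> nsteps H"
  shows "adj (two_slot H l X Y) = two_slot H l (adj X) (adj Y)"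
proof -
  have "adj (two_slot H l X Y) = slot H l (adj Y) * slot H 0 (adj X)"
    using assms by (simp add: two_slot_def adjoint_mult slot_adjoint)
  thus ?thesis using assms unfolding two_slot_def by (subst slot_commute) auto
qed

lemma two_slot_index:
  assumes X: "X \<in> M2" and Y: "Y \<in> M2" and ij: "i < hdim H" "j < hdim H"
  shows "two_slot H l X Y $$ (i, j) =
    X $$ (0, 0) * two_slot H l (emat 0 0) Y $$ (i, j) + X $$ (0, 1) * two_slot H l (emat 0 1) Y $$ (i, j) +
    X $$ (1, 0) * two_slot H l (emat 1 0) Y $$ (i, j) + X $$ (1, 1) * two_slot H l (emat 1 1) Y $$ (i, j)"
proof -
  have "X = X $$ (0, 0) \<cdot>\<^sub>m emat 0 0 + X $$ (0, 1) \<cdot>\<^sub>m emat 0 1 + X $$ (1, 0) \<cdot>\<^sub>m emat 1 0 + X $$ (1, 1) \<cdot>\<^sub>m emat 1 1"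
    using X by (intro mat2_eqI) (auto simp: index_emat)
  hence "two_slot H l X Y = two_slot H l (X $$ (0, 0) \<cdot>\<^sub>m emat 0 0 + X $$ (0, 1) \<cdot>\<^sub>m emat 0 1
      + X $$ (1, 0) \<cdot>\<^sub>m emat 1 0 + X $$ (1, 1) \<cdot>\<^sub>m emat 1 1) Y" by simp
  also have "\<dots> = X $$ (0, 0) \<cdot>\<^sub>m two_slot H l (emat 0 0) Y + X $$ (0, 1) \<cdot>\<^sub>m two_slot H l (emat 0 1) Y
      + X $$ (1, 0) \<cdot>\<^sub>m two_slot H l (emat 1 0) Y + X $$ (1, 1) \<cdot>\<^sub>m two_slot H l (emat 1 1) Y"
    using Y by (simp add: two_slot_add_left two_slot_smult_left)
  finally show ?thesis using ij Y by simp
qed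

section \<open>Block matrices over the basis of one field slot\<close>

text \<open>The operator with blocks \<open>A B\<close> over \<open>C D\<close> relative to the
  basis of slot \<open>l\<close>, the blocks acting on the system. Index 0 is the excited level and
  index 1 the vacuum.\<close>

definition quad :: "homodyne \<Rightarrow> nat \<Rightarrow> complex mat \<Rightarrow> complex mat \<Rightarrow> complex mat \<Rightarrow> complex mat \<Rightarrow> complex mat" where
  "quad H l A B C D = two_slot H l A (emat 0 0) + two_slot H l B (emat 0 1)
     + two_slot H l C (emat 1 0) + two_slot H l D (emat 1 1)"

lemma quad_carrier [simp]:
  "A \<in> M2 \<Longrightarrow> B \<in> M2 \<Longrightarrow> C \<in> M2 \<Longrightarrow> D \<in> M2 \<Longrightarrow>
    quad H l A B C D \<in> ops H"
  by (simp add: quad_def)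

lemma quad_smult:
  assumes "A \<in> M2" "B \<in> M2" "C \<in> M2" "D \<in> M2"
  shows "a \<cdot>\<^sub>m quad H l A B C D = quad H l (a \<cdot>\<^sub>m A) (a \<cdot>\<^sub>m B) (a \<cdot>\<^sub>m C) (a \<cdot>\<^sub>m D)"
  using assms by (simp add: quad_def smult_add_mat two_slot_smult_left)

lemma quad_one: "1 \<le> l \<Longrightarrow> l \<le> nsteps H \<Longrightarrow> quad H l (1\<^sub>m 2) (0\<^sub>m 2 2) (0\<^sub>m 2 2) (1\<^sub>m 2) = 1\<^sub>m (hdim H)"
  using two_slot_one[of H l]
  by (simp add: quad_def two_slot_zero_left two_slot_add_right emat_one[symmetric])

lemma quad_adjoint:
  assumes "A \<in> M2" "B \<in> M2" "C \<in> M2" "D \<in> M2"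
    and "1 \<le> l" "l \<le> nsteps H"
  shows "adj (quad H l A B C D)
       = quad H l (adj A) (adj C) (adj B) (adj D)"
  using assms by (intro eq_matI)
    (auto simp: quad_def adjoint_add two_slot_adjoint)

text \<open>Multiplying by \<open>1 \<otimes> |0><p|\<close> from the left and \<open>X \<otimes> |q><0|\<close> from the right
  isolates the block \<open>(p, q)\<close>.\<close>

lemma quad_block_trace:
  assumes c: "A \<in> M2" "B \<in> M2" "C \<in> M2" "D \<in> M2"
    "X \<in> M2" and l: "1 \<le> l" "l \<le> nsteps H" and pq: "p < 2" "q < 2"
  shows "mtrace (two_slot H l (1\<^sub>m 2) (emat 0 p) * quad H l A B C D * two_slot H l X (emat q 0))
       = 2 ^ (nsteps H - 1) * mtrace ((if p = 0 then if q = 0 then A else B else if q = 0 then C else D) * X)"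
proof -
  let ?F = "if p = 0 then if q = 0 then A else B else if q = 0 then C else D"
  have F: "?F \<in> M2" using c by simp
  have "two_slot H l (1\<^sub>m 2) (emat 0 p) * quad H l A B C D * two_slot H l X (emat q 0)
      = two_slot H l (?F * X) (emat 0 0)"
    using nat_less_2_cases[OF pq(1)] nat_less_2_cases[OF pq(2)] c l
    by (auto simp: quad_def mat_distrib_left mat_distrib_right two_slot_mult emat_mult
        two_slot_zero_right carrier_matD[of _ 2 2])
  also have "\<dots> = slot H 0 (?F * X) * tensor_list ((replicate (Suc (nsteps H)) (1\<^sub>m 2))[l := emat 0 0])"
    by (simp add: two_slot_def slot_def)
  also have "\<dots> = tensor_list ((replicate (Suc (nsteps H)) (1\<^sub>m 2))[l := emat 0 0, 0 := ?F * X])"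
    using F c l by (subst slot_mult_tensor) (auto simp: mats2_slot)
  finally have "mtrace (two_slot H l (1\<^sub>m 2) (emat 0 p) * quad H l A B C D * two_slot H l X (emat q 0))
      = (\<Prod>Y\<leftarrow>(replicate (Suc (nsteps H)) (1\<^sub>m 2))[l := emat 0 0, 0 := ?F * X]. mtrace Y)"
    using F c by (simp only:) (intro mtrace_tensor_list mats2_update, auto)
  moreover obtain l' where l': "l = Suc l'" using l by (cases l) auto
  moreover have "(replicate (nsteps H) (1\<^sub>m 2))[l' := emat 0 0]
      = replicate l' (1\<^sub>m 2) @ emat 0 0 # replicate (nsteps H - l) (1\<^sub>m 2)"
    using l l' by (simp add: upd_conv_take_nth_drop)
  moreover have "mtrace (emat 0 0) = 1" "mtrace (1\<^sub>m 2) = 2"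
    by (simp_all add: mtrace_mat2 index_emat)
  moreover have "nsteps H - 1 = l' + (nsteps H - l)" using l l' by simp
  ultimately show ?thesis
    by (simp add: replicate_Suc prod_list_replicate power_add)
qed

text \<open>Nondegeneracy of the trace pairing: testing against matrix units reads off the
  entries.\<close>

lemma mat2_trace_eqI:
  assumes "A \<in> M2" "B \<in> M2"
    and "\<And>X. X \<in> M2 \<Longrightarrow> mtrace (A * X) = mtrace (B * X)"
  shows "A = B"
proof -
  have "mtrace (Y * emat q p) = Y $$ (p, q)" if "Y \<in> M2" "p < 2" "q < 2" for Y p q
    using that nat_less_2_cases[of p] nat_less_2_cases[of q]
    by (auto simp: mtrace_mat2 index_mult_mat2 index_emat simp del: index_mult_mat(1))
  hence "A $$ (p, q) = B $$ (p, q)" if "p < 2" "q < 2" for p q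
    using assms that by (metis emat_carrier)
  thus ?thesis using assms by (intro eq_matI) auto
qed

text \<open>All blocks are recovered from traces, up to the common nonzero factor
  \<open>2 ^ (nsteps H - 1)\<close> contributed by the other field slots. This is the source of
  uniqueness of the coefficients of one step.\<close>

lemma quad_inject:
  assumes c: "A \<in> M2" "B \<in> M2" "C \<in> M2" "D \<in> M2"
    and c': "A' \<in> M2" "B' \<in> M2" "C' \<in> M2" "D' \<in> M2"
    and l: "1 \<le> l" "l \<le> nsteps H" and eq: "quad H l A B C D = quad H l A' B' C' D'"
  shows "A = A'" "B = B'" "C = C'" "D = D'"
proof -
  have *: "mtrace ((if p = 0 then if q = 0 then A else B else if q = 0 then C else D) * X)
      = mtrace ((if p = 0 then if q = 0 then A' else B' else if q = 0 then C' else D') * X)"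
    if "p < 2" "q < 2" "X \<in> M2" for p q :: nat and X
    using quad_block_trace[OF c that(3) l that(1,2)] quad_block_trace[OF c' that(3) l that(1,2)]
    unfolding eq by simp
  show "A = A'" using mat2_trace_eqI[OF c(1) c'(1)] *[of 0 0] by simp
  show "B = B'" using mat2_trace_eqI[OF c(2) c'(2)] *[of 0 1] by simp
  show "C = C'" using mat2_trace_eqI[OF c(3) c'(3)] *[of 1 0] by simp
  show "D = D'" using mat2_trace_eqI[OF c(4) c'(4)] *[of 1 1] by simp
qed

text \<open>Matrix units for the algebra of the system together with field slot \<open>l\<close>;
  quotient and remainder by 2 are the system and the field index.\<close>

definition slot_units :: "homodyne \<Rightarrow> nat \<Rightarrow> nat \<Rightarrow> nat \<Rightarrow> complex mat" where
  "slot_units H l r s = two_slot H l (emat (r div 2) (s div 2)) (emat (r mod 2) (s mod 2))"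

lemma sum_lessThan_4: "(\<Sum>r<4. f r) = f 0 + f 1 + f 2 + f (3 :: nat)"
  by (simp add: eval_nat_numeral add.assoc)

lemma matrix_units_slot_units:
  assumes l: "1 \<le> l" "l \<le> nsteps H"
  shows "matrix_units (hdim H) 4 (slot_units H l)"
  unfolding matrix_units_def
proof (intro conjI allI impI)
  fix r s t u :: nat assume "r < 4" "s < 4" "t < 4" "u < 4"
  have "s = t \<longleftrightarrow> s div 2 = t div 2 \<and> s mod 2 = t mod 2" by (metis div_mult_mod_eq)
  moreover have "s div 2 < 2" "s mod 2 < 2" using \<open>s < 4\<close> by auto
  ultimately show "slot_units H l r s * slot_units H l t u
      = (if s = t then slot_units H l r u else 0\<^sub>m (hdim H) (hdim H))"
    using l by (auto simp: slot_units_def two_slot_mult emat_mult two_slot_zero_left two_slot_zero_right)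
next
  have "1\<^sub>m (hdim H) = two_slot H l (emat 0 0 + emat 1 1) (emat 0 0 + emat 1 1)"
    by (simp only: emat_one two_slot_one)
  also have "\<dots> = msum (hdim H) (\<lambda>r. slot_units H l r r) {..<4}"
    using l by (intro eq_matI) (auto simp: sum_lessThan_4 slot_units_def two_slot_add_left two_slot_add_right)
  finally show "msum (hdim H) (\<lambda>r. slot_units H l r r) {..<4} = 1\<^sub>m (hdim H)" by simp
qed (simp add: slot_units_def)

text \<open>The pair \<open>(i, p)\<close> of a system and a field index is numbered \<open>2 i + p\<close>, as in \<open>kron\<close>.\<close>

definition block :: "nat \<Rightarrow> nat \<Rightarrow> complex mat \<Rightarrow> complex mat" where
  "block p q X = mat 2 2 (\<lambda>(i, j). X $$ (2 * i + p, 2 * j + q))"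

definition glue :: "complex mat \<Rightarrow> complex mat \<Rightarrow> complex mat \<Rightarrow> complex mat \<Rightarrow> complex mat" where
  "glue A B C D = mat 4 4 (\<lambda>(r, s). (if r mod 2 = 0 then if s mod 2 = 0 then A else B
     else if s mod 2 = 0 then C else D) $$ (r div 2, s div 2))"

lemma block_carrier [simp]: "block p q X \<in> M2"
  by (simp add: block_def)

lemma block_glue:
  assumes "A \<in> M2" "B \<in> M2" "C \<in> M2" "D \<in> M2"
  shows "block 0 0 (glue A B C D) = A" "block 0 1 (glue A B C D) = B"
    "block 1 0 (glue A B C D) = C" "block 1 1 (glue A B C D) = D"
  using assms by (auto intro!: mat2_eqI simp: block_def glue_def)

lemma unit_emb_slot_units:
  "unit_emb (hdim H) 4 (slot_units H l) X
     = quad H l (block 0 0 X) (block 0 1 X) (block 1 0 X) (block 1 1 X)"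
proof (rule square_mat_eqI[where n = "hdim H"])
  fix i j assume ij: "i < hdim H" "j < hdim H"
  have b: "block p q X $$ (a, b) = X $$ (2 * a + p, 2 * b + q)" if "a < 2" "b < 2" for p q a b
    using that by (simp add: block_def)
  show "unit_emb (hdim H) 4 (slot_units H l) X $$ (i, j)
      = quad H l (block 0 0 X) (block 0 1 X) (block 1 0 X) (block 1 1 X) $$ (i, j)"
    using ij by (simp add: unit_emb_def sum_lessThan_4 slot_units_def quad_def
        two_slot_index[of "block _ _ X" _ i H j] b)
qed (simp_all add: carrier_matD[OF quad_carrier])

text \<open>The new blocks are chosen before \<open>l\<close>: the exponential is computed once
  among 4 x 4 matrices and then embedded at any slot. This is why the coefficients of
  \<open>Mstep\<close> do not depend on the time.\<close>

lemma mexp_quad: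
  assumes "A \<in> M2" "B \<in> M2" "C \<in> M2" "D \<in> M2"
  obtains A' B' C' D' where "A' \<in> M2" "B' \<in> M2" "C' \<in> M2" "D' \<in> M2"
    "\<And>l. 1 \<le> l \<Longrightarrow> l \<le> nsteps H \<Longrightarrow> mexp (quad H l A B C D) = quad H l A' B' C' D'"
proof -
  define E where "E = mexp (glue A B C D)"
  have G: "glue A B C D \<in> carrier_mat 4 4" by (simp add: glue_def)
  have "mexp (quad H l A B C D) = quad H l (block 0 0 E) (block 0 1 E) (block 1 0 E) (block 1 1 E)"
    if "1 \<le> l" "l \<le> nsteps H" for l
    using unit_emb_mexp[OF matrix_units_slot_units[OF that] G]
    unfolding unit_emb_slot_units E_def block_glue[OF assms] .
  thus ?thesis using that[OF block_carrier block_carrier block_carrier block_carrier] by blast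
qed

section \<open>The one-step interaction\<close>

lemma quad_mult:
  assumes c: "A \<in> M2" "B \<in> M2" "C \<in> M2" "D \<in> M2"
    and c': "A' \<in> M2" "B' \<in> M2" "C' \<in> M2" "D' \<in> M2"
    and l: "1 \<le> l" "l \<le> nsteps H"
  shows "quad H l A B C D * quad H l A' B' C' D'
       = quad H l (A * A' + B * C') (A * B' + B * D') (C * A' + D * C') (C * B' + D * D')"
proof -
  have "quad H l A B C D * quad H l A' B' C' D'
      = two_slot H l (A * A') (emat 0 0) + two_slot H l (C * A') (emat 1 0)
      + (two_slot H l (A * B') (emat 0 1) + two_slot H l (C * B') (emat 1 1))
      + (two_slot H l (B * C') (emat 0 0) + two_slot H l (D * C') (emat 1 0))
      + (two_slot H l (B * D') (emat 0 1) + two_slot H l (D * D') (emat 1 1))"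
    using c c' l unfolding quad_def
    by (simp add: mat_distrib_left mat_distrib_right two_slot_mult emat_mult two_slot_zero_right
        del: assoc_add_mat)
  also have "\<dots> = quad H l (A * A' + B * C') (A * B' + B * D') (C * A' + D * C') (C * B' + D * D')"
    using c c' unfolding quad_def by (intro eq_matI) (simp_all add: two_slot_add_left)
  finally show ?thesis .
qed

lemma dLambda_eq: "slot H 0 X * dLambda H l = two_slot H l X (emat 0 0)"
  by (simp add: dLambda_def sigma_plus_eq sigma_minus_eq emat_mult two_slot_def)

lemma dAstar_eq:
  "X \<in> M2 \<Longrightarrow> l \<le> nsteps H \<Longrightarrow>
    slot H 0 X * dAstar H l = two_slot H l (of_real (lam H) \<cdot>\<^sub>m X) (emat 0 1)"
  by (simp add: dAstar_def sigma_plus_eq two_slot_def slot_smult smult_mat_mult)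

lemma dA_eq:
  "X \<in> M2 \<Longrightarrow> l \<le> nsteps H \<Longrightarrow>
    slot H 0 X * dA H l = two_slot H l (of_real (lam H) \<cdot>\<^sub>m X) (emat 1 0)"
  by (simp add: dA_def sigma_minus_eq two_slot_def slot_smult smult_mat_mult)

lemma dt_eq: "dt H l = lamsq H \<cdot>\<^sub>m 1\<^sub>m (hdim H)"
  by (simp only: dt_def hdim_def)

lemma slot0_two_slot:
  assumes "X \<in> M2" "l \<le> nsteps H"
  shows "slot H 0 X = two_slot H l X (emat 0 0) + two_slot H l X (emat 1 1)"
proof -
  have "slot H 0 X = two_slot H l X (emat 0 0 + emat 1 1)"
    using assms by (simp only: emat_one two_slot_def slot_one right_mult_one_mat' dim_slot)
  thus ?thesis using assms by (simp add: two_slot_add_right)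
qed

lemma dt_mult_eq:
  assumes "X \<in> M2" "l \<le> nsteps H"
  shows "slot H 0 X * dt H l = two_slot H l (lamsq H \<cdot>\<^sub>m X) (emat 0 0)
    + two_slot H l (lamsq H \<cdot>\<^sub>m X) (emat 1 1)"
proof -
  have "slot H 0 X * dt H l = slot H 0 (lamsq H \<cdot>\<^sub>m X)"
    using assms by (simp add: dt_eq smult_mat_mult slot_smult)
  thus ?thesis using assms slot0_two_slot[of "lamsq H \<cdot>\<^sub>m X" l H] by simp
qed

text \<open>The time increment is scalar on the field slot and therefore enters both diagonal
  blocks, whereas \<open>dLambda\<close> occupies the excited block alone.\<close>

lemma noise_sum_quad:
  assumes "X \<in> M2" "Y \<in> M2" "Z \<in> M2" "W \<in> M2"
    and "l \<le> nsteps H"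
  shows "slot H 0 X * dLambda H l + slot H 0 Y * dAstar H l + slot H 0 Z * dA H l + slot H 0 W * dt H l
    = quad H l (X + lamsq H \<cdot>\<^sub>m W) (of_real (lam H) \<cdot>\<^sub>m Y)
        (of_real (lam H) \<cdot>\<^sub>m Z) (lamsq H \<cdot>\<^sub>m W)"
  using assms unfolding dLambda_eq dAstar_eq[OF assms(2,5)] dA_eq[OF assms(3,5)] dt_mult_eq[OF assms(4,5)] quad_def
  by (intro eq_matI) (simp_all add: two_slot_add_left)

lemma one_noise_sum_quad:
  assumes "X \<in> M2" "Y \<in> M2" "Z \<in> M2" "W \<in> M2"
    and "1 \<le> l" "l \<le> nsteps H"
  shows "1\<^sub>m (hdim H) + slot H 0 X * dLambda H l + slot H 0 Y * dAstar H l + slot H 0 Z * dA H l + slot H 0 W * dt H l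
    = quad H l (1\<^sub>m 2 + X + lamsq H \<cdot>\<^sub>m W) (of_real (lam H) \<cdot>\<^sub>m Y)
        (of_real (lam H) \<cdot>\<^sub>m Z) (1\<^sub>m 2 + lamsq H \<cdot>\<^sub>m W)"
proof -
  have one: "1\<^sub>m (hdim H) = two_slot H l (1\<^sub>m 2) (emat 0 0) + two_slot H l (1\<^sub>m 2) (emat 1 1)"
    using slot0_two_slot[of "1\<^sub>m 2" l H] assms by (simp add: slot_one)
  show ?thesis
    using assms unfolding dLambda_eq dAstar_eq[OF assms(2,6)] dA_eq[OF assms(3,6)] dt_mult_eq[OF assms(4,6)]
      quad_def one
    by (intro eq_matI) (simp_all add: two_slot_add_left)
qed

section \<open>Unitarity and coefficients of one step\<close>

lemma model_ctrlD:
  assumes "homodyne_model H" "u \<in> ctrls H"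
  shows "L1 H u \<in> M2" "L2 H u \<in> M2" "L3 H u \<in> M2"
    "adj (L1 H u) = L1 H u" "adj (L3 H u) = L3 H u" "Qcost H u \<in> M2"
  using assms by (auto simp: homodyne_model_def nonneg_mat_def)

lemma Mstep_mexp_quad:
  assumes "homodyne_model H" "u \<in> ctrls H" "l \<le> nsteps H"
  shows "Mstep H l u = mexp ((- \<i>) \<cdot>\<^sub>m quad H l (L1 H u + lamsq H \<cdot>\<^sub>m L3 H u)
    (of_real (lam H) \<cdot>\<^sub>m L2 H u) (of_real (lam H) \<cdot>\<^sub>m adj (L2 H u))
    (lamsq H \<cdot>\<^sub>m L3 H u))"
  unfolding Mstep_def using model_ctrlD[OF assms(1,2)] assms(3) by (simp add: noise_sum_quad)

text \<open>The generator is self-adjoint: its diagonal blocks are, and its off-diagonal blocks are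
  adjoint to each other. Multiplied by \<open>- \<i>\<close> it becomes skew-adjoint.\<close>

lemma Mstep_unitary:
  assumes "homodyne_model H" "u \<in> ctrls H" "1 \<le> l" "l \<le> nsteps H"
  shows "adj (Mstep H l u) * Mstep H l u = 1\<^sub>m (hdim H)" "Mstep H l u \<in> ops H"
proof -
  define G where "G = quad H l (L1 H u + lamsq H \<cdot>\<^sub>m L3 H u)
    (of_real (lam H) \<cdot>\<^sub>m L2 H u) (of_real (lam H) \<cdot>\<^sub>m adj (L2 H u))
    (lamsq H \<cdot>\<^sub>m L3 H u)"
  note L = model_ctrlD[OF assms(1,2)]
  have G: "G \<in> ops H" using L by (simp add: G_def)
  have "adj G = G"
    unfolding G_def using L assms by (subst quad_adjoint) (simp_all add: adjoint_add adjoint_smult)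
  hence "adj ((- \<i>) \<cdot>\<^sub>m G) = (- 1) \<cdot>\<^sub>m ((- \<i>) \<cdot>\<^sub>m G)"
    by (simp add: adjoint_smult smult_smult_mat)
  moreover have "Mstep H l u = mexp ((- \<i>) \<cdot>\<^sub>m G)"
    using Mstep_mexp_quad[OF assms(1,2,4)] by (simp add: G_def)
  moreover have iG: "(- \<i>) \<cdot>\<^sub>m G \<in> ops H" using G by simp
  ultimately show "adj (Mstep H l u) * Mstep H l u = 1\<^sub>m (hdim H)"
    "Mstep H l u \<in> ops H"
    using mexp_skew_adjoint_unitary(1)[OF iG] mexp_carrier[OF iG] by auto
qed

text \<open>Slot 1, which exists since \<open>0 < nsteps H\<close>, already fixes the coefficients.
  The off-diagonal blocks give \<open>Y\<close> and \<open>Z\<close> because \<open>lam H\<close> is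
  nonzero; the vacuum block gives \<open>W\<close>, and with it the excited block gives
  \<open>X\<close>.\<close>

lemma Mcoeffs_eqI:
  assumes "homodyne_model H"
    and c: "X \<in> M2" "Y \<in> M2" "Z \<in> M2" "W \<in> M2"
    and M: "\<And>l. 1 \<le> l \<Longrightarrow> l \<le> nsteps H \<Longrightarrow> Mstep H l u =
      quad H l (1\<^sub>m 2 + X + lamsq H \<cdot>\<^sub>m W) (of_real (lam H) \<cdot>\<^sub>m Y)
        (of_real (lam H) \<cdot>\<^sub>m Z) (1\<^sub>m 2 + lamsq H \<cdot>\<^sub>m W)"
  shows "Mcoeffs H u = (X, Y, Z, W)"
proof -
  have k: "1 \<le> nsteps H" and l0: "lam H \<noteq> 0"
    using assms(1) lam_pos[OF assms(1)] by (auto simp: homodyne_model_def)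
  have cancel: "R = S" if "a \<cdot>\<^sub>m R = a \<cdot>\<^sub>m S" "a \<noteq> 0" for a and R S :: "complex mat"
  proof -
    have "inverse a \<cdot>\<^sub>m (a \<cdot>\<^sub>m R) = inverse a \<cdot>\<^sub>m (a \<cdot>\<^sub>m S)" using that by simp
    thus ?thesis using that(2) by (simp add: smult_smult_mat)
  qed
  have cancel_add: "R = S" if "T + R = T + S" "T \<in> M2" "R \<in> M2" "S \<in> M2"
    for T R S :: "complex mat"
  proof (rule eq_matI)
    fix i j assume "i < dim_row S" "j < dim_col S"
    thus "R $$ (i, j) = S $$ (i, j)"
      using arg_cong[OF that(1), of "\<lambda>Q. Q $$ (i, j)"] that(2-4) by simp
  qed (use that in auto)
  have cancel_add': "R = S" if "R + T = S + T" "T \<in> M2" "R \<in> M2" "S \<in> M2"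
    for T R S :: "complex mat"
    using that cancel_add[of T R S] by (simp add: comm_add_mat[of _ 2 2])
  show ?thesis unfolding Mcoeffs_def hdim_def[symmetric]
  proof (rule the_equality)
    show "case (X, Y, Z, W) of (Mpm, Mp, Mm, Mo) \<Rightarrow>
      Mpm \<in> M2 \<and> Mp \<in> M2 \<and> Mm \<in> M2 \<and> Mo \<in> M2 \<and>
      (\<forall>l\<in>{1..nsteps H}. Mstep H l u =
        1\<^sub>m (hdim H) + slot H 0 Mpm * dLambda H l + slot H 0 Mp * dAstar H l
        + slot H 0 Mm * dA H l + slot H 0 Mo * dt H l)"
      using c by (auto simp: one_noise_sum_quad M simp del: assoc_add_mat)
  next
    fix q assume q: "case q of (Mpm, Mp, Mm, Mo) \<Rightarrow>
      Mpm \<in> M2 \<and> Mp \<in> M2 \<and> Mm \<in> M2 \<and> Mo \<in> M2 \<and>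
      (\<forall>l\<in>{1..nsteps H}. Mstep H l u =
        1\<^sub>m (hdim H) + slot H 0 Mpm * dLambda H l + slot H 0 Mp * dAstar H l
        + slot H 0 Mm * dA H l + slot H 0 Mo * dt H l)"
    obtain X' Y' Z' W' where q': "q = (X', Y', Z', W')" by (cases q)
    have c': "X' \<in> M2" "Y' \<in> M2" "Z' \<in> M2" "W' \<in> M2"
      using q by (auto simp: q')
    have "Mstep H 1 u = 1\<^sub>m (hdim H) + slot H 0 X' * dLambda H 1 + slot H 0 Y' * dAstar H 1
        + slot H 0 Z' * dA H 1 + slot H 0 W' * dt H 1"
      using q k by (simp add: q')
    note q1 = trans[OF one_noise_sum_quad[OF c' order_refl k, symmetric] this[symmetric]]
    have "quad H 1 (1\<^sub>m 2 + X' + lamsq H \<cdot>\<^sub>m W') (of_real (lam H) \<cdot>\<^sub>m Y')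
        (of_real (lam H) \<cdot>\<^sub>m Z') (1\<^sub>m 2 + lamsq H \<cdot>\<^sub>m W') =
      quad H 1 (1\<^sub>m 2 + X + lamsq H \<cdot>\<^sub>m W) (of_real (lam H) \<cdot>\<^sub>m Y)
        (of_real (lam H) \<cdot>\<^sub>m Z) (1\<^sub>m 2 + lamsq H \<cdot>\<^sub>m W)"
      by (rule trans[OF q1 M[OF order_refl k]])
    from quad_inject[OF _ _ _ _ _ _ _ _ order_refl k this] c c'
    have e: "1\<^sub>m 2 + X' + lamsq H \<cdot>\<^sub>m W' = 1\<^sub>m 2 + X + lamsq H \<cdot>\<^sub>m W"
      "of_real (lam H) \<cdot>\<^sub>m Y' = of_real (lam H) \<cdot>\<^sub>m Y"
      "of_real (lam H) \<cdot>\<^sub>m Z' = of_real (lam H) \<cdot>\<^sub>m Z"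
      "1\<^sub>m 2 + lamsq H \<cdot>\<^sub>m W' = 1\<^sub>m 2 + lamsq H \<cdot>\<^sub>m W"
      by (simp_all del: assoc_add_mat)
    have "Y' = Y" "Z' = Z" using cancel[OF e(2)] cancel[OF e(3)] l0 by auto
    moreover have W: "W' = W"
      using cancel[OF cancel_add[OF e(4)]] c c' l0 by simp
    moreover have "X' = X"
      using cancel_add[OF cancel_add'[OF e(1)[unfolded W]]] c c' by simp
    ultimately show "q = (X, Y, Z, W)" by (simp add: q')
  qed
qed

text \<open>On the vacuum \<open>\<Phi>\<close> of slot \<open>l\<close>, \<open>Mstep\<close> acts as \<open>\<Phi> \<mapsto> stay \<otimes> \<Phi> + emit \<otimes> \<sigma>\<^sub>+ \<Phi>\<close>.\<close>

definition emit :: "homodyne \<Rightarrow> real \<Rightarrow> complex mat" where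
  "emit H u = of_real (lam H) \<cdot>\<^sub>m Mplus H u"

definition stay :: "homodyne \<Rightarrow> real \<Rightarrow> complex mat" where
  "stay H u = 1\<^sub>m 2 + lamsq H \<cdot>\<^sub>m Mcirc H u"

lemma Mstep_quad:
  assumes "homodyne_model H" "u \<in> ctrls H"
  obtains A C where "A \<in> M2" "C \<in> M2" "Mplus H u \<in> M2"
    "Mcirc H u \<in> M2"
    "\<And>l. 1 \<le> l \<Longrightarrow> l \<le> nsteps H \<Longrightarrow> Mstep H l u = quad H l A (emit H u) C (stay H u)"
proof -
  have l0: "lam H \<noteq> 0" using lam_pos[OF assms(1)] by simp
  note L = model_ctrlD[OF assms]
  let ?G = "(- \<i>) \<cdot>\<^sub>m (L1 H u + lamsq H \<cdot>\<^sub>m L3 H u)"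
  obtain A B C D where c: "A \<in> M2" "B \<in> M2" "C \<in> M2" "D \<in> M2"
    and M: "\<And>l. 1 \<le> l \<Longrightarrow> l \<le> nsteps H \<Longrightarrow>
      mexp (quad H l ?G ((- \<i>) \<cdot>\<^sub>m (of_real (lam H) \<cdot>\<^sub>m L2 H u))
        ((- \<i>) \<cdot>\<^sub>m (of_real (lam H) \<cdot>\<^sub>m adj (L2 H u)))
        ((- \<i>) \<cdot>\<^sub>m (lamsq H \<cdot>\<^sub>m L3 H u))) = quad H l A B C D"
    using L by (rule_tac mexp_quad[of ?G "(- \<i>) \<cdot>\<^sub>m (of_real (lam H) \<cdot>\<^sub>m L2 H u)"
        "(- \<i>) \<cdot>\<^sub>m (of_real (lam H) \<cdot>\<^sub>m adj (L2 H u))"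
        "(- \<i>) \<cdot>\<^sub>m (lamsq H \<cdot>\<^sub>m L3 H u)" H]) auto
  have MS: "Mstep H l u = quad H l A B C D" if "1 \<le> l" "l \<le> nsteps H" for l
    unfolding M[OF that, symmetric] Mstep_mexp_quad[OF assms that(2)]
    using L by (subst quad_smult) auto
  \<comment> \<open>The block equations are solved for the coefficients:
    \<open>D = 1 + lam^2 W\<close> gives \<open>W\<close>, and then
    \<open>A = 1 + X + lam^2 W = X + D\<close> forces \<open>X = A - D\<close>.\<close>
  define W where "W = of_real (inverse ((lam H)\<^sup>2)) \<cdot>\<^sub>m (D - 1\<^sub>m 2)"
  define Y where "Y = of_real (inverse (lam H)) \<cdot>\<^sub>m B"
  define Z where "Z = of_real (inverse (lam H)) \<cdot>\<^sub>m C"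
  define X where "X = A - D"
  have wc: "X \<in> M2" "Y \<in> M2" "Z \<in> M2" "W \<in> M2"
    using c by (simp_all add: X_def Y_def Z_def W_def minus_carrier_mat)
  have e: "of_real (lam H) \<cdot>\<^sub>m Y = B" "of_real (lam H) \<cdot>\<^sub>m Z = C"
    using l0 by (simp_all add: Y_def Z_def smult_smult_mat of_real_mult[symmetric] del: of_real_mult of_real_inverse)
  have "lamsq H \<cdot>\<^sub>m W = D - 1\<^sub>m 2"
    using l0 by (simp add: W_def smult_smult_mat of_real_mult[symmetric] del: of_real_mult of_real_inverse of_real_power)
  hence e2: "1\<^sub>m 2 + lamsq H \<cdot>\<^sub>m W = D" "1\<^sub>m 2 + X + lamsq H \<cdot>\<^sub>m W = A"
    using c by (auto simp: X_def intro!: eq_matI)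
  have "Mcoeffs H u = (X, Y, Z, W)"
    using assms(1) wc by (rule Mcoeffs_eqI) (simp add: MS e e2 del: assoc_add_mat of_real_power)
  hence "Mplus H u = Y" "Mcirc H u = W" by (simp_all add: Mplus_def Mcirc_def)
  thus ?thesis using that[of A C] wc c MS by (simp add: emit_def stay_def e e2 del: of_real_power)
qed

lemma Mplus_Mcirc_carrier:
  assumes "homodyne_model H" "u \<in> ctrls H"
  shows "Mplus H u \<in> M2" "Mcirc H u \<in> M2"
    "emit H u \<in> M2" "stay H u \<in> M2"
  using Mstep_quad[OF assms] by (metis, metis) (metis Mstep_quad[OF assms] emit_def smult_carrier_mat,
    metis Mstep_quad[OF assms] stay_def smult_carrier_mat add_carrier_mat)

text \<open>This is the vacuum diagonal block of the identity \<open>adj M * M = 1\<close> for one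
  step: \<open>emit\<close> and \<open>stay\<close> form the column applied to the vacuum. It makes
  the filter preserve the trace.\<close>

lemma emit_stay_isometry:
  assumes "homodyne_model H" "u \<in> ctrls H"
  shows "adj (emit H u) * emit H u + adj (stay H u) * stay H u = 1\<^sub>m 2"
proof -
  have k: "1 \<le> nsteps H" using assms(1) by (simp add: homodyne_model_def)
  note c = Mplus_Mcirc_carrier(3,4)[OF assms]
  obtain A C where AC: "A \<in> M2" "C \<in> M2"
    and M: "Mstep H 1 u = quad H 1 A (emit H u) C (stay H u)"
    using Mstep_quad[OF assms] k by (metis order_refl)
  have "quad H 1 (adj A) (adj C) (adj (emit H u)) (adj (stay H u))
      * quad H 1 A (emit H u) C (stay H u) = quad H 1 (1\<^sub>m 2) (0\<^sub>m 2 2) (0\<^sub>m 2 2) (1\<^sub>m 2)"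
    using Mstep_unitary(1)[OF assms order_refl k, unfolded M] AC c k
    by (simp add: quad_adjoint quad_one)
  note eq = this[unfolded quad_mult[OF adjoint_carrier[OF AC(1)] adjoint_carrier[OF AC(2)]
      adjoint_carrier[OF c(1)] adjoint_carrier[OF c(2)] AC(1) c(1) AC(2) c(2) order_refl k]]
  show ?thesis by (rule quad_inject(4)[OF _ _ _ _ _ _ _ _ order_refl k eq]) (use AC c in auto)
qed

section \<open>The filter step\<close>

text \<open>The unnormalised posterior state after outcome \<open>y\<close>. It contains no
  denominator; its trace is \<open>ptrans\<close>, and for a density matrix and a genuine outcome it
  equals \<open>ptrans\<close> times \<open>Gam\<close>.\<close>

definition filter_step :: "homodyne \<Rightarrow> complex mat \<Rightarrow> real \<Rightarrow> real \<Rightarrow> complex mat" where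
  "filter_step H \<rho> u y = (1 / 2 :: complex) \<cdot>\<^sub>m (\<rho> + lamsq H \<cdot>\<^sub>m Lbar H \<rho> u
     + of_real y \<cdot>\<^sub>m Jbar H \<rho> u)"

text \<open>The right-hand side is the unconditional evolution over one step, with the field traced
  out, in Kraus form. The powers of \<open>lam H\<close> in \<open>Lbar\<close> come from expanding
  \<open>emit\<close> and \<open>stay\<close>.\<close>

lemma filter_drift_eq:
  assumes "homodyne_model H" "u \<in> ctrls H" and r: "\<rho> \<in> M2"
  shows "\<rho> + lamsq H \<cdot>\<^sub>m Lbar H \<rho> u
    = emit H u * \<rho> * adj (emit H u) + stay H u * \<rho> * adj (stay H u)"
proof -
  note c = Mplus_Mcirc_carrier(1,2)[OF assms(1,2)]
  define P where "P = Mplus H u" define Q where "Q = Mcirc H u"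
  have d: "dim_row P = 2" "dim_col P = 2" "dim_row Q = 2" "dim_col Q = 2" "dim_row \<rho> = 2" "dim_col \<rho> = 2"
    using c r by (auto simp: P_def Q_def)
  have e: "emit H u * \<rho> * adj (emit H u) = (lamsq H) \<cdot>\<^sub>m (P * (\<rho> * adj P))"
    unfolding emit_def P_def[symmetric]
    by (simp add: d adjoint_smult smult_mat_mult smult_smult_mat mat_mult_assoc power2_eq_square)
  have s: "stay H u * \<rho> * adj (stay H u) = \<rho> + lamsq H \<cdot>\<^sub>m (Q * \<rho>)
     + lamsq H \<cdot>\<^sub>m (\<rho> * adj Q + lamsq H \<cdot>\<^sub>m (Q * (\<rho> * adj Q)))"
    unfolding stay_def Q_def[symmetric]
    by (simp add: d adjoint_smult adjoint_add smult_mat_mult mat_mult_assoc mat_distrib_left mat_distrib_right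
        del: of_real_power)
  show ?thesis
    unfolding e s Lbar_def P_def[symmetric] Q_def[symmetric]
    by (intro eq_matI) (simp_all add: d mat_mult_assoc algebra_simps del: of_real_power index_mult_mat(1))
qed

text \<open>These are the interference terms between emitting and staying; the factor
  \<open>lam H\<close> is the one contained in \<open>emit\<close>.\<close>

lemma filter_Jbar_eq:
  assumes "homodyne_model H" "u \<in> ctrls H" and r: "\<rho> \<in> M2"
  shows "of_real (lam H) \<cdot>\<^sub>m Jbar H \<rho> u
    = emit H u * \<rho> * adj (stay H u) + stay H u * \<rho> * adj (emit H u)"
proof -
  note c = Mplus_Mcirc_carrier(1,2)[OF assms(1,2)]
  define P where "P = Mplus H u" define Q where "Q = Mcirc H u"
  have d: "dim_row P = 2" "dim_col P = 2" "dim_row Q = 2" "dim_col Q = 2" "dim_row \<rho> = 2" "dim_col \<rho> = 2"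
    using c r by (auto simp: P_def Q_def)
  have e: "emit H u * \<rho> * adj (stay H u) = of_real (lam H) \<cdot>\<^sub>m (P * \<rho>)
     + lamsq H \<cdot>\<^sub>m (of_real (lam H) \<cdot>\<^sub>m (P * (\<rho> * adj Q)))"
    unfolding emit_def stay_def P_def[symmetric] Q_def[symmetric]
    by (simp add: d adjoint_smult adjoint_add smult_mat_mult mat_mult_assoc mat_distrib_left mat_distrib_right
        del: of_real_power)
  have s: "stay H u * \<rho> * adj (emit H u) = of_real (lam H) \<cdot>\<^sub>m (\<rho> * adj P
     + lamsq H \<cdot>\<^sub>m (Q * (\<rho> * adj P)))"
    unfolding emit_def stay_def P_def[symmetric] Q_def[symmetric]
    by (simp add: d adjoint_smult adjoint_add smult_mat_mult mat_mult_assoc mat_distrib_left mat_distrib_right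
        smult_add_mat smult_smult_mat mult_ac del: of_real_power)
  show ?thesis
    unfolding e s Jbar_def P_def[symmetric] Q_def[symmetric]
    by (intro eq_matI) (simp_all add: d mat_mult_assoc algebra_simps del: of_real_power index_mult_mat(1))
qed

lemma Lbar_Jbar_carrier:
  assumes "homodyne_model H" "u \<in> ctrls H" and r: "\<rho> \<in> M2"
  shows "Lbar H \<rho> u \<in> M2" "Jbar H \<rho> u \<in> M2"
  using Mplus_Mcirc_carrier(1,2)[OF assms(1,2)] r by (simp_all add: Lbar_def Jbar_def)

lemma filter_step_eq:
  assumes "homodyne_model H" "u \<in> ctrls H" and "\<rho> \<in> M2" and y: "y = lam H \<or> y = - lam H"
  shows "filter_step H \<rho> u y = (1 / 2 :: complex) \<cdot>\<^sub>m
    (emit H u * \<rho> * adj (emit H u) + stay H u * \<rho> * adj (stay H u)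
     + of_real (sgn y) \<cdot>\<^sub>m (emit H u * \<rho> * adj (stay H u) + stay H u * \<rho> * adj (emit H u)))"
proof -
  \<comment> \<open>For an outcome only the sign remains once \<open>lam H\<close> has been absorbed
    into the interference terms.\<close>
  have "y = sgn y * lam H" using y lam_pos[OF assms(1)] by auto
  hence "of_real y \<cdot>\<^sub>m Jbar H \<rho> u = of_real (sgn y) \<cdot>\<^sub>m (of_real (lam H) \<cdot>\<^sub>m Jbar H \<rho> u)"
    by (metis of_real_mult smult_smult_mat)
  thus ?thesis by (simp only: filter_step_def filter_drift_eq[OF assms(1-3)] filter_Jbar_eq[OF assms(1-3)])
qed

text \<open>Projecting the field on \<open>(1, sgn y) / sqrt 2\<close> superposes emitting and
  staying into one Kraus operator; the normalisation yields the factor 1/2. Positivity of the step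
  becomes visible in this form.\<close>

lemma filter_step_kraus:
  assumes "homodyne_model H" "u \<in> ctrls H" and r: "\<rho> \<in> M2" and y: "y = lam H \<or> y = - lam H"
  defines "N \<equiv> emit H u + complex_of_real (sgn y) \<cdot>\<^sub>m stay H u"
  shows "filter_step H \<rho> u y = (1 / 2 :: complex) \<cdot>\<^sub>m (N * \<rho> * adj N)"
proof -
  note c = Mplus_Mcirc_carrier(3,4)[OF assms(1,2)]
  define B where "B = emit H u" define D where "D = stay H u"
  have d: "dim_row B = 2" "dim_col B = 2" "dim_row D = 2" "dim_col D = 2" "dim_row \<rho> = 2" "dim_col \<rho> = 2"
    using c r by (auto simp: B_def D_def)
  have s2: "complex_of_real (sgn y) * complex_of_real (sgn y) = 1"
    using y lam_pos[OF assms(1)] by auto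
  have "N * \<rho> * adj N = B * (\<rho> * adj B) + of_real (sgn y) \<cdot>\<^sub>m (D * (\<rho> * adj B))
     + (of_real (sgn y) \<cdot>\<^sub>m (B * (\<rho> * adj D)) + D * (\<rho> * adj D))"
    unfolding N_def B_def[symmetric] D_def[symmetric]
    by (simp add: d adjoint_smult adjoint_add smult_mat_mult mat_mult_assoc mat_distrib_left mat_distrib_right
        smult_add_mat smult_smult_mat s2)
  thus ?thesis
    unfolding filter_step_eq[OF assms(1-4)] B_def[symmetric] D_def[symmetric]
    by (auto intro!: eq_matI simp: d mat_mult_assoc algebra_simps simp del: index_mult_mat(1))
qed

lemma filter_step_carrier:
  assumes "homodyne_model H" "u \<in> ctrls H" "\<rho> \<in> M2"
  shows "filter_step H \<rho> u y \<in> M2"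
  using Lbar_Jbar_carrier[OF assms] assms(3) by (simp add: filter_step_def)

section \<open>Positivity and trace of the filter step\<close>

lemma nonneg_mat_conj:
  assumes "nonneg_mat n X" and N: "N \<in> carrier_mat n n"
  shows "nonneg_mat n (N * X * adj N)"
proof -
  have X: "X \<in> carrier_mat n n" "adj X = X" using assms by (auto simp: nonneg_mat_def)
  note d = carrier_matD[OF X(1)] carrier_matD[OF N]
  have "0 \<le> Re ((N * X * adj N *\<^sub>v v) \<bullet>c v)" if v: "v \<in> carrier_vec n" for v
  proof -
    have w: "adj N *\<^sub>v v \<in> carrier_vec n" using N v by (simp add: mult_mat_vec_carrier[of _ n n])
    have "(N * X * adj N *\<^sub>v v) \<bullet>c v = (N *\<^sub>v (X *\<^sub>v (adj N *\<^sub>v v))) \<bullet>c v"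
      using d v by (simp add: mat_vec_assoc)
    also have "\<dots> = (X *\<^sub>v (adj N *\<^sub>v v)) \<bullet>c (adj N *\<^sub>v v)"
      using v mult_mat_vec_carrier[OF X(1) w] by (intro cscalar_prod_adjoint) (simp_all add: d)
    finally show ?thesis using assms(1) w by (simp add: nonneg_mat_def)
  qed
  moreover have "adj (N * X * adj N) = N * X * adj N"
    by (simp add: adjoint_mult d X(2) mat_mult_assoc)
  ultimately show ?thesis using X N by (simp add: nonneg_mat_def)
qed

lemma nonneg_mat_smult:
  assumes "nonneg_mat n X" "0 \<le> a"
  shows "nonneg_mat n (of_real a \<cdot>\<^sub>m X)"
proof -
  have X: "X \<in> carrier_mat n n" "adj X = X" using assms by (auto simp: nonneg_mat_def)
  have "0 \<le> Re ((of_real a \<cdot>\<^sub>m X *\<^sub>v v) \<bullet>c v)" if v: "v \<in> carrier_vec n" for v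
  proof -
    have "(of_real a \<cdot>\<^sub>m X *\<^sub>v v) \<bullet>c v = of_real a * ((X *\<^sub>v v) \<bullet>c v)"
      using X v by (simp add: smult_mat_mult_vec[OF X(1) v] mult_mat_vec_carrier[OF X(1) v])
    thus ?thesis using assms v by (simp add: nonneg_mat_def)
  qed
  thus ?thesis using X by (simp add: nonneg_mat_def adjoint_smult)
qed

lemma nonneg_mat2_form:
  assumes "nonneg_mat 2 X"
  shows "0 \<le> Re ((X $$ (0, 0) * x + X $$ (0, 1) * y) * cnj x + (X $$ (1, 0) * x + X $$ (1, 1) * y) * cnj y)"
proof -
  let ?v = "vec 2 (\<lambda>i. if i = 0 then x else y)"
  have X: "X \<in> M2" using assms by (auto simp: nonneg_mat_def)
  have "(X *\<^sub>v ?v) \<bullet>c ?v = (X $$ (0, 0) * x + X $$ (0, 1) * y) * cnj x + (X $$ (1, 0) * x + X $$ (1, 1) * y) * cnj y"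
    using X by (simp add: scalar_prod_def numeral_2_eq_2)
  moreover have "0 \<le> Re ((X *\<^sub>v ?v) \<bullet>c ?v)" using assms unfolding nonneg_mat_def by (meson vec_carrier)
  ultimately show ?thesis by simp
qed

lemma nonneg_mat2_diag:
  assumes "nonneg_mat 2 X"
  shows "0 \<le> Re (X $$ (0, 0))" "0 \<le> Re (X $$ (1, 1))" "Im (X $$ (0, 0)) = 0" "Im (X $$ (1, 1)) = 0"
    "X $$ (1, 0) = cnj (X $$ (0, 1))"
proof -
  have X: "X \<in> M2" "adj X = X" using assms by (auto simp: nonneg_mat_def)
  show "0 \<le> Re (X $$ (0, 0))" "0 \<le> Re (X $$ (1, 1))"
    using nonneg_mat2_form[OF assms, of 1 0] nonneg_mat2_form[OF assms, of 0 1] by simp_all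
  have adj: "X $$ (i, j) = cnj (X $$ (j, i))" if "i < 2" "j < 2" for i j
    using index_adjoint[of i X j] X that by simp
  show "Im (X $$ (0, 0)) = 0" "Im (X $$ (1, 1)) = 0"
    using arg_cong[OF adj[of 0 0], of Im] arg_cong[OF adj[of 1 1], of Im] by simp_all
  show "X $$ (1, 0) = cnj (X $$ (0, 1))" by (rule adj) auto
qed

lemma nonneg_mat2_trace:
  assumes "nonneg_mat 2 X"
  shows "mtrace X = of_real (Re (mtrace X))" "0 \<le> Re (mtrace X)"
proof -
  have "X \<in> M2" using assms by (auto simp: nonneg_mat_def)
  thus "mtrace X = of_real (Re (mtrace X))" "0 \<le> Re (mtrace X)"
    using nonneg_mat2_diag[OF assms] by (simp_all add: mtrace_mat2 complex_eq_iff)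
qed

lemma nonneg_mat2_trace_zero:
  assumes "nonneg_mat 2 X" "mtrace X = 0"
  shows "X = 0\<^sub>m 2 2"
proof -
  have X: "X \<in> M2" using assms by (auto simp: nonneg_mat_def)
  note D = nonneg_mat2_diag[OF assms(1)]
  have "Re (X $$ (0, 0)) + Re (X $$ (1, 1)) = 0" using assms(2) X by (simp add: mtrace_mat2 complex_eq_iff)
  hence z: "X $$ (0, 0) = 0" "X $$ (1, 1) = 0" using D by (simp_all add: complex_eq_iff)
  define b where "b = X $$ (0, 1)"
  \<comment> \<open>Once the diagonal vanishes, the test vector \<open>(1, - cnj b)\<close> makes
    the quadratic form equal to -2 times the squared modulus of \<open>b\<close>, so nonnegativity
    forces \<open>b = 0\<close>.\<close>
  have "0 \<le> Re (b * (- cnj b) + cnj b * cnj (- cnj b))"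
    using nonneg_mat2_form[OF assms(1), of 1 "- cnj b"] z D(5) by (simp add: b_def)
  hence "(Re b)\<^sup>2 + (Im b)\<^sup>2 \<le> 0" by (simp add: power2_eq_square)
  hence "b = 0" by (simp add: complex_eq_iff sum_power2_le_zero_iff)
  thus ?thesis using X z D(5) by (intro mat2_eqI) (simp_all add: b_def)
qed

lemma density_matsD:
  assumes "\<rho> \<in> density_mats"
  shows "nonneg_mat 2 \<rho>" "mtrace \<rho> = 1" "\<rho> \<in> M2" "adj \<rho> = \<rho>"
  using assms by (auto simp: density_mats_def nonneg_mat_def)

lemma filter_step_nonneg:
  assumes "homodyne_model H" "u \<in> ctrls H" and r: "\<rho> \<in> density_mats" and y: "y = lam H \<or> y = - lam H"
  shows "nonneg_mat 2 (filter_step H \<rho> u y)"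
proof -
  let ?N = "emit H u + of_real (sgn y) \<cdot>\<^sub>m stay H u"
  have "?N \<in> M2" using Mplus_Mcirc_carrier(3,4)[OF assms(1,2)] by simp
  hence "nonneg_mat 2 (?N * \<rho> * adj ?N)" by (rule nonneg_mat_conj[OF density_matsD(1)[OF r]])
  hence "nonneg_mat 2 (of_real (1 / 2) \<cdot>\<^sub>m (?N * \<rho> * adj ?N))" by (rule nonneg_mat_smult) simp
  thus ?thesis by (simp add: filter_step_kraus[OF assms(1,2) density_matsD(3)[OF r] y])
qed

text \<open>By cyclicity the trace sees only the sum of \<open>adj X * X\<close> over the two Kraus
  operators, which is the identity by \<open>emit_stay_isometry\<close>.\<close>

lemma mtrace_filter_drift:
  assumes "homodyne_model H" "u \<in> ctrls H" and r: "\<rho> \<in> density_mats"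
  shows "mtrace (\<rho> + lamsq H \<cdot>\<^sub>m Lbar H \<rho> u) = 1"
proof -
  note c = Mplus_Mcirc_carrier(3,4)[OF assms(1,2)] and r' = density_matsD(3)[OF r]
  note d = carrier_matD[OF c(1)] carrier_matD[OF c(2)] carrier_matD[OF r']
  have cyc: "mtrace (X * \<rho> * adj X) = mtrace (adj X * X * \<rho>)" if "X \<in> M2" for X
    using that r' mtrace_mult_comm[of "X * \<rho>" "adj X"] by (simp add: mat_mult_assoc)
  have "mtrace (\<rho> + lamsq H \<cdot>\<^sub>m Lbar H \<rho> u)
      = mtrace (adj (emit H u) * emit H u * \<rho>) + mtrace (adj (stay H u) * stay H u * \<rho>)"
    unfolding filter_drift_eq[OF assms(1,2) r'] by (simp add: mtrace_add d cyc c)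
  also have "\<dots> = mtrace ((adj (emit H u) * emit H u + adj (stay H u) * stay H u) * \<rho>)"
    by (simp add: mat_distrib_right mtrace_add d)
  finally show ?thesis using r' density_matsD(2)[OF r] by (simp add: emit_stay_isometry[OF assms(1,2)])
qed

text \<open>The two interference terms are adjoint to each other, so their traces add up to a real
  number; dividing by \<open>lam H\<close> keeps it real.\<close>

lemma mtrace_Jbar:
  assumes "homodyne_model H" "u \<in> ctrls H" and r: "\<rho> \<in> density_mats"
  shows "mtrace (Jbar H \<rho> u) = of_real (trJ H \<rho> u)"
proof -
  note c = Mplus_Mcirc_carrier(3,4)[OF assms(1,2)] and r' = density_matsD(3,4)[OF r]
  note d = carrier_matD[OF c(1)] carrier_matD[OF c(2)] carrier_matD[OF r'(1)]
  have J: "Jbar H \<rho> u \<in> M2" using assms r' by (intro Lbar_Jbar_carrier)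
  have "of_real (lam H) * mtrace (Jbar H \<rho> u) = mtrace (emit H u * \<rho> * adj (stay H u))
      + mtrace (adj (emit H u * \<rho> * adj (stay H u)))"
    using J filter_Jbar_eq[OF assms(1,2) r'(1)]
    by (simp add: mtrace_smult[symmetric] mtrace_add d adjoint_mult r'(2) mat_mult_assoc)
  hence "Im (of_real (lam H) * mtrace (Jbar H \<rho> u)) = 0" by (simp add: mtrace_adjoint d)
  thus ?thesis using lam_pos[OF assms(1)] by (simp add: trJ_def complex_eq_iff)
qed

lemma mtrace_filter_step:
  assumes "homodyne_model H" "u \<in> ctrls H" and r: "\<rho> \<in> density_mats"
  shows "mtrace (filter_step H \<rho> u y) = of_real (ptrans H \<rho> u y)"
proof -
  note r' = density_matsD(3)[OF r]
  note LJ = Lbar_Jbar_carrier[OF assms(1,2) r']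
  show ?thesis
    using r' LJ mtrace_filter_drift[OF assms] mtrace_Jbar[OF assms]
    by (simp add: filter_step_def ptrans_def mtrace_smult mtrace_add)
qed

lemma ptrans_nonneg:
  assumes "homodyne_model H" "u \<in> ctrls H" "\<rho> \<in> density_mats" "y = lam H \<or> y = - lam H"
  shows "0 \<le> ptrans H \<rho> u y"
  using nonneg_mat2_trace(2)[OF filter_step_nonneg[OF assms]] by (simp add: mtrace_filter_step[OF assms(1-3)])

lemma ptrans_sum:
  assumes "homodyne_model H"
  shows "(\<Sum>y\<in>{lam H, - lam H}. ptrans H \<rho> u y) = 1"
  using lam_pos[OF assms] by (simp add: ptrans_def)

text \<open>An outcome of probability \<open>0\<close> has \<open>filter_step = 0\<close>, since a nonnegative matrix of
  trace \<open>0\<close> vanishes; this covers the degenerate branch of \<open>Gam\<close>.\<close>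

lemma filter_step_Gam:
  assumes m: "homodyne_model H" "u \<in> ctrls H" and r: "\<rho> \<in> density_mats" and y: "y = lam H \<or> y = - lam H"
  shows "filter_step H \<rho> u y = of_real (ptrans H \<rho> u y) \<cdot>\<^sub>m Gam H \<rho> u y"
proof -
  note r' = density_matsD(3)[OF r]
  note LJ = Lbar_Jbar_carrier[OF m r']
  define R where "R = \<rho> + lamsq H \<cdot>\<^sub>m Lbar H \<rho> u"
  define J where "J = Jbar H \<rho> u"
  define t where "t = trJ H \<rho> u"
  have R: "R \<in> M2" and J: "J \<in> M2" using LJ r' by (simp_all add: R_def J_def)
  have Gc: "Gam H \<rho> u y \<in> M2"
    using R J by (simp add: Gam_def Let_def R_def J_def minus_carrier_mat)
  have yy: "y\<^sup>2 = (lam H)\<^sup>2" using y by auto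
  have fs: "filter_step H \<rho> u z = (1 / 2 :: complex) \<cdot>\<^sub>m (R + of_real z \<cdot>\<^sub>m J)" for z
    by (simp add: filter_step_def R_def J_def)
  have p: "ptrans H \<rho> u z = 1 / 2 + z / 2 * t" for z by (simp add: ptrans_def t_def)
  have zero: "filter_step H \<rho> u z = 0\<^sub>m 2 2" if "1 + z * t = 0" "z = lam H \<or> z = - lam H" for z
  proof (rule nonneg_mat2_trace_zero[OF filter_step_nonneg[OF m r that(2)]])
    have "ptrans H \<rho> u z = 0" using that(1) by (simp add: p field_simps)
    thus "mtrace (filter_step H \<rho> u z) = 0" by (simp add: mtrace_filter_step[OF m r])
  qed
  have d: "1 - (lam H)\<^sup>2 * t\<^sup>2 = (1 + y * t) * (1 - y * t)"
    unfolding yy[symmetric] by (simp add: power2_eq_square algebra_simps)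
  consider "1 + y * t = 0" | "1 + y * t \<noteq> 0" "1 - y * t = 0" | "1 + y * t \<noteq> 0" "1 - y * t \<noteq> 0" by blast
  thus ?thesis
  proof cases
    case 1
    hence "ptrans H \<rho> u y = 0" by (simp add: p field_simps)
    thus ?thesis using zero[OF 1 y] Gc by (auto intro!: eq_matI)
  next
    case 2
    \<comment> \<open>The outcome \<open>y\<close> is certain here and \<open>- y\<close> is null.
      The vanishing step for \<open>- y\<close> yields \<open>R = y J\<close>, whence the step for
      \<open>y\<close> is \<open>R\<close>, which is what \<open>Gam\<close> gives when its fraction
      is read as 0.\<close>
    have "filter_step H \<rho> u (- y) = 0\<^sub>m 2 2" using 2(2) y by (intro zero) auto
    hence e: "(1 / 2 :: complex) \<cdot>\<^sub>m (R + of_real (- y) \<cdot>\<^sub>m J) = 0\<^sub>m 2 2" by (simp only: fs)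
    have RJ: "R = of_real y \<cdot>\<^sub>m J"
    proof (rule eq_matI)
      fix i j assume "i < dim_row (of_real y \<cdot>\<^sub>m J)" "j < dim_col (of_real y \<cdot>\<^sub>m J)"
      thus "R $$ (i, j) = (of_real y \<cdot>\<^sub>m J) $$ (i, j)"
        using arg_cong[OF e, of "\<lambda>Q. Q $$ (i, j)"] R J by simp
    qed (use R J in auto)
    have "Gam H \<rho> u y = R" using 2 d by (simp add: Gam_def Let_def R_def t_def)
    moreover have "ptrans H \<rho> u y = 1" using 2(2) by (simp add: p field_simps)
    moreover have "filter_step H \<rho> u y = R"
      unfolding fs RJ[symmetric] using R by (intro eq_matI) auto
    ultimately show ?thesis by simp
  next
    case 3
    have ne: "1 - (lam H)\<^sup>2 * t\<^sup>2 \<noteq> 0" using 3 unfolding d by simp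
    \<comment> \<open>Since \<open>lam^2 = y^2\<close>, numerator and denominator of the gain share
      the factor \<open>1 - y t\<close>. What remains is \<open>1 + y t\<close>, twice the
      probability of \<open>y\<close>.\<close>
    have num: "y - (lam H)\<^sup>2 * t = y * (1 - y * t)"
      unfolding yy[symmetric] by (simp add: power2_eq_square algebra_simps)
    have "Gam H \<rho> u y = R + of_real ((y - (lam H)\<^sup>2 * t) / (1 - (lam H)\<^sup>2 * t\<^sup>2)) \<cdot>\<^sub>m (J - of_real t \<cdot>\<^sub>m R)"
      using ne unfolding Gam_def Let_def R_def[symmetric] J_def[symmetric] t_def[symmetric] by (simp only: if_False)
    also have "(y - (lam H)\<^sup>2 * t) / (1 - (lam H)\<^sup>2 * t\<^sup>2) = y / (1 + y * t)"
      unfolding d num using 3 by simp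
    finally have G: "Gam H \<rho> u y = R + of_real (y / (1 + y * t)) \<cdot>\<^sub>m (J - of_real t \<cdot>\<^sub>m R)" .
    have pv: "ptrans H \<rho> u y = (1 + y * t) / 2" by (simp add: p field_simps)
    let ?y = "complex_of_real y" and ?t = "complex_of_real t"
    have c0: "1 + ?y * ?t \<noteq> 0"
      using 3(1) by (metis of_real_1 of_real_add of_real_eq_0_iff of_real_mult)
    have sc: "(1 + ?y * ?t) / 2 * (r + ?y / (1 + ?y * ?t) * (j - ?t * r)) = 1 / 2 * (r + ?y * j)" for r j
    proof -
      have "(1 + ?y * ?t) * (r + ?y / (1 + ?y * ?t) * (j - ?t * r)) = (1 + ?y * ?t) * r + ?y * (j - ?t * r)"
        using c0 by (simp add: distrib_left)
      also have "\<dots> = r + ?y * j" by (simp add: algebra_simps)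
      finally show ?thesis by simp
    qed
    show ?thesis unfolding fs G pv
    proof (rule eq_matI)
      fix i j
      assume "i < dim_row (of_real ((1 + y * t) / 2) \<cdot>\<^sub>m (R + of_real (y / (1 + y * t)) \<cdot>\<^sub>m (J - ?t \<cdot>\<^sub>m R)))"
        "j < dim_col (of_real ((1 + y * t) / 2) \<cdot>\<^sub>m (R + of_real (y / (1 + y * t)) \<cdot>\<^sub>m (J - ?t \<cdot>\<^sub>m R)))"
      thus "((1 / 2 :: complex) \<cdot>\<^sub>m (R + ?y \<cdot>\<^sub>m J)) $$ (i, j) =
        (of_real ((1 + y * t) / 2) \<cdot>\<^sub>m (R + of_real (y / (1 + y * t)) \<cdot>\<^sub>m (J - ?t \<cdot>\<^sub>m R))) $$ (i, j)"
        using R J sc[of "R $$ (i, j)" "J $$ (i, j)", symmetric] by simp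
    qed (use R J in auto)
  qed
qed

lemma Gam_carrier:
  assumes "homodyne_model H" "u \<in> ctrls H" "\<rho> \<in> M2"
  shows "Gam H \<rho> u y \<in> M2"
  using Lbar_Jbar_carrier[OF assms] assms(3) by (simp add: Gam_def Let_def minus_carrier_mat)

lemma Gam_density:
  assumes m: "homodyne_model H" "u \<in> ctrls H" and r: "\<rho> \<in> density_mats" and y: "y = lam H \<or> y = - lam H"
    and p: "0 < ptrans H \<rho> u y"
  shows "Gam H \<rho> u y \<in> density_mats"
proof -
  let ?p = "ptrans H \<rho> u y"
  have "of_real (inverse ?p) \<cdot>\<^sub>m filter_step H \<rho> u y = Gam H \<rho> u y"
    using p by (simp add: filter_step_Gam[OF assms(1-4)] smult_smult_mat of_real_mult[symmetric]
        del: of_real_mult of_real_inverse)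
  moreover have "nonneg_mat 2 (of_real (inverse ?p) \<cdot>\<^sub>m filter_step H \<rho> u y)"
    using p by (intro nonneg_mat_smult filter_step_nonneg[OF assms(1-4)]) simp
  moreover have "mtrace (of_real (inverse ?p) \<cdot>\<^sub>m filter_step H \<rho> u y) = 1"
    using p filter_step_carrier[OF m density_matsD(3)[OF r], of y]
    by (simp add: mtrace_smult mtrace_filter_step[OF m r])
  ultimately show ?thesis by (simp add: density_mats_def)
qed

section \<open>Functional calculus for the observations\<close>

lemma hproj_commute: "hproj y * hproj z = hproj z * hproj y"
  by (rule mat2_eqI) (simp_all add: index_mult_mat2 index_hproj mult_ac del: index_mult_mat(1))

lemma spectral_family_slot:
  assumes "homodyne_model H" "i \<le> nsteps H"
  shows "spectral_family (hdim H) {lam H, - lam H} (\<lambda>y. slot H i (hproj y))"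
proof -
  have l0: "lam H \<noteq> 0" "lam H \<noteq> - lam H" using lam_pos[OF assms(1)] by auto
  have "slot H i (hproj (lam H)) + slot H i (hproj (- lam H)) = 1\<^sub>m (hdim H)"
    using assms by (simp add: slot_add[symmetric] hproj_sum slot_one)
  hence "msum (hdim H) (\<lambda>y. slot H i (hproj y)) {lam H, - lam H} = 1\<^sub>m (hdim H)"
    using l0 by (simp add: msum_insert)
  moreover have "hproj (- lam H) * hproj (lam H) = 0\<^sub>m 2 2"
    using l0 hproj_orth[of "- lam H"] by simp
  ultimately show ?thesis
    using assms l0 unfolding spectral_family_def orth_proj_def
    by (auto simp: slot_mult hproj_idem hproj_orth slot_zero slot_adjoint)
qed

lemma dZ_spectral:
  assumes "homodyne_model H" "i \<le> nsteps H"
  shows "dZ H i = msum (hdim H) (\<lambda>y. of_real y \<cdot>\<^sub>m slot H i (hproj y)) {lam H, - lam H}"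
proof -
  have l0: "0 < lam H" using lam_pos[OF assms(1)] .
  have "emat 1 0 + emat 0 1 = hproj (lam H) + (- 1) \<cdot>\<^sub>m hproj (- lam H)"
    using l0 by (intro mat2_eqI) (auto simp: index_emat index_hproj carrier_matD[OF hproj_carrier])
  hence "slot H i (emat 1 0) + slot H i (emat 0 1) = slot H i (hproj (lam H)) + (- 1) \<cdot>\<^sub>m slot H i (hproj (- lam H))"
    using assms by (simp add: slot_add[symmetric] slot_smult[symmetric])
  moreover have "dZ H i = of_real (lam H) \<cdot>\<^sub>m (slot H i (emat 1 0) + slot H i (emat 0 1))"
    by (simp add: dZ_def dA_def dAstar_def sigma_minus_eq sigma_plus_eq smult_add_mat)
  moreover have "lam H \<noteq> - lam H" using l0 by simp
  ultimately show ?thesis by (simp add: msum_insert smult_add_mat smult_smult_mat)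
qed

lemma dZ_carrier [simp]: "dZ H i \<in> ops H"
  by (simp add: dZ_def dA_def dAstar_def sigma_minus_eq sigma_plus_eq)

lemma is_eigenproj_dZ:
  assumes "homodyne_model H" "i \<le> nsteps H" "y = lam H \<or> y = - lam H"
  shows "is_eigenproj (hdim H) (dZ H i) y (slot H i (hproj y))"
proof -
  have "{z \<in> {lam H, - lam H}. z = y} = {y}" using assms(3) by auto
  thus ?thesis
    using is_eigenproj_spectral_sum[OF spectral_family_slot[OF assms(1,2)], of id y]
    by (simp add: dZ_spectral[OF assms(1,2)])
qed

text \<open>Slots count from 1 and list positions from 0, hence the index
  \<open>i - 1\<close>.\<close>

lemma mprod_slot_hproj:
  assumes "n \<le> nsteps H" "length ys = n"
  shows "mprod (hdim H) (map (\<lambda>i. slot H i (hproj (ys ! (i - 1)))) [1..<Suc n]) = recproj H ys"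
  using assms
proof (induction n arbitrary: ys)
  case 0
  thus ?case by (simp add: recproj_Nil)
next
  case (Suc n)
  then obtain zs z where ys: "ys = zs @ [z]" "length zs = n" by (cases ys rule: rev_cases) auto
  have "map (\<lambda>i. slot H i (hproj (ys ! (i - 1)))) [1..<Suc (Suc n)]
      = map (\<lambda>i. slot H i (hproj (ys ! (i - 1)))) [1..<Suc n] @ [slot H (Suc n) (hproj z)]"
    using ys by (simp add: nth_append)
  also have "map (\<lambda>i. slot H i (hproj (ys ! (i - 1)))) [1..<Suc n] = map (\<lambda>i. slot H i (hproj (zs ! (i - 1)))) [1..<Suc n]"
    using ys by (intro map_cong) (auto simp: nth_append)
  finally have "mprod (hdim H) (map (\<lambda>i. slot H i (hproj (ys ! (i - 1)))) [1..<Suc (Suc n)])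
      = mprod (hdim H) (map (\<lambda>i. slot H i (hproj (zs ! (i - 1)))) [1..<Suc n]) * slot H (Suc n) (hproj z)"
    by (simp only:) (rule mprod_snoc, auto)
  also have "\<dots> = recproj H zs * slot H (Suc n) (hproj z)" using Suc.IH[of zs] Suc.prems ys by simp
  also have "\<dots> = recproj H ys" using recproj_mult_slot[of zs H z] Suc.prems ys by simp
  finally show ?case .
qed

lemma ctrl_op_eq:
  assumes "homodyne_model H" "1 \<le> l" "l \<le> nsteps H"
  shows "ctrl_op H \<mu> l = msum (hdim H) (\<lambda>ys. of_real (\<mu> l ys) \<cdot>\<^sub>m recproj H ys) (records H (l - 1))"
  unfolding ctrl_op_def hdim_def[symmetric]
proof (rule msum_cong[OF refl])
  fix ys assume ys: "ys \<in> records H (l - 1)"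
  have e: "map (\<lambda>i. eigenproj (dZ H i) (ys ! (i - 1))) [1..<l] = map (\<lambda>i. slot H i (hproj (ys ! (i - 1)))) [1..<Suc (l - 1)]"
  proof (rule map_cong)
    fix i assume "i \<in> set [1..<Suc (l - 1)]"
    hence "i - 1 < l - 1" "i \<le> nsteps H" using assms by auto
    thus "eigenproj (dZ H i) (ys ! (i - 1)) = slot H i (hproj (ys ! (i - 1)))"
      using records_nth[OF ys] by (intro eigenproj_eqI[OF dZ_carrier is_eigenproj_dZ] assms(1)) auto
  qed (use assms in simp)
  have "mprod (hdim H) (map (\<lambda>i. slot H i (hproj (ys ! (i - 1)))) [1..<Suc (l - 1)]) = recproj H ys"
    using assms records_length[OF ys] by (intro mprod_slot_hproj) auto
  thus "of_real (\<mu> l ys) \<cdot>\<^sub>m mprod (hdim H) (map (\<lambda>i. eigenproj (dZ H i) (ys ! (i - 1))) [1..<l])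
      = of_real (\<mu> l ys) \<cdot>\<^sub>m recproj H ys"
    by (simp only: e)
qed

text \<open>On the sector of each past record the control is a number, so the operator-valued
  function is evaluated there directly, even if several records share that number.\<close>

lemma at_ctrl_eq:
  assumes "homodyne_model H" "admissible H \<mu>" "1 \<le> l" "l \<le> nsteps H"
    and "\<And>u. u \<in> ctrls H \<Longrightarrow> F u \<in> ops H"
  shows "at_ctrl H \<mu> l F = msum (hdim H) (\<lambda>ys. F (\<mu> l ys) * recproj H ys) (records H (l - 1))"
proof -
  have "\<mu> l ` records H (l - 1) \<subseteq> ctrls H" using assms by (auto simp: admissible_def)
  moreover have "spectral_family (hdim H) (records H (l - 1)) (recproj H)"
    using assms by (intro spectral_family_recproj) auto
  ultimately show ?thesis
    unfolding at_ctrl_def hdim_def[symmetric] ctrl_op_eq[OF assms(1,3,4)]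
    using assms(5) by (intro functional_calculus_spectral_sum) auto
qed

section \<open>The controlled evolution\<close>

text \<open>The projector carries the identity on the system and on every slot beyond the
  record.\<close>

lemma recproj_slot_commute:
  assumes X: "X \<in> M2" and i: "i = 0 \<or> length ys < i" "i \<le> nsteps H" and len: "length ys \<le> nsteps H"
  shows "recproj H ys * slot H i X = slot H i X * recproj H ys"
proof -
  let ?A = "1\<^sub>m 2 # map hproj ys @ replicate (nsteps H - length ys) (1\<^sub>m 2)"
  have "?A ! i = 1\<^sub>m 2" using i len by (cases i) (auto simp: nth_append)
  moreover have "mats2 ?A" "length ?A = Suc (nsteps H)" using len by auto
  ultimately show ?thesis unfolding recproj_def
    using X i by (simp add: tensor_mult_slot slot_mult_tensor del: list_update.simps)
qed

lemma recproj_slot_hproj_commute: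
  assumes i: "1 \<le> i" "i \<le> nsteps H" and len: "length ys \<le> nsteps H"
  shows "recproj H ys * slot H i (hproj y) = slot H i (hproj y) * recproj H ys"
proof (cases "length ys < i")
  case True
  thus ?thesis using assms by (intro recproj_slot_commute) auto
next
  case False
  let ?A = "1\<^sub>m 2 # map hproj ys @ replicate (nsteps H - length ys) (1\<^sub>m 2)"
  have "?A ! i = hproj (ys ! (i - 1))" using i False by (cases i) (auto simp: nth_append)
  moreover have "mats2 ?A" "length ?A = Suc (nsteps H)" using len by auto
  ultimately show ?thesis unfolding recproj_def
    using i by (simp add: tensor_mult_slot slot_mult_tensor hproj_commute[of y] del: list_update.simps)
qed

lemma quad_commute:
  assumes c: "A \<in> M2" "B \<in> M2" "C \<in> M2" "D \<in> M2"
    and T: "T \<in> ops H"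
    and T0: "\<And>X. X \<in> M2 \<Longrightarrow> T * slot H 0 X = slot H 0 X * T"
    and Tl: "\<And>X. X \<in> M2 \<Longrightarrow> T * slot H l X = slot H l X * T"
  shows "T * quad H l A B C D = quad H l A B C D * T"
proof -
  have "T * two_slot H l X Y = two_slot H l X Y * T" if "X \<in> M2" "Y \<in> M2" for X Y
  proof -
    have "T * two_slot H l X Y = slot H 0 X * (T * slot H l Y)"
      using that T by (simp add: two_slot_def mat_mult_assoc[symmetric] T0)
    also have "\<dots> = two_slot H l X Y * T"
      using that T by (simp add: Tl two_slot_def mat_mult_assoc)
    finally show ?thesis .
  qed
  thus ?thesis using c T by (simp add: quad_def mat_distrib_left mat_distrib_right)
qed

text \<open>One step is composed of operators on slots 0 and \<open>l\<close> only, so commuting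
  with these suffices.\<close>

lemma Mstep_commute:
  assumes "homodyne_model H" "u \<in> ctrls H" "1 \<le> l" "l \<le> nsteps H"
    and "T \<in> ops H"
    and "\<And>X. X \<in> M2 \<Longrightarrow> T * slot H 0 X = slot H 0 X * T"
    and "\<And>X. X \<in> M2 \<Longrightarrow> T * slot H l X = slot H l X * T"
  shows "T * Mstep H l u = Mstep H l u * T"
proof -
  obtain A C where AC: "A \<in> M2" "C \<in> M2"
    and M: "Mstep H l u = quad H l A (emit H u) C (stay H u)"
    using Mstep_quad[OF assms(1,2)] assms(3,4) by metis
  show ?thesis unfolding M using AC Mplus_Mcirc_carrier(3,4)[OF assms(1,2)] assms(5-7)
    by (intro quad_commute) auto
qed

definition ctrl_step :: "homodyne \<Rightarrow> strategy \<Rightarrow> nat \<Rightarrow> complex mat" where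
  "ctrl_step H \<mu> l = at_ctrl H \<mu> l (Mstep H l)"

lemma admissibleD:
  "admissible H \<mu> \<Longrightarrow> 1 \<le> l \<Longrightarrow> l \<le> nsteps H \<Longrightarrow> ys \<in> records H (l - 1) \<Longrightarrow> \<mu> l ys \<in> ctrls H"
  by (simp add: admissible_def)

lemma ctrl_step_eq:
  assumes m: "homodyne_model H" "admissible H \<mu>" and l: "1 \<le> l" "l \<le> nsteps H"
  shows "ctrl_step H \<mu> l
    = msum (hdim H) (\<lambda>ys. Mstep H l (\<mu> l ys) * recproj H ys) (records H (l - 1))"
  unfolding ctrl_step_def by (rule at_ctrl_eq[OF m l]) (rule Mstep_unitary(2)[OF m(1) _ l])

lemma recproj_dims:
  assumes "length ys \<le> nsteps H"
  shows "dim_row (recproj H ys) = hdim H" "dim_col (recproj H ys) = hdim H"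
  using recproj_carrier[OF assms] by auto

text \<open>The step at time \<open>l\<close> acts on the system and slot \<open>l\<close>, hence
  commutes with the projectors of records of length \<open>l - 1\<close>. Orthogonality then removes
  all sectors except that of \<open>ys\<close>, leaving one fixed control.\<close>

lemma ctrl_step_recproj:
  assumes m: "homodyne_model H" "admissible H \<mu>" and l: "1 \<le> l" "l \<le> nsteps H" and ys: "ys \<in> records H (l - 1)"
  shows "recproj H ys * ctrl_step H \<mu> l = Mstep H l (\<mu> l ys) * recproj H ys"
proof -
  let ?N = "hdim H"
  note u = admissibleD[OF m(2) l]
  have l1: "l - 1 \<le> nsteps H" using l by simp
  note P = records_recproj_carrier[OF _ l1]
  have M: "Mstep H l (\<mu> l zs) \<in> ops H" if "zs \<in> records H (l - 1)" for zs
    by (rule Mstep_unitary(2)[OF m(1) u[OF that] l])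
  have com: "recproj H zs * Mstep H l (\<mu> l xs) = Mstep H l (\<mu> l xs) * recproj H zs"
    if "zs \<in> records H (l - 1)" "xs \<in> records H (l - 1)" for zs xs
    using records_length[OF that(1)] l P[OF that(1)]
    by (intro Mstep_commute m u that recproj_slot_commute) auto
  have PP: "recproj H ys * recproj H zs = (if zs = ys then recproj H ys else 0\<^sub>m ?N ?N)" if "zs \<in> records H (l - 1)" for zs
    using recproj_mult[OF m(1) ys that] l by auto
  note V = ctrl_step_eq[OF m l]
  have "recproj H ys * ctrl_step H \<mu> l
      = msum ?N (\<lambda>zs. recproj H ys * (Mstep H l (\<mu> l zs) * recproj H zs)) (records H (l - 1))"
    unfolding V using P[OF ys] P M by (intro msum_mult_left) auto
  also have "\<dots> = msum ?N (\<lambda>zs. if zs = ys then Mstep H l (\<mu> l zs) * recproj H zs else 0\<^sub>m ?N ?N) (records H (l - 1))"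
  proof (rule msum_cong[OF refl])
    fix zs assume z: "zs \<in> records H (l - 1)"
    have "recproj H ys * (Mstep H l (\<mu> l zs) * recproj H zs) = Mstep H l (\<mu> l zs) * (recproj H ys * recproj H zs)"
      using carrier_matD[OF P[OF ys]] carrier_matD[OF P[OF z]] carrier_matD[OF M[OF z]]
      by (simp add: mat_mult_assoc[symmetric] com[OF ys z])
    thus "recproj H ys * (Mstep H l (\<mu> l zs) * recproj H zs)
        = (if zs = ys then Mstep H l (\<mu> l zs) * recproj H zs else 0\<^sub>m ?N ?N)"
      using M[OF z] by (simp add: PP[OF z])
  qed
  also have "\<dots> = Mstep H l (\<mu> l ys) * recproj H ys"
    using P[OF ys] M[OF ys] ys by (subst msum_delta) auto
  finally show ?thesis .
qed

lemma ctrl_step_carrier [simp]: "ctrl_step H \<mu> l \<in> ops H"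
  unfolding ctrl_step_def at_ctrl_def hdim_def[symmetric] by simp

lemma dim_ctrl_step [simp]:
  "dim_row (ctrl_step H \<mu> l) = hdim H" "dim_col (ctrl_step H \<mu> l) = hdim H"
  by (rule carrier_matD[OF ctrl_step_carrier])+

text \<open>The resolution of the identity over past records is inserted between the two factors; on
  each sector the step is a fixed unitary, and the sector projectors sum back to 1.\<close>

lemma ctrl_step_unitary:
  assumes m: "homodyne_model H" "admissible H \<mu>" and l: "1 \<le> l" "l \<le> nsteps H"
  shows "adj (ctrl_step H \<mu> l) * ctrl_step H \<mu> l = 1\<^sub>m (hdim H)"
proof -
  let ?N = "hdim H" and ?V = "ctrl_step H \<mu> l"
  have one: "msum ?N (recproj H) (records H (l - 1)) = 1\<^sub>m ?N" using l by (intro msum_recproj m) auto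
  have l1: "l - 1 \<le> nsteps H" using l by simp
  note P = records_recproj_carrier[OF _ l1]
  have M: "Mstep H l (\<mu> l zs) \<in> ops H" if "zs \<in> records H (l - 1)" for zs
    by (rule Mstep_unitary(2)[OF m(1) admissibleD[OF m(2) l that] l])
  have "adj ?V * ?V = adj ?V * (msum ?N (recproj H) (records H (l - 1)) * ?V)"
    unfolding one by simp
  also have "\<dots> = adj ?V * msum ?N (\<lambda>zs. recproj H zs * ?V) (records H (l - 1))"
    using P by (subst msum_mult_right) auto
  also have "\<dots> = msum ?N (\<lambda>zs. adj ?V * (recproj H zs * ?V)) (records H (l - 1))"
    using P by (intro msum_mult_left) auto
  also have "\<dots> = msum ?N (recproj H) (records H (l - 1))"
  proof (rule msum_cong[OF refl])
    fix zs assume z: "zs \<in> records H (l - 1)"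
    let ?P = "recproj H zs" and ?M = "Mstep H l (\<mu> l zs)"
    note d = carrier_matD[OF P[OF z]] carrier_matD[OF M[OF z]]
    have PP: "?P * ?P = ?P" using recproj_mult[OF m(1) z z] l by auto
    have MM: "adj ?M * ?M = 1\<^sub>m ?N"
      by (rule Mstep_unitary(1)[OF m(1) admissibleD[OF m(2) l z] l])
    have "adj ?V * (?P * ?V) = adj ?V * ((?P * ?P) * ?V)" by (simp only: PP)
    also have "\<dots> = adj (?P * ?V) * (?P * ?V)"
      by (simp add: adjoint_mult d recproj_adjoint mat_mult_assoc)
    also have "\<dots> = ?P * ((adj ?M * ?M) * ?P)"
      unfolding ctrl_step_recproj[OF m l z] by (simp add: adjoint_mult d recproj_adjoint mat_mult_assoc)
    finally show "adj ?V * (?P * ?V) = ?P" by (simp add: MM PP d)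
  qed
  finally show ?thesis using one by simp
qed

lemma Uop_simps: "Uop H \<mu> 0 = 1\<^sub>m (hdim H)" "Uop H \<mu> (Suc l) = ctrl_step H \<mu> (Suc l) * Uop H \<mu> l"
  by (simp_all only: Uop.simps hdim_def ctrl_step_def)

lemma Uop_carrier [simp]: "Uop H \<mu> l \<in> ops H"
  by (induction l) (simp_all only: Uop_simps one_carrier_mat square_mult_carrier ctrl_step_carrier)

lemma dim_Uop [simp]: "dim_row (Uop H \<mu> l) = hdim H" "dim_col (Uop H \<mu> l) = hdim H"
  using carrier_matD[OF Uop_carrier[of H \<mu> l]] by auto

lemma Uop_unitary:
  assumes m: "homodyne_model H" "admissible H \<mu>" and l: "l \<le> nsteps H"
  shows "adj (Uop H \<mu> l) * Uop H \<mu> l = 1\<^sub>m (hdim H)" "Uop H \<mu> l * adj (Uop H \<mu> l) = 1\<^sub>m (hdim H)"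
proof -
  show *: "adj (Uop H \<mu> l) * Uop H \<mu> l = 1\<^sub>m (hdim H)"
    using l
  proof (induction l)
    case (Suc l)
    let ?V = "ctrl_step H \<mu> (Suc l)" and ?U = "Uop H \<mu> l"
    note d = carrier_matD[OF ctrl_step_carrier[of H \<mu> "Suc l"]]
    have "adj (Uop H \<mu> (Suc l)) * Uop H \<mu> (Suc l) = adj ?U * ((adj ?V * ?V) * ?U)"
      by (simp add: Uop_simps adjoint_mult mat_mult_assoc d del: Uop.simps)
    also have "adj ?V * ?V = 1\<^sub>m (hdim H)" using Suc by (intro ctrl_step_unitary m) auto
    finally show ?case using Suc by (simp del: Uop.simps)
  qed (simp add: Uop_simps del: Uop.simps)
  show "Uop H \<mu> l * adj (Uop H \<mu> l) = 1\<^sub>m (hdim H)"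
    \<comment> \<open>Only a left inverse has been built; for square matrices it is also a right
      inverse.\<close>
    using mat_mult_left_right_inverse[OF _ _ *] by simp
qed

section \<open>Demolition-free observation\<close>

text \<open>A past field slot meets the later step only through the control, which is a function of
  projectors of the same observable; the unitaries themselves act on slots 0 and
  \<open>l\<close>.\<close>

lemma ctrl_step_slot_commute:
  assumes m: "homodyne_model H" "admissible H \<mu>" and l: "l \<le> nsteps H" and i: "1 \<le> i" "i < l"
  shows "slot H i (hproj y) * ctrl_step H \<mu> l = ctrl_step H \<mu> l * slot H i (hproj y)"
proof -
  let ?N = "hdim H" and ?S = "slot H i (hproj y)"
  have l': "1 \<le> l" using i by simp
  note u = admissibleD[OF m(2) l' l]
  have l1: "l - 1 \<le> nsteps H" using l by simp
  note P = records_recproj_carrier[OF _ l1]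
  have M: "Mstep H l (\<mu> l zs) \<in> ops H" if "zs \<in> records H (l - 1)" for zs
    by (rule Mstep_unitary(2)[OF m(1) u[OF that] l' l])
  note V = ctrl_step_eq[OF m l' l]
  have "?S * ctrl_step H \<mu> l = msum ?N (\<lambda>zs. ?S * (Mstep H l (\<mu> l zs) * recproj H zs)) (records H (l - 1))"
    unfolding V using P M by (intro msum_mult_left) auto
  also have "\<dots> = msum ?N (\<lambda>zs. Mstep H l (\<mu> l zs) * recproj H zs * ?S) (records H (l - 1))"
  proof (rule msum_cong[OF refl])
    fix zs assume z: "zs \<in> records H (l - 1)"
    note d = carrier_matD[OF P[OF z]] carrier_matD[OF M[OF z]]
    have SM: "?S * Mstep H l (\<mu> l zs) = Mstep H l (\<mu> l zs) * ?S"
      using i l by (intro Mstep_commute m u z slot_commute) auto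
    have SP: "recproj H zs * ?S = ?S * recproj H zs"
      using i l records_length[OF z] by (intro recproj_slot_hproj_commute) auto
    have "?S * (Mstep H l (\<mu> l zs) * recproj H zs) = Mstep H l (\<mu> l zs) * (?S * recproj H zs)"
      by (simp add: mat_mult_assoc[symmetric] d SM)
    thus "?S * (Mstep H l (\<mu> l zs) * recproj H zs) = Mstep H l (\<mu> l zs) * recproj H zs * ?S"
      by (simp add: mat_mult_assoc d SP)
  qed
  also have "\<dots> = ctrl_step H \<mu> l * ?S"
    unfolding V using P M by (intro msum_mult_right[symmetric]) auto
  finally show ?thesis .
qed

text \<open>Non-demolition: later steps commute with the spectral projectors of slot
  \<open>i\<close> and cancel by unitarity. All observations can therefore be conjugated by the same
  final unitary.\<close>

lemma jflow_slot_const: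
  assumes m: "homodyne_model H" "admissible H \<mu>" and i: "1 \<le> i" "i \<le> l" "l \<le> nsteps H"
  shows "adj (Uop H \<mu> l) * slot H i (hproj y) * Uop H \<mu> l
    = adj (Uop H \<mu> i) * slot H i (hproj y) * Uop H \<mu> i"
  using i(2,3)
proof (induction l rule: dec_induct)
  case (step l)
  let ?V = "ctrl_step H \<mu> (Suc l)" and ?U = "Uop H \<mu> l" and ?S = "slot H i (hproj y)"
  note d = carrier_matD[OF ctrl_step_carrier[of H \<mu> "Suc l"]]
  have SV: "?S * ?V = ?V * ?S" using step i by (intro ctrl_step_slot_commute m) auto
  have VV: "adj ?V * ?V = 1\<^sub>m (hdim H)" using step by (intro ctrl_step_unitary m) auto
  have "adj (Uop H \<mu> (Suc l)) * ?S * Uop H \<mu> (Suc l) = adj ?U * (adj ?V * ((?S * ?V) * ?U))"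
    by (simp add: Uop_simps adjoint_mult mat_mult_assoc d del: Uop.simps)
  also have "\<dots> = adj ?U * ((adj ?V * ?V) * (?S * ?U))"
    unfolding SV by (simp add: mat_mult_assoc d)
  also have "\<dots> = adj ?U * ?S * ?U" by (simp add: VV mat_mult_assoc)
  finally show ?case using step by simp
qed simp

lemma mprod_eigenproj_dY:
  assumes m: "homodyne_model H" "admissible H \<mu>" and ys: "ys \<in> records H (nsteps H)"
  shows "mprod (hdim H) (map (\<lambda>l. eigenproj (dY H \<mu> l) (ys ! (l - 1))) [1..<Suc (nsteps H)])
    = adj (Uop H \<mu> (nsteps H)) * recproj H ys * Uop H \<mu> (nsteps H)"
proof -
  let ?U = "Uop H \<mu> (nsteps H)"
  let ?S = "\<lambda>l. slot H l (hproj (ys ! (l - 1)))"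
  have "map (\<lambda>l. eigenproj (dY H \<mu> l) (ys ! (l - 1))) [1..<Suc (nsteps H)]
      = map (\<lambda>l. adj ?U * ?S l * ?U) [1..<Suc (nsteps H)]"
  proof (rule map_cong[OF refl])
    fix l assume "l \<in> set [1..<Suc (nsteps H)]"
    hence l: "1 \<le> l" "l \<le> nsteps H" "l - 1 < nsteps H" by auto
    have "is_eigenproj (hdim H) (dY H \<mu> l) (ys ! (l - 1)) (adj (Uop H \<mu> l) * ?S l * Uop H \<mu> l)"
      unfolding dY_def jflow_def
      using l records_nth[OF ys l(3)] by (intro is_eigenproj_unitary_conj is_eigenproj_dZ Uop_unitary m) auto
    hence "eigenproj (dY H \<mu> l) (ys ! (l - 1)) = adj (Uop H \<mu> l) * ?S l * Uop H \<mu> l"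
      by (intro eigenproj_eqI) (auto simp: dY_def jflow_def)
    thus "eigenproj (dY H \<mu> l) (ys ! (l - 1)) = adj ?U * ?S l * ?U"
      using jflow_slot_const[OF m l(1,2) order_refl] by simp
  qed
  also have "\<dots> = map (\<lambda>A. adj ?U * A * ?U) (map ?S [1..<Suc (nsteps H)])" by simp
  finally have "mprod (hdim H) (map (\<lambda>l. eigenproj (dY H \<mu> l) (ys ! (l - 1))) [1..<Suc (nsteps H)])
      = adj ?U * mprod (hdim H) (map ?S [1..<Suc (nsteps H)]) * ?U"
    by (simp only:) (intro mprod_conj Uop_unitary m Uop_carrier order_refl, auto)
  thus ?thesis using mprod_slot_hproj[OF order_refl records_length[OF ys]] by simp
qed

section \<open>The conditional state\<close>

text \<open>The probability of the first \<open>l\<close> observations, computed from the filter.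
  Once it is 0 it stays 0, so the filter values reached after a null outcome do not influence
  it.\<close>

definition weight :: "homodyne \<Rightarrow> strategy \<Rightarrow> nat \<Rightarrow> real list \<Rightarrow> real" where
  "weight H \<mu> l ys = (\<Prod>i<l. ptrans H (filt H \<mu> i ys) (uctrl \<mu> (Suc i) ys) (ys ! i))"

lemma weight_simps: "weight H \<mu> 0 ys = 1"
  "weight H \<mu> (Suc l) ys = weight H \<mu> l ys * ptrans H (filt H \<mu> l ys) (uctrl \<mu> (Suc l) ys) (ys ! l)"
  by (simp_all add: weight_def)

lemma uctrl_take: "l \<le> Suc m \<Longrightarrow> uctrl \<mu> l (take m ys) = uctrl \<mu> l ys"
  by (simp add: uctrl_def min_absorb1)

lemma filt_take: "l \<le> m \<Longrightarrow> filt H \<mu> l (take m ys) = filt H \<mu> l ys"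
  by (induction l) (simp_all add: uctrl_take)

lemma weight_take: "l \<le> m \<Longrightarrow> weight H \<mu> l (take m ys) = weight H \<mu> l ys"
  by (induction l) (simp_all add: weight_simps uctrl_take filt_take)

lemma filt_append: "l \<le> length ys \<Longrightarrow> filt H \<mu> l (ys @ zs) = filt H \<mu> l ys"
  using filt_take[of l "length ys" H \<mu> "ys @ zs"] by simp

lemma weight_append: "l \<le> length ys \<Longrightarrow> weight H \<mu> l (ys @ zs) = weight H \<mu> l ys"
  using weight_take[of l "length ys" H \<mu> "ys @ zs"] by simp

lemma records_take: "ys \<in> records H n \<Longrightarrow> l \<le> n \<Longrightarrow> take l ys \<in> records H l"
  using set_take_subset[of l ys] by (auto simp: records_def)

lemma uctrl_ctrls:
  assumes "admissible H \<mu>" "ys \<in> records H n" "1 \<le> l" "l \<le> nsteps H" "l \<le> Suc n"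
  shows "uctrl \<mu> l ys \<in> ctrls H"
  unfolding uctrl_def using assms by (intro admissibleD records_take[OF assms(2)]) auto

lemma rho0_density: "homodyne_model H \<Longrightarrow> rho0 H \<in> density_mats"
  by (simp add: homodyne_model_def)

lemma filt_carrier:
  assumes m: "homodyne_model H" "admissible H \<mu>" and ys: "ys \<in> records H n" and l: "l \<le> n" "l \<le> nsteps H"
  shows "filt H \<mu> l ys \<in> M2"
  using l
proof (induction l)
  case 0
  thus ?case using density_matsD(3)[OF rho0_density[OF m(1)]] by simp
next
  case (Suc l)
  thus ?case using uctrl_ctrls[OF m(2) ys, of "Suc l"] by (simp add: Gam_carrier[OF m(1)])
qed

text \<open>Both claims are proved together: a transition probability is nonnegative because the
  current state is a density matrix, and this is known only along prefixes of positive
  weight.\<close>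

lemma weight_nonneg_filt_density:
  assumes m: "homodyne_model H" "admissible H \<mu>" and ys: "ys \<in> records H n" and l: "l \<le> n" "l \<le> nsteps H"
  shows "0 \<le> weight H \<mu> l ys \<and> (0 < weight H \<mu> l ys \<longrightarrow> filt H \<mu> l ys \<in> density_mats)"
  using l
proof (induction l)
  case 0
  thus ?case using rho0_density[OF m(1)] by (simp add: weight_simps)
next
  case (Suc l)
  have u: "uctrl \<mu> (Suc l) ys \<in> ctrls H" using Suc by (intro uctrl_ctrls[OF m(2) ys]) auto
  have y: "ys ! l = lam H \<or> ys ! l = - lam H" using Suc by (intro records_nth[OF ys]) auto
  show ?case
  proof (cases "weight H \<mu> l ys = 0")
    case False
    hence r: "filt H \<mu> l ys \<in> density_mats" and w: "0 < weight H \<mu> l ys" using Suc by auto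
    show ?thesis
      using ptrans_nonneg[OF m(1) u r y] Gam_density[OF m(1) u r y] w
      by (auto simp: weight_simps zero_less_mult_iff)
  qed (simp add: weight_simps)
qed

lemmas weight_nonneg = weight_nonneg_filt_density[THEN conjunct1]
lemmas filt_density = weight_nonneg_filt_density[THEN conjunct2, rule_format]

text \<open>Only the second column of the block form of \<open>Mstep\<close> meets the vacuum.\<close>

lemma interaction_step:
  assumes m: "homodyne_model H" "u \<in> ctrls H" and r: "\<rho> \<in> M2"
    and ps: "mats2 ps" "mats2 vs" "Suc (length ps + length vs) = nsteps H"
    and y: "y = lam H \<or> y = - lam H"
  defines "l \<equiv> Suc (length ps)"
  shows "slot H l (hproj y) * (Mstep H l u * tensor_list (\<rho> # ps @ vac_proj # vs)
      * adj (Mstep H l u)) * slot H l (hproj y)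
    = tensor_list (filter_step H \<rho> u y # ps @ hproj y # vs)"
proof -
  define T where "T X Y = tensor_list (X # ps @ Y # vs)" for X Y
  have l: "1 \<le> l" "l \<le> nsteps H" "0 \<le> nsteps H" using ps by (auto simp: l_def)
  have Tc: "T X Y \<in> ops H" if "X \<in> M2" "Y \<in> M2" for X Y
    unfolding T_def using that ps by (intro tensor_list_hdim) auto
  have Td: "dim_row (T X Y) = hdim H" "dim_col (T X Y) = hdim H" if "X \<in> M2" "Y \<in> M2" for X Y
    using Tc[OF that] by auto
  have nth: "(X # ps @ Y # vs) ! l = Y" and upd: "(X # ps @ Y # vs)[l := Z] = X # ps @ Z # vs" for X Y Z
    by (simp_all add: l_def)
  have ml: "mats2 (X # ps @ Y # vs)" "length (X # ps @ Y # vs) = Suc (nsteps H)"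
    if "X \<in> M2" "Y \<in> M2" for X Y
    using that ps by auto
  have sl: "slot H l Z * T X Y = T X (Z * Y)" "T X Y * slot H l Z = T X (Y * Z)"
    if "X \<in> M2" "Y \<in> M2" "Z \<in> M2" for X Y Z
    unfolding T_def slot_mult_tensor[OF that(3) ml[OF that(1,2)] l(2)] tensor_mult_slot[OF that(3) ml[OF that(1,2)] l(2)]
    by (simp_all only: nth upd)
  have s0: "slot H 0 Z * T X Y = T (Z * X) Y" "T X Y * slot H 0 Z = T (X * Z) Y"
    if "X \<in> M2" "Y \<in> M2" "Z \<in> M2" for X Y Z
    unfolding T_def slot_mult_tensor[OF that(3) ml[OF that(1,2)] l(3)] tensor_mult_slot[OF that(3) ml[OF that(1,2)] l(3)]
    by simp_all
  have tT: "two_slot H l X' Y' * T X Y = T (X' * X) (Y' * Y)" "T X Y * two_slot H l X' Y' = T (X * X') (Y * Y')"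
    if "X \<in> M2" "Y \<in> M2" "X' \<in> M2" "Y' \<in> M2" for X Y X' Y'
  proof -
    show "two_slot H l X' Y' * T X Y = T (X' * X) (Y' * Y)"
      using that by (simp add: two_slot_def mat_mult_assoc Td sl s0)
    have "T X Y * two_slot H l X' Y' = (T X Y * slot H 0 X') * slot H l Y'"
      using that by (simp add: two_slot_def mat_mult_assoc Td)
    thus "T X Y * two_slot H l X' Y' = T (X * X') (Y * Y')"
      using that by (simp add: sl s0)
  qed
  have Tz: "T X (0\<^sub>m 2 2) = 0\<^sub>m (hdim H) (hdim H)" if "X \<in> M2" for X
    using tensor_list_zero[OF ml(1)[OF that zero_carrier_mat], of l] nth[of X "0\<^sub>m 2 2"] l ml(2)[OF that zero_carrier_mat]
    unfolding T_def by (simp only: hdim_def)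
  have Tadd: "T (X + X') Y = T X Y + T X' Y" if "X \<in> M2" "X' \<in> M2" "Y \<in> M2" for X X' Y
    using tensor_list_update_add[OF ml(1)[OF that(1,3)] that(1,2), of 0] by (simp add: T_def)
  have Tsm: "T (a \<cdot>\<^sub>m X) Y = a \<cdot>\<^sub>m T X Y" "T X (a \<cdot>\<^sub>m Y) = a \<cdot>\<^sub>m T X Y"
    if "X \<in> M2" "Y \<in> M2" for a X Y
  proof -
    show "T (a \<cdot>\<^sub>m X) Y = a \<cdot>\<^sub>m T X Y"
      using tensor_list_update_smult[OF ml(1)[OF that] that(1), of 0] by (simp add: T_def)
    have "l < length (X # ps @ Y # vs)" using l ml(2)[OF that] by simp
    from tensor_list_update_smult[OF ml(1)[OF that] that(2) this, of a]
    show "T X (a \<cdot>\<^sub>m Y) = a \<cdot>\<^sub>m T X Y" by (simp only: upd T_def)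
  qed
  obtain A C where AC: "A \<in> M2" "C \<in> M2"
    and M: "Mstep H l u = quad H l A (emit H u) C (stay H u)"
    using Mstep_quad[OF m] l by metis
  define B where "B = emit H u" define D where "D = stay H u"
  have BD: "B \<in> M2" "D \<in> M2"
    using Mplus_Mcirc_carrier(3,4)[OF m] by (simp_all add: B_def D_def)
  note c = AC BD r
  define q where "q = hproj y"
  have q: "q \<in> M2" by (simp add: q_def)
  have "Mstep H l u * T \<rho> (emat 1 1) = T (B * \<rho>) (emat 0 1) + T (D * \<rho>) (emat 1 1)"
    unfolding M B_def[symmetric] D_def[symmetric] quad_def
    using c Tc[of "B * \<rho>" "emat 0 1"]
    by (simp add: mat_distrib_right Td tT emat_mult Tz)
  moreover have "adj (Mstep H l u) = quad H l (adj A) (adj C) (adj B) (adj D)"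
    unfolding M B_def[symmetric] D_def[symmetric] using c l by (intro quad_adjoint)
  ultimately have "Mstep H l u * T \<rho> (emat 1 1) * adj (Mstep H l u)
      = T (B * \<rho> * adj B) (emat 0 0) + T (D * \<rho> * adj B) (emat 1 0)
      + (T (B * \<rho> * adj D) (emat 0 1) + T (D * \<rho> * adj D) (emat 1 1))"
    using c by (simp add: quad_def mat_distrib_left mat_distrib_right Td Tc tT emat_mult Tz)
  hence "slot H l q * (Mstep H l u * T \<rho> (emat 1 1) * adj (Mstep H l u)) * slot H l q
      = T (B * \<rho> * adj B) (q * emat 0 0 * q) + T (D * \<rho> * adj B) (q * emat 1 0 * q)
      + (T (B * \<rho> * adj D) (q * emat 0 1 * q) + T (D * \<rho> * adj D) (q * emat 1 1 * q))"
    using c q by (simp add: mat_distrib_left mat_distrib_right Td sl)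
  also have "\<dots> = T (filter_step H \<rho> u y) q"
  proof -
    have y0: "y \<noteq> 0" using y lam_pos[OF m(1)] by auto
    \<comment> \<open>After projection all four field blocks become multiples of the same
      \<open>q\<close>, so the system parts add up to one matrix, the filter step.\<close>
    have e: "q * emat 0 0 * q = (1 / 2) \<cdot>\<^sub>m q" "q * emat 1 1 * q = (1 / 2) \<cdot>\<^sub>m q"
      "q * emat 0 1 * q = (of_real (sgn y) / 2) \<cdot>\<^sub>m q" "q * emat 1 0 * q = (of_real (sgn y) / 2) \<cdot>\<^sub>m q"
      using hproj_emat_hproj[of 0 0 y] hproj_emat_hproj[of 1 1 y] hproj_emat_hproj[of 0 1 y] hproj_emat_hproj[of 1 0 y] y0
      by (simp_all add: q_def)
    have f: "filter_step H \<rho> u y = (1 / 2 :: complex) \<cdot>\<^sub>m (B * \<rho> * adj B + D * \<rho> * adj D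
     + of_real (sgn y) \<cdot>\<^sub>m (B * \<rho> * adj D + D * \<rho> * adj B))"
      unfolding B_def D_def by (rule filter_step_eq[OF m r y])
    show ?thesis
      unfolding e f using c q Td
      by (intro eq_matI) (simp_all add: Tsm Tadd algebra_simps)
  qed
  finally show ?thesis by (simp add: T_def q_def vac_proj_eq)
qed

definition total_state :: "homodyne \<Rightarrow> complex mat" where
  "total_state H = tensor_list (rho0 H # replicate (nsteps H) vac_proj)"

lemma total_state_carrier: "homodyne_model H \<Longrightarrow> total_state H \<in> ops H"
  unfolding total_state_def using density_matsD(3)[OF rho0_density]
  by (intro tensor_list_hdim) (auto simp: vac_proj_eq)

text \<open>After observing \<open>ys\<close> the system is in the filter state, each observed slot
  in the eigenstate of its outcome, and each slot not yet reached still in the vacuum.\<close>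

definition cond_state :: "homodyne \<Rightarrow> strategy \<Rightarrow> real list \<Rightarrow> complex mat" where
  "cond_state H \<mu> ys = tensor_list (filt H \<mu> (length ys) ys # map hproj ys @ replicate (nsteps H - length ys) vac_proj)"

lemma cond_state_carrier:
  assumes "homodyne_model H" "admissible H \<mu>" "ys \<in> records H l" "l \<le> nsteps H"
  shows "cond_state H \<mu> ys \<in> ops H"
  unfolding cond_state_def using filt_carrier[OF assms(1,2,3), of l] assms(3,4)
  by (intro tensor_list_hdim) (auto simp: vac_proj_eq records_length)

text \<open>Induction on time. Moving the old projector through the controlled step from both sides
  fixes the control and exposes the induction hypothesis; the new projector then acts on slot
  \<open>Suc l\<close> alone, where \<open>interaction_step\<close> applies.\<close>

lemma state_evolution:
  assumes m: "homodyne_model H" "admissible H \<mu>"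
  shows "l \<le> nsteps H \<Longrightarrow> ys \<in> records H l \<Longrightarrow>
    recproj H ys * Uop H \<mu> l * total_state H * adj (Uop H \<mu> l) * recproj H ys
      = of_real (weight H \<mu> l ys) \<cdot>\<^sub>m cond_state H \<mu> ys"
proof (induction l arbitrary: ys)
  case 0
  have "cond_state H \<mu> [] = total_state H" by (simp add: cond_state_def total_state_def)
  thus ?case
    using 0 carrier_matD[OF total_state_carrier[OF m(1)]] by (simp add: recproj_Nil Uop_simps weight_simps del: Uop.simps)
next
  case (Suc l)
  then obtain xs y where ys: "ys = xs @ [y]" and xs: "xs \<in> records H l" and y: "y = lam H \<or> y = - lam H"
    unfolding records_Suc by auto
  have len: "length xs = l" using records_length[OF xs] .
  have l: "l < nsteps H" "1 \<le> Suc l" "Suc l \<le> nsteps H" using Suc.prems by auto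
  let ?D = "total_state H" and ?U = "Uop H \<mu> l" and ?V = "ctrl_step H \<mu> (Suc l)" and ?P = "recproj H xs"
  let ?q = "slot H (Suc l) (hproj y)" and ?u = "\<mu> (Suc l) xs"
  let ?M = "Mstep H (Suc l) ?u"
  have u: "?u \<in> ctrls H" using xs l by (intro admissibleD[OF m(2)]) auto
  have P: "?P \<in> ops H" using len l by (intro recproj_carrier) auto
  note M = Mstep_unitary(2)[OF m(1) u l(2,3)]
  note d = carrier_matD[OF total_state_carrier[OF m(1)]] carrier_matD[OF ctrl_step_carrier[of H \<mu> "Suc l"]]
    carrier_matD[OF P] carrier_matD[OF M]
  have Py: "recproj H ys = ?P * ?q" using recproj_mult_slot[of xs H y] len l by (simp add: ys)
  have Pq: "?P * ?q = ?q * ?P" using len l by (intro recproj_slot_commute) auto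
  have PV: "?P * ?V = ?M * ?P" using ctrl_step_recproj[OF m l(2,3), of xs] xs by simp
  have VP: "adj ?V * ?P = ?P * adj ?M"
  proof -
    have "adj ?V * ?P = adj (?P * ?V)" by (simp add: adjoint_mult d recproj_adjoint)
    also have "\<dots> = ?P * adj ?M" unfolding PV by (simp add: adjoint_mult d recproj_adjoint)
    finally show ?thesis .
  qed
  have "recproj H ys * Uop H \<mu> (Suc l) * ?D * adj (Uop H \<mu> (Suc l)) * recproj H ys
      = ?q * ((?P * ?V) * (?U * (?D * (adj ?U * ((adj ?V * ?P) * ?q)))))"
    unfolding Py Uop_simps by (subst Pq) (simp add: adjoint_mult d mat_mult_assoc)
  also have "\<dots> = ?q * (?M * (?P * ?U * ?D * adj ?U * ?P) * adj ?M) * ?q"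
    unfolding PV VP by (simp add: d mat_mult_assoc)
  also have "?P * ?U * ?D * adj ?U * ?P = of_real (weight H \<mu> l xs) \<cdot>\<^sub>m cond_state H \<mu> xs"
    using Suc.IH[OF _ xs] l by simp
  also have "?q * (?M * (of_real (weight H \<mu> l xs) \<cdot>\<^sub>m cond_state H \<mu> xs) * adj ?M) * ?q
      = of_real (weight H \<mu> l xs) \<cdot>\<^sub>m (?q * (?M * cond_state H \<mu> xs * adj ?M) * ?q)"
    using carrier_matD[OF cond_state_carrier[OF m xs]] l by (simp add: smult_mat_mult d)
  also have "\<dots> = of_real (weight H \<mu> (Suc l) ys) \<cdot>\<^sub>m cond_state H \<mu> ys"
  proof -
    let ?r = "filt H \<mu> l xs" and ?vs = "replicate (nsteps H - Suc l) vac_proj"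
    have r: "?r \<in> M2" using l by (intro filt_carrier[OF m xs]) auto
    have "cond_state H \<mu> xs = tensor_list (?r # map hproj xs @ vac_proj # ?vs)"
      using len l by (simp add: cond_state_def replicate_Suc[symmetric] Suc_diff_Suc)
    moreover have hp: "mats2 (map hproj xs)" by auto
    moreover have vs: "mats2 ?vs" by (auto simp: vac_proj_eq)
    moreover have sz: "Suc (length (map hproj xs) + length ?vs) = nsteps H" using len l by simp
    ultimately have "?q * (?M * cond_state H \<mu> xs * adj ?M) * ?q
        = tensor_list (filter_step H ?r ?u y # map hproj xs @ hproj y # ?vs)"
      using interaction_step[OF m(1) u r hp vs sz y] by (simp only: length_map len)
    moreover have "weight H \<mu> (Suc l) ys = weight H \<mu> l xs * ptrans H ?r ?u y"
      using len by (simp add: weight_simps ys filt_append weight_append uctrl_def nth_append)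
    moreover have "cond_state H \<mu> ys = tensor_list (Gam H ?r ?u y # map hproj xs @ hproj y # ?vs)"
      using len by (simp add: cond_state_def ys filt_append uctrl_def nth_append)
    moreover have "of_real (weight H \<mu> l xs) \<cdot>\<^sub>m tensor_list (filter_step H ?r ?u y # map hproj xs @ hproj y # ?vs)
        = of_real (weight H \<mu> l xs * ptrans H ?r ?u y) \<cdot>\<^sub>m tensor_list (Gam H ?r ?u y # map hproj xs @ hproj y # ?vs)"
    proof (cases "weight H \<mu> l xs = 0")
      case True
      have "tensor_list (X # map hproj xs @ hproj y # ?vs) \<in> ops H" if "X \<in> M2" for X
        using that len l by (intro tensor_list_hdim) (auto simp: vac_proj_eq)
      thus ?thesis
        using True filter_step_carrier[OF m(1) u r] Gam_carrier[OF m(1) u r]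
        by (auto intro!: eq_matI simp: carrier_matD[of _ "hdim H" "hdim H"])
    next
      case False
      hence "0 < weight H \<mu> l xs" using weight_nonneg[OF m xs order_refl] l by simp
      hence dm: "?r \<in> density_mats" using l by (intro filt_density[OF m xs order_refl]) auto
      note G = Gam_carrier[OF m(1) u r, of y]
      have ml: "mats2 (X # map hproj xs @ hproj y # ?vs)" if "X \<in> M2" for X
        using that by (auto simp: vac_proj_eq)
      have "tensor_list (filter_step H ?r ?u y # map hproj xs @ hproj y # ?vs)
          = of_real (ptrans H ?r ?u y) \<cdot>\<^sub>m tensor_list (Gam H ?r ?u y # map hproj xs @ hproj y # ?vs)"
        using tensor_list_update_smult[OF ml[OF G] G, where i = 0 and a = "of_real (ptrans H ?r ?u y)"]
        by (simp add: filter_step_Gam[OF m(1) u dm y])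
      thus ?thesis by (simp add: smult_smult_mat)
    qed
    ultimately show ?thesis by simp
  qed
  finally show ?case .
qed

text \<open>The conditional state is a product and every field factor has trace 1, so only the
  system factor remains.\<close>

lemma mtrace_slot_cond_state:
  assumes m: "homodyne_model H" "admissible H \<mu>" and ys: "ys \<in> records H l" and l: "l \<le> nsteps H"
    and X: "X \<in> M2"
  shows "mtrace (slot H 0 X * cond_state H \<mu> ys) = mtrace (filt H \<mu> l ys * X)"
proof -
  have len: "length ys = l" using records_length[OF ys] .
  have r: "filt H \<mu> l ys \<in> M2" using l by (intro filt_carrier[OF m ys]) auto
  let ?vs = "replicate (nsteps H - l) vac_proj"
  have "slot H 0 X * cond_state H \<mu> ys = tensor_list (X * filt H \<mu> l ys # map hproj ys @ ?vs)"
    unfolding cond_state_def len using len l r X by (subst slot_mult_tensor) (auto simp: vac_proj_eq)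
  moreover have "mats2 (X * filt H \<mu> l ys # map hproj ys @ ?vs)" using r X by (auto simp: vac_proj_eq)
  moreover have "mtrace vac_proj = 1" by (simp add: vac_proj_eq mtrace_mat2 index_emat)
  ultimately have "mtrace (slot H 0 X * cond_state H \<mu> ys) = mtrace (X * filt H \<mu> l ys)"
    by (simp add: mtrace_tensor_list comp_def prod_list_replicate map_replicate_const)
  thus ?thesis using r X mtrace_mult_comm[of X "filt H \<mu> l ys"] by simp
qed

lemma qstate_eq: "qstate H Z = mtrace (total_state H * Z)"
  by (simp add: qstate_def total_state_def)

text \<open>The projector is idempotent and commutes with system operators, so it may be placed on
  both sides of the evolved initial state; cyclicity of the trace then produces the expression of
  \<open>state_evolution\<close>.\<close>

lemma qstate_record:
  assumes m: "homodyne_model H" "admissible H \<mu>" and ys: "ys \<in> records H l" and l: "l \<le> nsteps H"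
    and X: "X \<in> M2"
  shows "qstate H (adj (Uop H \<mu> l) * (slot H 0 X * recproj H ys) * Uop H \<mu> l)
    = of_real (weight H \<mu> l ys) * mtrace (filt H \<mu> l ys * X)"
proof -
  let ?D = "total_state H" and ?U = "Uop H \<mu> l" and ?P = "recproj H ys" and ?X = "slot H 0 X"
  have len: "length ys \<le> nsteps H" using records_length[OF ys] l by simp
  note d = carrier_matD[OF total_state_carrier[OF m(1)]] carrier_matD[OF recproj_carrier[OF len]] dim_slot[OF X]
  have PP: "?P * ?P = ?P" using recproj_mult[OF m(1) ys ys l] by simp
  have PX: "?P * ?X = ?X * ?P" using len X by (intro recproj_slot_commute) auto
  have "?P * (?X * ?P) = ?X * ?P"
    by (simp add: mat_mult_assoc[symmetric] d PX) (simp add: mat_mult_assoc d PP)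
  note PXP = this
  have "?D * (adj ?U * ?P) * (?X * (?P * ?U)) = ?D * (adj ?U * ((?P * (?X * ?P)) * ?U))"
    by (simp add: mat_mult_assoc d)
  also have "\<dots> = ?D * (adj ?U * (?X * ?P) * ?U)"
    unfolding PXP by (simp add: mat_mult_assoc d)
  finally have "?D * (adj ?U * (?X * ?P) * ?U) = ?D * (adj ?U * ?P) * (?X * (?P * ?U))" ..
  hence "qstate H (adj ?U * (?X * ?P) * ?U) = mtrace ((?D * (adj ?U * ?P)) * (?X * (?P * ?U)))"
    by (simp add: qstate_eq)
  also have "\<dots> = mtrace ((?X * (?P * ?U)) * (?D * (adj ?U * ?P)))"
    by (rule mtrace_mult_comm) (simp_all add: d)
  also have "(?X * (?P * ?U)) * (?D * (adj ?U * ?P)) = ?X * (?P * ?U * ?D * adj ?U * ?P)"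
    by (simp add: mat_mult_assoc d)
  also have "mtrace \<dots> = of_real (weight H \<mu> l ys) * mtrace (?X * cond_state H \<mu> ys)"
    unfolding state_evolution[OF m l ys]
    using carrier_matD[OF cond_state_carrier[OF m ys l]] d by (simp add: smult_mat_mult mtrace_smult)
  finally show ?thesis by (simp only: mtrace_slot_cond_state[OF m ys l X])
qed

section \<open>The law of the observation record\<close>

lemma weight_snoc:
  assumes "length ys = l"
  shows "weight H \<mu> (Suc l) (ys @ [y]) = weight H \<mu> l ys * ptrans H (filt H \<mu> l ys) (\<mu> (Suc l) ys) y"
  using assms by (simp add: weight_simps filt_append weight_append uctrl_def nth_append)

lemma filt_snoc:
  assumes "length ys = l"
  shows "filt H \<mu> (Suc l) (ys @ [y]) = Gam H (filt H \<mu> l ys) (\<mu> (Suc l) ys) y"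
  using assms by (simp add: filt_append uctrl_def nth_append)

text \<open>Consistency of the finite-dimensional laws: the transition probabilities at the last
  step sum to 1, on null prefixes as well. It moves expectations between prefixes and full
  records.\<close>

lemma weight_marginal:
  assumes m: "homodyne_model H" and l: "l \<le> n"
  shows "(\<Sum>zs\<in>records H n. weight H \<mu> n zs * f (take l zs)) = (\<Sum>ys\<in>records H l. weight H \<mu> l ys * f ys)"
  using l
proof (induction n rule: dec_induct)
  case base
  show ?case by (intro sum.cong) (auto simp: records_def)
next
  case (step n)
  have "(\<Sum>y\<in>{lam H, - lam H}. weight H \<mu> (Suc n) (ys @ [y]) * f (take l (ys @ [y]))) = weight H \<mu> n ys * f (take l ys)"
    if "ys \<in> records H n" for ys
  proof -
    have len: "length ys = n" using records_length[OF that] .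
    have "(\<Sum>y\<in>{lam H, - lam H}. weight H \<mu> (Suc n) (ys @ [y]) * f (take l (ys @ [y])))
        = weight H \<mu> n ys * f (take l ys) * (\<Sum>y\<in>{lam H, - lam H}. ptrans H (filt H \<mu> n ys) (\<mu> (Suc n) ys) y)"
      unfolding sum_distrib_left using len step by (intro sum.cong) (auto simp: weight_snoc[OF len])
    thus ?thesis by (simp only: ptrans_sum[OF m] mult_1_right)
  qed
  thus ?case using step by (simp add: sum_records_Suc)
qed

lemma sum_weight:
  assumes "homodyne_model H"
  shows "(\<Sum>zs\<in>records H n. weight H \<mu> n zs) = 1"
  using weight_marginal[OF assms, of 0 n \<mu> "\<lambda>_. 1"] by (simp add: weight_simps)

lemma qstate_record_proj:
  assumes m: "homodyne_model H" "admissible H \<mu>" and ys: "ys \<in> records H (nsteps H)"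
  shows "Re (qstate H (mprod (hdim H) (map (\<lambda>l. eigenproj (dY H \<mu> l) (ys ! (l - 1))) [1..<Suc (nsteps H)])))
    = weight H \<mu> (nsteps H) ys"
proof -
  let ?k = "nsteps H"
  have len: "length ys \<le> ?k" using records_length[OF ys] by simp
  have "qstate H (mprod (hdim H) (map (\<lambda>l. eigenproj (dY H \<mu> l) (ys ! (l - 1))) [1..<Suc (nsteps H)]))
      = qstate H (adj (Uop H \<mu> ?k) * (slot H 0 (1\<^sub>m 2) * recproj H ys) * Uop H \<mu> ?k)"
    using recproj_dims[OF len] by (simp only: mprod_eigenproj_dY[OF m ys] slot_one left_mult_one_mat')
  also have "\<dots> = of_real (weight H \<mu> ?k ys) * mtrace (filt H \<mu> ?k ys * 1\<^sub>m 2)"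
    by (rule qstate_record[OF m ys order_refl]) simp
  also have "\<dots> = of_real (weight H \<mu> ?k ys)"
  proof (cases "weight H \<mu> ?k ys = 0")
    \<comment> \<open>Only for positive weight is the filter value known to have trace 1; for weight
      0 the product vanishes.\<close>
    case False
    hence "filt H \<mu> ?k ys \<in> density_mats"
      using weight_nonneg[OF m ys order_refl order_refl] by (intro filt_density[OF m ys]) auto
    thus ?thesis using density_matsD[of "filt H \<mu> ?k ys"] by simp
  qed simp
  finally show ?thesis by simp
qed

text \<open>For \<open>embed_pmf\<close> to return its argument, nonnegativity and total mass 1 must
  be verified; they are \<open>weight_nonneg\<close> and \<open>sum_weight\<close>.\<close>

lemma pmf_record_pmf:
  assumes m: "homodyne_model H" "admissible H \<mu>"
  shows "pmf (record_pmf H \<mu>) ys = (if ys \<in> records H (nsteps H) then weight H \<mu> (nsteps H) ys else 0)"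
proof -
  let ?k = "nsteps H"
  define f where "f ys = (if ys \<in> records H ?k then weight H \<mu> ?k ys else 0)" for ys
  have "record_pmf H \<mu> = embed_pmf f"
    unfolding record_pmf_def f_def hdim_def[symmetric]
    by (intro arg_cong[of _ _ embed_pmf] ext if_cong refl qstate_record_proj[OF m])
  moreover have nn: "0 \<le> f ys" for ys
    using weight_nonneg[OF m _ order_refl order_refl] by (simp add: f_def)
  moreover have "(\<integral>\<^sup>+ys. ennreal (f ys) \<partial>count_space UNIV) = 1"
  proof -
    have "(\<integral>\<^sup>+ys. ennreal (f ys) \<partial>count_space UNIV) = (\<Sum>ys\<in>records H ?k. ennreal (f ys))"
      by (rule nn_integral_count_space') (auto simp: f_def)
    also have "\<dots> = ennreal (\<Sum>ys\<in>records H ?k. f ys)" using nn by (intro sum_ennreal) auto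
    also have "(\<Sum>ys\<in>records H ?k. f ys) = 1" using sum_weight[OF m(1), of \<mu> ?k] by (simp add: f_def)
    finally show ?thesis by simp
  qed
  ultimately show ?thesis by (simp add: pmf_embed_pmf f_def)
qed

lemma set_record_pmf:
  assumes m: "homodyne_model H" "admissible H \<mu>"
  shows "set_pmf (record_pmf H \<mu>) = {ys \<in> records H (nsteps H). 0 < weight H \<mu> (nsteps H) ys}"
  using weight_nonneg[OF m _ order_refl order_refl]
  by (auto simp: set_pmf_eq pmf_record_pmf[OF m] order_less_le)

section \<open>The cost functional\<close>

definition path_cost :: "homodyne \<Rightarrow> strategy \<Rightarrow> nat \<Rightarrow> real list \<Rightarrow> real" where
  "path_cost H \<mu> l ys = (\<Sum>i\<in>{l + 1..nsteps H}.
      Re (mtrace (filt H \<mu> (i - 1) ys * Qcost H (uctrl \<mu> i ys))) * (lam H)\<^sup>2)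
    + Re (mtrace (filt H \<mu> (nsteps H) ys * Kcost H))"

lemma qstate_msum:
  assumes m: "homodyne_model H" and F: "\<And>x. x \<in> S \<Longrightarrow> F x \<in> ops H"
  shows "qstate H (msum (hdim H) F S) = (\<Sum>x\<in>S. qstate H (F x))"
proof -
  note D = total_state_carrier[OF m]
  have "total_state H * msum (hdim H) F S = msum (hdim H) (\<lambda>x. total_state H * F x) S"
    using D F by (intro msum_mult_left) auto
  moreover have "mtrace (msum (hdim H) (\<lambda>x. total_state H * F x) S) = (\<Sum>x\<in>S. mtrace (total_state H * F x))"
    using D F by (intro mtrace_msum) auto
  ultimately show ?thesis by (simp only: qstate_eq)
qed

lemma qstate_jflow_msum:
  assumes m: "homodyne_model H" "admissible H \<mu>" and l: "l \<le> nsteps H"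
    and X: "\<And>ys. ys \<in> records H l \<Longrightarrow> X ys \<in> M2"
  shows "qstate H (jflow H \<mu> l (msum (hdim H) (\<lambda>ys. slot H 0 (X ys) * recproj H ys) (records H l)))
    = (\<Sum>ys\<in>records H l. of_real (weight H \<mu> l ys) * mtrace (filt H \<mu> l ys * X ys))"
proof -
  let ?U = "Uop H \<mu> l"
  have P: "slot H 0 (X ys) * recproj H ys \<in> ops H" if "ys \<in> records H l" for ys
    using recproj_carrier[of ys H] records_length[OF that] X[OF that] l by simp
  have "jflow H \<mu> l (msum (hdim H) (\<lambda>ys. slot H 0 (X ys) * recproj H ys) (records H l))
      = msum (hdim H) (\<lambda>ys. adj ?U * (slot H 0 (X ys) * recproj H ys)) (records H l) * ?U"
    unfolding jflow_def using P by (subst msum_mult_left) auto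
  also have "\<dots> = msum (hdim H) (\<lambda>ys. adj ?U * (slot H 0 (X ys) * recproj H ys) * ?U) (records H l)"
    using P by (intro msum_mult_right) auto
  finally have "qstate H (jflow H \<mu> l (msum (hdim H) (\<lambda>ys. slot H 0 (X ys) * recproj H ys) (records H l)))
      = (\<Sum>ys\<in>records H l. qstate H (adj ?U * (slot H 0 (X ys) * recproj H ys) * ?U))"
    using P by (simp only:) (intro qstate_msum[OF m(1)], auto)
  also have "\<dots> = (\<Sum>ys\<in>records H l. of_real (weight H \<mu> l ys) * mtrace (filt H \<mu> l ys * X ys))"
    by (intro sum.cong refl qstate_record[OF m _ l] X)
  finally show ?thesis .
qed

lemma Jcost_eq:
  assumes m: "homodyne_model H" "admissible H \<mu>"
  shows "Jcost H \<mu> = (\<Sum>ys\<in>records H (nsteps H). weight H \<mu> (nsteps H) ys * path_cost H \<mu> 0 ys)"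
proof -
  let ?k = "nsteps H" and ?N = "hdim H"
  have Kc: "Kcost H \<in> M2" using m(1) by (simp add: homodyne_model_def nonneg_mat_def)
  let ?F = "\<lambda>l. jflow H \<mu> (l - 1) (at_ctrl H \<mu> l (\<lambda>u. slot H 0 (Qcost H u))) * dt H l"
  have jc: "jflow H \<mu> l X \<in> ops H" if "X \<in> ops H" for l X
    using that by (simp add: jflow_def)
  have ac: "at_ctrl H \<mu> l F \<in> ops H" for l F
    unfolding at_ctrl_def hdim_def[symmetric] by simp
  have F: "?F l \<in> ops H" for l using jc[OF ac] by (simp add: dt_eq)
  have run: "Re (qstate H (?F l)) = (\<Sum>ys\<in>records H ?k. weight H \<mu> ?k ys *
      (Re (mtrace (filt H \<mu> (l - 1) ys * Qcost H (uctrl \<mu> l ys))) * (lam H)\<^sup>2))" if l: "l \<in> {1..?k}" for l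
  proof -
    have l': "1 \<le> l" "l \<le> ?k" "l - 1 \<le> ?k" using l by auto
    let ?A = "jflow H \<mu> (l - 1) (at_ctrl H \<mu> l (\<lambda>u. slot H 0 (Qcost H u)))"
    have "?F l = lamsq H \<cdot>\<^sub>m ?A"
      using jc[OF ac, of "l - 1" l "\<lambda>u. slot H 0 (Qcost H u)"]
      by (simp add: dt_eq smult_mat_mult carrier_matD[OF jc[OF ac]] del: of_real_power)
    hence "qstate H (?F l) = lamsq H * qstate H ?A"
      using carrier_matD[OF jc[OF ac]] carrier_matD[OF total_state_carrier[OF m(1)]]
      by (simp add: qstate_eq smult_mat_mult mtrace_smult del: of_real_power)
    also have "qstate H ?A
        = (\<Sum>ys\<in>records H (l - 1). of_real (weight H \<mu> (l - 1) ys) * mtrace (filt H \<mu> (l - 1) ys * Qcost H (\<mu> l ys)))"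
    proof -
      have "at_ctrl H \<mu> l (\<lambda>u. slot H 0 (Qcost H u))
          = msum ?N (\<lambda>ys. slot H 0 (Qcost H (\<mu> l ys)) * recproj H ys) (records H (l - 1))"
        using model_ctrlD(6)[OF m(1)] by (intro at_ctrl_eq[OF m l'(1,2)]) simp
      thus ?thesis
        using l' model_ctrlD(6)[OF m(1)] admissibleD[OF m(2) l'(1,2)]
        by (simp only:) (intro qstate_jflow_msum m, auto)
    qed
    finally have "Re (qstate H (?F l)) = (\<Sum>ys\<in>records H (l - 1). weight H \<mu> (l - 1) ys *
        (Re (mtrace (filt H \<mu> (l - 1) ys * Qcost H (\<mu> l ys))) * (lam H)\<^sup>2))"
      by (simp add: sum_distrib_left mult_ac del: of_real_power)
    \<comment> \<open>The running cost at time \<open>l\<close> depends on \<open>l - 1\<close>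
      observations. Lifting every such term to full records puts all times under one measure, so
      that the sums can be interchanged.\<close>
    also have "\<dots> = (\<Sum>ys\<in>records H ?k. weight H \<mu> ?k ys *
        (Re (mtrace (filt H \<mu> (l - 1) (take (l - 1) ys) * Qcost H (\<mu> l (take (l - 1) ys)))) * (lam H)\<^sup>2))"
      by (rule weight_marginal[OF m(1) l'(3), symmetric])
    finally show ?thesis by (simp add: filt_take uctrl_def)
  qed
  have fin: "Re (qstate H (jflow H \<mu> ?k (slot H 0 (Kcost H)))) =
      (\<Sum>ys\<in>records H ?k. weight H \<mu> ?k ys * Re (mtrace (filt H \<mu> ?k ys * Kcost H)))"
  proof -
    \<comment> \<open>Inserting the resolution of the identity gives the terminal cost the same
      record-wise form as the running costs.\<close>
    have "slot H 0 (Kcost H) = slot H 0 (Kcost H) * msum ?N (recproj H) (records H ?k)"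
      using Kc by (simp add: msum_recproj[OF m(1)])
    also have "\<dots> = msum ?N (\<lambda>ys. slot H 0 (Kcost H) * recproj H ys) (records H ?k)"
      using Kc recproj_carrier[of _ H] records_length[of _ H ?k] by (intro msum_mult_left) auto
    finally have "qstate H (jflow H \<mu> ?k (slot H 0 (Kcost H)))
        = (\<Sum>ys\<in>records H ?k. of_real (weight H \<mu> ?k ys) * mtrace (filt H \<mu> ?k ys * Kcost H))"
      using qstate_jflow_msum[OF m order_refl, of "\<lambda>_. Kcost H"] Kc by simp
    thus ?thesis by simp
  qed
  have "qstate H (msum ?N ?F {1..?k} + jflow H \<mu> ?k (slot H 0 (Kcost H)))
      = (\<Sum>l\<in>{1..?k}. qstate H (?F l)) + qstate H (jflow H \<mu> ?k (slot H 0 (Kcost H)))"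
    unfolding qstate_msum[OF m(1) F, symmetric]
    using carrier_matD[OF total_state_carrier[OF m(1)]] carrier_matD[OF jc[OF slot_carrier[OF Kc]]]
    by (simp add: qstate_eq mat_distrib_left mtrace_add)
  hence "Jcost H \<mu> = (\<Sum>l\<in>{1..?k}. Re (qstate H (?F l))) + Re (qstate H (jflow H \<mu> ?k (slot H 0 (Kcost H))))"
    unfolding Jcost_def hdim_def[symmetric] by simp
  also have "(\<Sum>l\<in>{1..?k}. Re (qstate H (?F l))) = (\<Sum>l\<in>{1..?k}. \<Sum>ys\<in>records H ?k. weight H \<mu> ?k ys *
      (Re (mtrace (filt H \<mu> (l - 1) ys * Qcost H (uctrl \<mu> l ys))) * (lam H)\<^sup>2))"
    by (intro sum.cong refl run)
  also have "\<dots> = (\<Sum>ys\<in>records H ?k. \<Sum>l\<in>{1..?k}. weight H \<mu> ?k ys *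
      (Re (mtrace (filt H \<mu> (l - 1) ys * Qcost H (uctrl \<mu> l ys))) * (lam H)\<^sup>2))"
    by (rule sum.swap)
  finally show ?thesis
    unfolding fin path_cost_def by (simp add: distrib_left sum.distrib sum_distrib_left)
qed

section \<open>Verification\<close>

text \<open>The expected cost from time \<open>l\<close> on, restricted to the event that the first
  \<open>l\<close> observations are \<open>ys\<close>: a conditional expectation times the
  probability of the prefix, defined for null prefixes too.\<close>

definition tail_cost :: "homodyne \<Rightarrow> strategy \<Rightarrow> nat \<Rightarrow> real list \<Rightarrow> real" where
  "tail_cost H \<mu> l ys = (\<Sum>zs\<in>{zs \<in> records H (nsteps H). take l zs = ys}.
     weight H \<mu> (nsteps H) zs * path_cost H \<mu> l zs)"

lemma weight_eq_sum_extensions: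
  assumes "homodyne_model H" "l \<le> nsteps H" "ys \<in> records H l"
  shows "(\<Sum>zs\<in>{zs \<in> records H (nsteps H). take l zs = ys}. weight H \<mu> (nsteps H) zs) = weight H \<mu> l ys"
proof -
  have "(\<Sum>zs\<in>{zs \<in> records H (nsteps H). take l zs = ys}. weight H \<mu> (nsteps H) zs)
      = (\<Sum>zs\<in>records H (nsteps H). weight H \<mu> (nsteps H) zs * of_bool (take l zs = ys))"
    unfolding sum.inter_filter[OF finite_records] by (intro sum.cong) auto
  also have "\<dots> = (\<Sum>xs\<in>records H l. weight H \<mu> l xs * of_bool (xs = ys))"
    by (rule weight_marginal[OF assms(1,2)])
  also have "\<dots> = (\<Sum>xs\<in>records H l. if xs = ys then weight H \<mu> l xs else 0)"
    by (intro sum.cong) auto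
  finally show ?thesis using assms(3) by simp
qed

text \<open>The dynamic programming equation of a fixed strategy. On all extensions of
  \<open>ys\<close> the next running cost is constant, and the remaining cost splits according to
  the next observation.\<close>

lemma tail_cost_step:
  assumes m: "homodyne_model H" and l: "l < nsteps H" and ys: "ys \<in> records H l"
  shows "tail_cost H \<mu> l ys = weight H \<mu> l ys * (Re (mtrace (filt H \<mu> l ys * Qcost H (\<mu> (Suc l) ys))) * (lam H)\<^sup>2)
    + (\<Sum>y\<in>{lam H, - lam H}. tail_cost H \<mu> (Suc l) (ys @ [y]))"
proof -
  let ?k = "nsteps H" and ?q = "Re (mtrace (filt H \<mu> l ys * Qcost H (\<mu> (Suc l) ys))) * (lam H)\<^sup>2"
  let ?E = "{zs \<in> records H ?k. take l zs = ys}"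
  have len: "length ys = l" using records_length[OF ys] .
  have pc: "path_cost H \<mu> l zs = ?q + path_cost H \<mu> (Suc l) zs" if "zs \<in> ?E" for zs
  proof -
    have "{l + 1..?k} = insert (Suc l) {Suc l + 1..?k}" using l by auto
    moreover have "filt H \<mu> l zs = filt H \<mu> l ys" using that filt_take[of l l H \<mu> zs] by auto
    moreover have "uctrl \<mu> (Suc l) zs = \<mu> (Suc l) ys" using that by (auto simp: uctrl_def)
    ultimately show ?thesis by (simp add: path_cost_def)
  qed
  have "tail_cost H \<mu> l ys = (\<Sum>zs\<in>?E. weight H \<mu> ?k zs * ?q + weight H \<mu> ?k zs * path_cost H \<mu> (Suc l) zs)"
    unfolding tail_cost_def by (intro sum.cong refl) (simp add: pc distrib_left)
  also have "\<dots> = (\<Sum>zs\<in>?E. weight H \<mu> ?k zs) * ?q + (\<Sum>zs\<in>?E. weight H \<mu> ?k zs * path_cost H \<mu> (Suc l) zs)"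
    by (simp add: sum.distrib sum_distrib_right)
  also have "(\<Sum>zs\<in>?E. weight H \<mu> ?k zs) = weight H \<mu> l ys"
    using l by (intro weight_eq_sum_extensions m ys) auto
  also have "(\<Sum>zs\<in>?E. weight H \<mu> ?k zs * path_cost H \<mu> (Suc l) zs)
      = (\<Sum>y\<in>{lam H, - lam H}. \<Sum>zs\<in>{zs \<in> ?E. zs ! l = y}. weight H \<mu> ?k zs * path_cost H \<mu> (Suc l) zs)"
    by (rule sum.group[symmetric]) (use records_nth[of _ H ?k l] l in auto)
  also have "\<dots> = (\<Sum>y\<in>{lam H, - lam H}. tail_cost H \<mu> (Suc l) (ys @ [y]))"
  proof (rule sum.cong[OF refl])
    fix y
    have "take (Suc l) zs = ys @ [y] \<longleftrightarrow> take l zs = ys \<and> zs ! l = y" if "zs \<in> records H ?k" for zs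
      using records_length[OF that] l len by (auto simp: take_Suc_conv_app_nth)
    hence "{zs \<in> ?E. zs ! l = y} = {zs \<in> records H ?k. take (Suc l) zs = ys @ [y]}" by blast
    thus "(\<Sum>zs\<in>{zs \<in> ?E. zs ! l = y}. weight H \<mu> ?k zs * path_cost H \<mu> (Suc l) zs) = tail_cost H \<mu> (Suc l) (ys @ [y])"
      by (simp only: tail_cost_def)
  qed
  finally show ?thesis .
qed

text \<open>Backward induction, run once for the inequality (arbitrary strategies) and once for the
  equality (optimal strategies).\<close>

lemma value_tail_cost:
  fixes R :: "real \<Rightarrow> real \<Rightarrow> bool"
  assumes R: "R = (\<le>) \<or> R = (=)"
    and m: "homodyne_model H" "admissible H \<mu>"
    and V_final: "\<And>\<rho>. \<rho> \<in> density_mats \<Longrightarrow> V (nsteps H) \<rho> = Re (mtrace (\<rho> * Kcost H))"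
    and V_step: "\<And>l ys. l < nsteps H \<Longrightarrow> ys \<in> records H l \<Longrightarrow> 0 < weight H \<mu> l ys \<Longrightarrow>
      R (V l (filt H \<mu> l ys)) (bellman H V l (filt H \<mu> l ys) (\<mu> (Suc l) ys))"
    and l: "l \<le> nsteps H" and ys: "ys \<in> records H l"
  shows "R (weight H \<mu> l ys * V l (filt H \<mu> l ys)) (tail_cost H \<mu> l ys)"
  using l ys
proof (induction l arbitrary: ys rule: inc_induct)
  case base
  let ?k = "nsteps H"
  have "{zs \<in> records H ?k. take ?k zs = ys} = {ys}" using base by (auto simp: records_def)
  hence t: "tail_cost H \<mu> ?k ys = weight H \<mu> ?k ys * Re (mtrace (filt H \<mu> ?k ys * Kcost H))"
    by (simp add: tail_cost_def path_cost_def)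
  have "weight H \<mu> ?k ys * V ?k (filt H \<mu> ?k ys) = tail_cost H \<mu> ?k ys"
  proof (cases "weight H \<mu> ?k ys = 0")
    case False
    hence "filt H \<mu> ?k ys \<in> density_mats"
      using weight_nonneg[OF m base order_refl order_refl] by (intro filt_density[OF m base]) auto
    thus ?thesis by (simp add: t V_final)
  qed (simp add: t)
  thus ?case using R by auto
next
  case (step l)
  let ?w = "weight H \<mu> l ys" and ?r = "filt H \<mu> l ys" and ?u = "\<mu> (Suc l) ys"
  have len: "length ys = l" using records_length[OF step.prems] .
  have w0: "0 \<le> ?w" using step by (intro weight_nonneg[OF m step.prems]) auto
  have Rw: "R (?w * V l ?r) (?w * bellman H V l ?r ?u)"
  proof (cases "?w = 0")
    case False
    thus ?thesis using V_step[OF step.hyps(2) step.prems] w0 R by (auto intro: mult_left_mono)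
  qed (use R in auto)
  \<comment> \<open>Multiplied by the weight, each transition term of the Bellman bracket becomes
    the weighted value at the extended prefix. A null outcome gets weight 0, whatever
    \<open>V\<close> is at the matrix that \<open>Gam\<close> returns there.\<close>
  have w: "?w * bellman H V l ?r ?u = ?w * (Re (mtrace (?r * Qcost H ?u)) * (lam H)\<^sup>2)
      + (\<Sum>y\<in>{lam H, - lam H}. weight H \<mu> (Suc l) (ys @ [y]) * V (Suc l) (filt H \<mu> (Suc l) (ys @ [y])))"
    unfolding bellman_def distrib_left sum_distrib_left weight_snoc[OF len] filt_snoc[OF len] by (simp only: mult.assoc)
  have each: "R (weight H \<mu> (Suc l) (ys @ [y]) * V (Suc l) (filt H \<mu> (Suc l) (ys @ [y]))) (tail_cost H \<mu> (Suc l) (ys @ [y]))"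
    if "y \<in> {lam H, - lam H}" for y
    using that step.prems by (intro step.IH) (auto simp: records_def)
  from R have "R (\<Sum>y\<in>{lam H, - lam H}. weight H \<mu> (Suc l) (ys @ [y]) * V (Suc l) (filt H \<mu> (Suc l) (ys @ [y])))
      (\<Sum>y\<in>{lam H, - lam H}. tail_cost H \<mu> (Suc l) (ys @ [y]))"
  proof
    assume e: "R = (\<le>)"
    show ?thesis unfolding e by (rule sum_mono) (use each in \<open>simp only: e\<close>)
  next
    assume e: "R = (=)"
    show ?thesis unfolding e by (rule sum.cong[OF refl]) (use each in \<open>simp only: e\<close>)
  qed
  hence "R (?w * bellman H V l ?r ?u) (tail_cost H \<mu> l ys)"
    unfolding w tail_cost_step[OF m(1) step.hyps(2) step.prems] using R by auto
  with Rw show ?case using R by auto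
qed

lemma tail_cost_0:
  assumes "homodyne_model H" "admissible H \<mu>"
  shows "tail_cost H \<mu> 0 [] = Jcost H \<mu>"
  by (simp add: tail_cost_def Jcost_eq[OF assms])

text \<open>Several prefixes may lead to the same state \<open>\<rho>\<close>. The value depends on
  \<open>\<rho>\<close> alone, so it factors out of the sum over these prefixes, and their total
  weight is the probability conditioned upon.\<close>

lemma cost_to_go_eq:
  assumes m: "homodyne_model H" "admissible H \<mu>" and l: "l \<le> nsteps H"
    and tail: "\<And>ys. ys \<in> records H l \<Longrightarrow> weight H \<mu> l ys * V l (filt H \<mu> l ys) = tail_cost H \<mu> l ys"
    and pos: "0 < measure_pmf.prob (record_pmf H \<mu>) {ys. filt H \<mu> l ys = \<rho>}"
  shows "V l \<rho> = cost_to_go H \<mu> l \<rho>"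
proof -
  let ?k = "nsteps H" and ?p = "record_pmf H \<mu>" and ?S = "{ys. filt H \<mu> l ys = \<rho>}"
  let ?A = "{zs \<in> records H ?k. filt H \<mu> l zs = \<rho>}" and ?B = "{ys \<in> records H l. filt H \<mu> l ys = \<rho>}"
  have group: "(\<Sum>zs\<in>?A. h zs) = (\<Sum>ys\<in>?B. \<Sum>zs\<in>{zs \<in> records H ?k. take l zs = ys}. h zs)" for h :: "real list \<Rightarrow> real"
  proof -
    have "(\<Sum>zs\<in>?A. h zs) = (\<Sum>ys\<in>?B. \<Sum>zs\<in>{zs \<in> ?A. take l zs = ys}. h zs)"
      by (rule sum.group[symmetric]) (use l in \<open>auto simp: filt_take intro: records_take\<close>)
    also have "\<dots> = (\<Sum>ys\<in>?B. \<Sum>zs\<in>{zs \<in> records H ?k. take l zs = ys}. h zs)"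
    proof (rule sum.cong[OF refl])
      fix ys assume "ys \<in> ?B"
      hence "{zs \<in> ?A. take l zs = ys} = {zs \<in> records H ?k. take l zs = ys}"
        using filt_take[of l l H \<mu>] by auto
      thus "(\<Sum>zs\<in>{zs \<in> ?A. take l zs = ys}. h zs) = (\<Sum>zs\<in>{zs \<in> records H ?k. take l zs = ys}. h zs)" by simp
    qed
    finally show ?thesis .
  qed
  have P: "measure_pmf.prob ?p ?S = (\<Sum>ys\<in>?B. weight H \<mu> l ys)"
  proof -
    \<comment> \<open>Lists that are not records carry no mass, so the event may be cut down to a
      finite set.\<close>
    have "measure_pmf.prob ?p ?S = measure_pmf.prob ?p ?A"
      by (rule measure_prob_cong_0) (auto simp: pmf_record_pmf[OF m])
    also have "\<dots> = (\<Sum>zs\<in>?A. weight H \<mu> ?k zs)"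
      by (subst measure_measure_pmf_finite) (auto simp: pmf_record_pmf[OF m] intro!: sum.cong)
    also have "\<dots> = (\<Sum>ys\<in>?B. weight H \<mu> l ys)"
      unfolding group using l by (intro sum.cong refl weight_eq_sum_extensions m) auto
    finally show ?thesis .
  qed
  have ne: "set_pmf ?p \<inter> ?S \<noteq> {}" using pos by (metis measure_pmf_zero_iff less_irrefl)
  have "cost_to_go H \<mu> l \<rho> = (\<Sum>zs\<in>?A. pmf (cond_pmf ?p ?S) zs * path_cost H \<mu> l zs)"
    unfolding cost_to_go_def path_cost_def[symmetric]
    by (subst integral_measure_pmf[of ?A]) (auto simp: set_cond_pmf[OF ne] set_record_pmf[OF m])
  also have "\<dots> = (\<Sum>zs\<in>?A. weight H \<mu> ?k zs * path_cost H \<mu> l zs) / measure_pmf.prob ?p ?S"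
    unfolding sum_divide_distrib by (intro sum.cong) (auto simp: pmf_cond[OF ne] pmf_record_pmf[OF m])
  also have "(\<Sum>zs\<in>?A. weight H \<mu> ?k zs * path_cost H \<mu> l zs) = (\<Sum>ys\<in>?B. tail_cost H \<mu> l ys)"
    by (simp only: group tail_cost_def)
  also have "\<dots> = (\<Sum>ys\<in>?B. weight H \<mu> l ys) * V l \<rho>"
    unfolding sum_distrib_right using tail by (intro sum.cong) auto
  finally show ?thesis using pos by (simp add: P)
qed

theorem lemma8p4:
  fixes H :: homodyne
    and V :: "nat \<Rightarrow> complex mat \<Rightarrow> real"
    and g :: "nat \<Rightarrow> complex mat \<Rightarrow> real"
    and \<mu>s :: strategy
  assumes model: "homodyne_model H"
    and V_final: "\<forall>\<rho>\<in>density_mats. V (nsteps H) \<rho> = Re (mtrace (\<rho> * Kcost H))"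
    and V_step: "\<forall>l<nsteps H. \<forall>\<rho>\<in>density_mats. V l \<rho> = (INF u\<in>ctrls H. bellman H V l \<rho> u)"
    and attained: "\<forall>l<nsteps H. \<forall>\<rho>\<in>density_mats. \<exists>u\<in>ctrls H.
      bellman H V l \<rho> u = (INF u\<in>ctrls H. bellman H V l \<rho> u)"
    and sep: "separated H g \<mu>s"
    and minimizer: "\<forall>l<nsteps H. \<forall>\<rho>\<in>density_mats.
      is_arg_min (bellman H V l \<rho>) (\<lambda>u. u \<in> ctrls H) (g l \<rho>)"
  shows "(\<forall>\<mu>. admissible H \<mu> \<longrightarrow> Jcost H \<mu>s \<le> Jcost H \<mu>) \<and>
    (\<forall>l\<le>nsteps H. \<forall>\<rho>. measure_pmf.prob (record_pmf H \<mu>s) {ys. filt H \<mu>s l ys = \<rho>} > 0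
        \<longrightarrow> V l \<rho> = cost_to_go H \<mu>s l \<rho>) \<and>
    V 0 (rho0 H) = Jcost H \<mu>s"
proof -
  let ?k = "nsteps H"
  have adm: "admissible H \<mu>s" using sep by (simp add: separated_def)
  have min: "bellman H V l \<rho> (g l \<rho>) \<le> bellman H V l \<rho> u" and gc: "g l \<rho> \<in> ctrls H"
    if "l < ?k" "\<rho> \<in> density_mats" "u \<in> ctrls H" for l \<rho> u
    using minimizer that by (auto simp: is_arg_min_def not_less)
  have Vg: "V l \<rho> = bellman H V l \<rho> (g l \<rho>)" if "l < ?k" "\<rho> \<in> density_mats" for l \<rho>
  proof -
    obtain u where "u \<in> ctrls H" using model by (auto simp: homodyne_model_def)
    \<comment> \<open>An element of the set that bounds it from below is its infimum, which also
      settles boundedness in the reals.\<close>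
    hence "(INF u\<in>ctrls H. bellman H V l \<rho> u) = bellman H V l \<rho> (g l \<rho>)"
      using min[OF that] gc[OF that] by (intro cInf_eq_minimum) auto
    thus ?thesis using V_step that by simp
  qed
  have dens: "filt H \<mu> l ys \<in> density_mats"
    if "admissible H \<mu>" "l < ?k" "ys \<in> records H l" "0 < weight H \<mu> l ys" for \<mu> l ys
    using that by (intro filt_density[OF model that(1,3)]) auto
  have lower: "V 0 (rho0 H) \<le> Jcost H \<mu>" if adm': "admissible H \<mu>" for \<mu>
  proof -
    have "weight H \<mu> 0 [] * V 0 (filt H \<mu> 0 []) \<le> tail_cost H \<mu> 0 []"
    proof (rule value_tail_cost[of "(\<le>)"])
      fix l ys assume l: "l < ?k" and ys: "ys \<in> records H l" and w: "0 < weight H \<mu> l ys"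
      have "\<mu> (Suc l) ys \<in> ctrls H" using l ys by (intro admissibleD[OF adm']) auto
      thus "V l (filt H \<mu> l ys) \<le> bellman H V l (filt H \<mu> l ys) (\<mu> (Suc l) ys)"
        using Vg min l dens[OF adm' l ys w] by simp
    qed (use model adm' V_final in auto)
    thus ?thesis by (simp add: weight_simps tail_cost_0[OF model adm'])
  qed
  have opt: "weight H \<mu>s l ys * V l (filt H \<mu>s l ys) = tail_cost H \<mu>s l ys"
    if "l \<le> ?k" "ys \<in> records H l" for l ys
  proof (rule value_tail_cost[of "(=)"])
    fix l ys assume l: "l < ?k" and ys: "ys \<in> records H l" and w: "0 < weight H \<mu>s l ys"
    \<comment> \<open>\<open>separated\<close> speaks only of full records of positive probability.
      A prefix of positive weight has an extension of this kind, through which the control on the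
      prefix is identified with \<open>g\<close>.\<close>
    have "(\<Sum>zs\<in>{zs \<in> records H ?k. take l zs = ys}. weight H \<mu>s ?k zs) \<noteq> 0"
      using weight_eq_sum_extensions[OF model _ ys] l w by simp
    then obtain zs where zs: "zs \<in> records H ?k" "take l zs = ys" "weight H \<mu>s ?k zs \<noteq> 0"
      by (metis (mono_tags, lifting) mem_Collect_eq sum.neutral)
    hence "zs \<in> set_pmf (record_pmf H \<mu>s)"
      using weight_nonneg[OF model adm zs(1) order_refl order_refl] by (simp add: set_record_pmf[OF model adm])
    moreover have "Suc l \<in> {1..?k}" using l by simp
    ultimately have "uctrl \<mu>s (Suc l) zs = g l (filt H \<mu>s l zs)"
      using sep unfolding separated_def by (metis diff_Suc_1)
    hence "\<mu>s (Suc l) ys = g l (filt H \<mu>s l ys)"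
      using zs(2) filt_take[of l l H \<mu>s zs] by (simp add: uctrl_def)
    thus "V l (filt H \<mu>s l ys) = bellman H V l (filt H \<mu>s l ys) (\<mu>s (Suc l) ys)"
      using Vg[OF l dens[OF adm l ys w]] by simp
  qed (use model adm V_final that in auto)
  have V0: "V 0 (rho0 H) = Jcost H \<mu>s"
    using opt[of 0 "[]"] by (simp add: weight_simps tail_cost_0[OF model adm])
  have ctg: "V l \<rho> = cost_to_go H \<mu>s l \<rho>"
    if "l \<le> ?k" "0 < measure_pmf.prob (record_pmf H \<mu>s) {ys. filt H \<mu>s l ys = \<rho>}" for l \<rho>
    by (rule cost_to_go_eq[where V = V, OF model adm that(1) opt[OF that(1)] that(2)])
  show ?thesis using lower ctg by (simp add: V0)
qed

end
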